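(* Let $\mathcal X^\star\in\mathbb R^{d_1\times\cdots\times d_N}$ be a tensor with tensor train ranks $\mathbf r=(r_1,\dots,r_{N-1})$, $\overline r=\max_i r_i$, with left-orthogonal factors $\{\mathbf X_i^\star\}$; let $\mathbf s\in\mathbb R^m$ be an outlier vector with fraction of nonzero entries $p_s=\|\mathbf s\|_0/m$, $\mathcal A(\mathcal X)=(\langle\mathcal A_k,\mathcal X\rangle)_{k=1}^m$ a linear map $\mathbb R^{d_1\times\cdots\times d_N}\to\mathbb R^m$, and $\mathbf y=\mathcal A(\mathcal X^\star)+\mathbf s$. Assume $\mathcal A$ obeys the $\ell_1/\ell_2$-RIP and sharpness (as defined in the context) with a constant $\delta_{(N+1)\overline r}\le(1-2p_s)\sqrt{2/\pi}$. Let $$b=\frac{\underline\sigma^4(\mathcal X^\star)\left((1-2p_s)\sqrt{2/\pi}-\delta_{(N+1)\overline r}\right)^2}{144(2N^2-2N+1)\left(N+1+\sum_{i=2}^{N-1}r_i\right)^2(\sqrt{2/\pi}+\delta_{(N+1)\overline r})^2\,\overline\sigma^2(\mathcal X^\star)},\qquad \mathcal C(b)=\{\mathcal X:\|\mathcal X-\mathcal X^\star\|_F^2\le b\}.$$ Let $\mathcal X=[\mathbf X_1,\dots,\mathbf X_N]\in\mathcal C(b)$ be in tensor train format with ranks $\mathbf r$ and left-orthogonal factors $\{\mathbf X_i\}$, and let $F(\mathbf X_1,\dots,\mathbf X_N)=\frac1m\|\mathcal A([\mathbf X_1,\dots,\mathbf X_N])-\mathbf y\|_1$. Then, with $\mathbf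 R_1,\dots,\mathbf R_{N-1}$ the orthogonal matrices attaining the minimum in the definition of $\operatorname{dist}(\{\mathbf X_i\},\{\mathbf X_i^\star\})$, $$\sum_{i=1}^N\left\langle L(\mathbf X_i)-L_{\mathbf R}(\mathbf X_i^\star),\ \mathcal P_{\mathrm T_{L(\mathbf X_i)}\mathrm{St}}\left(\partial_{L(\mathbf X_i)}F(\mathbf X_1,\dots,\mathbf X_N)\right)\right\rangle\ \ge\ \frac{(1-2p_s)\sqrt{2/\pi}-\delta_{(N+1)\overline r}}{4\sqrt{2\left(N+1+\sum_{i=2}^{N-1}r_i\right)}\,\kappa(\mathcal X^\star)}\operatorname{dist}(\{\mathbf X_i\},\{\mathbf X_i^\star\}),$$ where $\mathcal P_{\mathrm T_{L(\mathbf X_N)}\mathrm{St}}$ denotes the identity operator.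
   Context: TT format: for factors $\mathbf X_i\in\mathbb R^{r_{i-1}\times d_i\times r_i}$, $i=1,\dots,N$ ($N\ge2$, $r_0=r_N=1$), $[\mathbf X_1,\dots,\mathbf X_N]$ is the tensor $\mathcal X\in\mathbb R^{d_1\times\cdots\times d_N}$ with $\mathcal X(s_1,\dots,s_N)=\mathbf X_1(s_1)\cdots\mathbf X_N(s_N)$, $\mathbf X_i(s_i)=\mathbf X_i(:,s_i,:)\in\mathbb R^{r_{i-1}\times r_i}$; such $\mathcal X$ is said to be in TT format with ranks $\mathbf r$. The left unfolding $L(\mathbf X_i)\in\mathbb R^{d_ir_{i-1}\times r_i}$ stacks $\mathbf X_i(1),\dots,\mathbf X_i(d_i)$ vertically. Factors are left-orthogonal if $L(\mathbf X_i)^\top L(\mathbf X_i)=\mathbf I_{r_i}$ for $i=1,\dots,N-1$. The $i$-th unfolding $\mathcal X^{\langle i\rangle}$ groups the first $i$ indices as rows and the rest as columns; the TT ranks of $\mathcal X^\star$ are $r_i=\operatorname{rank}\mathcal X^{\star\langle i\rangle}$. $\underline\sigma(\mathcal X^\star)=\min_{i\le N-1}\sigma_{r_i}(\mathcal X^{\star\langle i\rangle})$, $\overline\sigma(\mathcal X^\star)=\max_{i\le N-1}\sigma_1(\mathcal X^{\star\langle i\rangle})$, $\kappa(\mathcal X^\star)=\overline\sigma(\mathcal X^\star)/\underline\sigma(\mathcal X^\star)$. Distance: for orthogonal matrices $\mathbf R_i\in\mathbb R^{r_i\times r_i}$, $i\in[N-1]$, and $\mathbf R_0=\mathbf R_N=1$,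 $L_{\mathbf R}(\mathbf X_i^\star)$ stacks $\mathbf R_{i-1}^\top\mathbf X_i^\star(s)\mathbf R_i$, $s=1,\dots,d_i$, vertically, and $$\operatorname{dist}^2(\{\mathbf X_i\},\{\mathbf X_i^\star\})=\min_{\mathbf R_1,\dots,\mathbf R_{N-1}}\sum_{i=1}^{N-1}\overline\sigma^2(\mathcal X^\star)\|L(\mathbf X_i)-L_{\mathbf R}(\mathbf X_i^\star)\|_F^2+\|L(\mathbf X_N)-L_{\mathbf R}(\mathbf X_N^\star)\|_2^2.$$ Subgradient: $\partial_{L(\mathbf X_i)}F$ stacks vertically, over $s_i=1,\dots,d_i$, the matrices $$\partial_{\mathbf X_i(s_i)}F=\frac1m\sum_{k=1}^m\operatorname{sign}(\langle\mathcal A_k,\mathcal X\rangle-y_k)\sum_{s_j,\,j\ne i}\mathcal A_k(s_1,\dots,s_N)\,\mathbf X_{i-1}^\top(s_{i-1})\cdots\mathbf X_1^\top(s_1)\,\mathbf X_N^\top(s_N)\cdots\mathbf X_{i+1}^\top(s_{i+1}),$$ with $\operatorname{sign}(x)=-1,0,1$ for $x<0,x=0,x>0$. For $i\le N-1$, $\mathcal P_{\mathrm T_{L(\mathbf X_i)}\mathrm{St}}(\mathbf U)=\mathbf U-\frac12L(\mathbf X_i)\left(\mathbf U^\top L(\mathbf X_i)+L(\mathbf X_i)^\top\mathbf U\right)$ is the projection onto the tangent space of the Stiefel manifold at $L(\mathbf X_i)$. $\ell_1/\ell_2$-RIP with constant $\delta_{(N+1)\overline r}\in(0,\sqrt{2/\pi})$: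 $(\sqrt{2/\pi}-\delta_{(N+1)\overline r})\|\mathcal X\|_F\le\frac1m\|\mathcal A(\mathcal X)\|_1\le(\sqrt{2/\pi}+\delta_{(N+1)\overline r})\|\mathcal X\|_F$ for all $\mathcal X$ in TT format with all ranks at most $(N+1)\overline r$. Sharpness with this constant: $\frac1m\|\mathcal A(\mathcal X-\mathcal X^\star)-\mathbf s\|_1-\frac1m\|\mathbf s\|_1\ge((1-2p_s)\sqrt{2/\pi}-\delta_{(N+1)\overline r})\|\mathcal X-\mathcal X^\star\|_F$ for all $\mathcal X$ in TT format with ranks $\mathbf r$. *)

theory Defs
  imports
    "HOL-Library.FuncSet"
    "HOL-Library.Multiset"
    "HOL-Computational_Algebra.Polynomial"
    "Jordan_Normal_Form.Matrix"
    "Jordan_Normal_Form.Char_Poly"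
    "Jordan_Normal_Form.DL_Rank"
begin

section \<open>Tensors\<close>

text \<open>Modes are numbered \<open>1, \<dots>, N\<close> (as are the factors and the ranks), but a position in mode
  \<open>i\<close> ranges over \<open>0, \<dots>, d i - 1\<close> and a measurement number over \<open>0, \<dots>, m - 1\<close>. Only the values
  of a tensor on \<open>tensor_idx N d\<close> are meaningful.\<close>

type_synonym tensor = "(nat \<Rightarrow> nat) \<Rightarrow> real"

definition tensor_idx :: "nat \<Rightarrow> (nat \<Rightarrow> nat) \<Rightarrow> (nat \<Rightarrow> nat) set" where
  "tensor_idx N d = PiE {1..N} (\<lambda>i. {..<d i})"

definition tensor_inner :: "nat \<Rightarrow> (nat \<Rightarrow> nat) \<Rightarrow> tensor \<Rightarrow> tensor \<Rightarrow> real" where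
  "tensor_inner N d X Y = (\<Sum>s\<in>tensor_idx N d. X s * Y s)"

definition tensor_norm :: "nat \<Rightarrow> (nat \<Rightarrow> nat) \<Rightarrow> tensor \<Rightarrow> real" where
  "tensor_norm N d X = sqrt (tensor_inner N d X X)"

text \<open>Rows and columns of the \<open>i\<close>-th unfolding are numbered by the mixed-radix value of
  \<open>(s 1, \<dots>, s i)\<close> and \<open>(s (i+1), \<dots>, s N)\<close>, with the first index running fastest.\<close>

definition unfold_idx :: "nat \<Rightarrow> (nat \<Rightarrow> nat) \<Rightarrow> nat \<Rightarrow> nat \<Rightarrow> nat \<Rightarrow> nat \<Rightarrow> nat" where
  "unfold_idx N d i p q = (\<lambda>j\<in>{1..N}.
     if j \<le> i then (p div (\<Prod>l\<in>{1..<j}. d l)) mod d j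
     else (q div (\<Prod>l\<in>{Suc i..<j}. d l)) mod d j)"

definition unfolding_mat :: "nat \<Rightarrow> (nat \<Rightarrow> nat) \<Rightarrow> nat \<Rightarrow> tensor \<Rightarrow> real mat" where
  "unfolding_mat N d i X =
     mat (\<Prod>j\<in>{1..i}. d j) (\<Prod>j\<in>{Suc i..N}. d j) (\<lambda>(p, q). X (unfold_idx N d i p q))"

section \<open>Matrices\<close>

definition frob_inner :: "real mat \<Rightarrow> real mat \<Rightarrow> real" where
  "frob_inner A B = (\<Sum>i<dim_row A. \<Sum>j<dim_col A. A $$ (i, j) * B $$ (i, j))"

definition frob_norm :: "real mat \<Rightarrow> real" where
  "frob_norm A = sqrt (frob_inner A A)"

definition mat_rank :: "real mat \<Rightarrow> nat" where
  "mat_rank A = vec_space.rank (dim_row A) A"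

text \<open>The \<open>k\<close>-th largest singular value (\<open>k \<ge> 1\<close>): the square roots of the eigenvalues of
  \<open>A\<^sup>T A\<close>, with multiplicity, in decreasing order. The index must satisfy \<open>1 \<le> k \<le> dim_col A\<close>.\<close>

definition singular_value :: "nat \<Rightarrow> real mat \<Rightarrow> real" where
  "singular_value k A =
     map sqrt (rev (sorted_list_of_multiset (proots (char_poly (transpose_mat A * A))))) ! (k - 1)"

definition sigma_min :: "nat \<Rightarrow> (nat \<Rightarrow> nat) \<Rightarrow> (nat \<Rightarrow> nat) \<Rightarrow> tensor \<Rightarrow> real" where
  "sigma_min N d r X = Min ((\<lambda>i. singular_value (r i) (unfolding_mat N d i X)) ` {1..N-1})"

definition sigma_max :: "nat \<Rightarrow> (nat \<Rightarrow> nat) \<Rightarrow> tensor \<Rightarrow> real" where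
  "sigma_max N d X = Max ((\<lambda>i. singular_value 1 (unfolding_mat N d i X)) ` {1..N-1})"

definition tt_kappa :: "nat \<Rightarrow> (nat \<Rightarrow> nat) \<Rightarrow> (nat \<Rightarrow> nat) \<Rightarrow> tensor \<Rightarrow> real" where
  "tt_kappa N d r X = sigma_max N d X / sigma_min N d r X"

section \<open>Tensor train format\<close>

text \<open>\<open>F i t\<close> is the slice of the \<open>i\<close>-th factor at position \<open>t\<close> of mode \<open>i\<close>.\<close>

type_synonym factors = "nat \<Rightarrow> nat \<Rightarrow> real mat"

definition tt_factors :: "nat \<Rightarrow> (nat \<Rightarrow> nat) \<Rightarrow> (nat \<Rightarrow> nat) \<Rightarrow> factors \<Rightarrow> bool" where
  "tt_factors N d r F \<longleftrightarrow> r 0 = 1 \<and> r N = 1 \<and>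
     (\<forall>i\<in>{1..N}. \<forall>t<d i. F i t \<in> carrier_mat (r (i - 1)) (r i))"

text \<open>\<open>n\<close> is the number of columns of the last matrix in the product.\<close>

definition mat_prod :: "nat \<Rightarrow> real mat list \<Rightarrow> real mat" where
  "mat_prod n Ms = foldr (*) Ms (1\<^sub>m n)"

definition tt_tensor :: "nat \<Rightarrow> factors \<Rightarrow> tensor" where
  "tt_tensor N F s = mat_prod 1 (map (\<lambda>i. F i (s i)) [1..<Suc N]) $$ (0, 0)"

definition tt_decomp :: "nat \<Rightarrow> (nat \<Rightarrow> nat) \<Rightarrow> (nat \<Rightarrow> nat) \<Rightarrow> factors \<Rightarrow> tensor \<Rightarrow> bool" where
  "tt_decomp N d r F X \<longleftrightarrow>
     tt_factors N d r F \<and> (\<forall>s\<in>tensor_idx N d. X s = tt_tensor N F s)"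

definition in_tt_format :: "nat \<Rightarrow> (nat \<Rightarrow> nat) \<Rightarrow> (nat \<Rightarrow> nat) \<Rightarrow> tensor \<Rightarrow> bool" where
  "in_tt_format N d r X \<longleftrightarrow> (\<exists>F. tt_decomp N d r F X)"

definition has_tt_ranks :: "nat \<Rightarrow> (nat \<Rightarrow> nat) \<Rightarrow> (nat \<Rightarrow> nat) \<Rightarrow> tensor \<Rightarrow> bool" where
  "has_tt_ranks N d r X \<longleftrightarrow> (\<forall>i\<in>{1..N-1}. r i = mat_rank (unfolding_mat N d i X))"

definition vstack :: "nat \<Rightarrow> nat \<Rightarrow> nat \<Rightarrow> (nat \<Rightarrow> real mat) \<Rightarrow> real mat" where
  "vstack n p q G = mat (n * p) q (\<lambda>(a, b). G (a div p) $$ (a mod p, b))"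

definition left_unf :: "(nat \<Rightarrow> nat) \<Rightarrow> (nat \<Rightarrow> nat) \<Rightarrow> factors \<Rightarrow> nat \<Rightarrow> real mat" where
  "left_unf d r F i = vstack (d i) (r (i - 1)) (r i) (F i)"

definition left_orthogonal :: "nat \<Rightarrow> (nat \<Rightarrow> nat) \<Rightarrow> (nat \<Rightarrow> nat) \<Rightarrow> factors \<Rightarrow> bool" where
  "left_orthogonal N d r F \<longleftrightarrow>
     (\<forall>i\<in>{1..N-1}. transpose_mat (left_unf d r F i) * left_unf d r F i = 1\<^sub>m (r i))"

section \<open>Distance between factorizations\<close>

definition rotations :: "nat \<Rightarrow> (nat \<Rightarrow> nat) \<Rightarrow> (nat \<Rightarrow> real mat) \<Rightarrow> bool" where
  "rotations N r R \<longleftrightarrow> R 0 = 1\<^sub>m 1 \<and> R N = 1\<^sub>m 1 \<and>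
     (\<forall>i\<in>{1..N-1}. R i \<in> carrier_mat (r i) (r i) \<and> transpose_mat (R i) * R i = 1\<^sub>m (r i))"

definition left_unf_rot ::
  "(nat \<Rightarrow> nat) \<Rightarrow> (nat \<Rightarrow> nat) \<Rightarrow> (nat \<Rightarrow> real mat) \<Rightarrow> factors \<Rightarrow> nat \<Rightarrow> real mat" where
  "left_unf_rot d r R F i =
     vstack (d i) (r (i - 1)) (r i) (\<lambda>t. transpose_mat (R (i - 1)) * F i t * R i)"

text \<open>The last block has the single column \<open>col _ 0\<close>, since \<open>r N = 1\<close>. The tensor \<open>Xs\<close> enters
  only through its largest singular value.\<close>

definition dist_objective ::
  "nat \<Rightarrow> (nat \<Rightarrow> nat) \<Rightarrow> (nat \<Rightarrow> nat) \<Rightarrow> tensor \<Rightarrow> factors \<Rightarrow> factors \<Rightarrow> (nat \<Rightarrow> real mat) \<Rightarrow> real" where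
  "dist_objective N d r Xs F Fs R =
     (\<Sum>i=1..N-1. (sigma_max N d Xs)\<^sup>2 * (frob_norm (left_unf d r F i - left_unf_rot d r R Fs i))\<^sup>2)
     + (let v = col (left_unf d r F N - left_unf_rot d r R Fs N) 0 in v \<bullet> v)"

definition tt_dist ::
  "nat \<Rightarrow> (nat \<Rightarrow> nat) \<Rightarrow> (nat \<Rightarrow> nat) \<Rightarrow> tensor \<Rightarrow> factors \<Rightarrow> factors \<Rightarrow> real" where
  "tt_dist N d r Xs F Fs = sqrt (INF R\<in>{R. rotations N r R}. dist_objective N d r Xs F Fs R)"

section \<open>Measurements\<close>

definition outlier_fraction :: "nat \<Rightarrow> (nat \<Rightarrow> real) \<Rightarrow> real" where
  "outlier_fraction m out = real (card {k. k < m \<and> out k \<noteq> 0}) / real m"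

definition l1l2_rip ::
  "nat \<Rightarrow> (nat \<Rightarrow> nat) \<Rightarrow> nat \<Rightarrow> (nat \<Rightarrow> tensor) \<Rightarrow> nat \<Rightarrow> real \<Rightarrow> bool" where
  "l1l2_rip N d m A rmax \<delta> \<longleftrightarrow> 0 < \<delta> \<and> \<delta> < sqrt (2 / pi) \<and>
     (\<forall>r X. in_tt_format N d r X \<and> (\<forall>i\<in>{1..N-1}. r i \<le> rmax) \<longrightarrow>
        (sqrt (2 / pi) - \<delta>) * tensor_norm N d X
          \<le> 1 / real m * (\<Sum>k<m. \<bar>tensor_inner N d (A k) X\<bar>) \<and>
        1 / real m * (\<Sum>k<m. \<bar>tensor_inner N d (A k) X\<bar>)
          \<le> (sqrt (2 / pi) + \<delta>) * tensor_norm N d X)"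

definition sharpness ::
  "nat \<Rightarrow> (nat \<Rightarrow> nat) \<Rightarrow> (nat \<Rightarrow> nat) \<Rightarrow> nat \<Rightarrow> (nat \<Rightarrow> tensor) \<Rightarrow> tensor \<Rightarrow> (nat \<Rightarrow> real) \<Rightarrow> real \<Rightarrow> bool"
where
  "sharpness N d r m A Xs out \<delta> \<longleftrightarrow>
     (\<forall>X. in_tt_format N d r X \<longrightarrow>
        1 / real m * (\<Sum>k<m. \<bar>tensor_inner N d (A k) (\<lambda>s. X s - Xs s) - out k\<bar>)
          - 1 / real m * (\<Sum>k<m. \<bar>out k\<bar>)
        \<ge> ((1 - 2 * outlier_fraction m out) * sqrt (2 / pi) - \<delta>)
            * tensor_norm N d (\<lambda>s. X s - Xs s))"

text \<open>The objective is \<open>1/m * (\<Sum>k<m. \<bar>\<langle>A k, [F 1, \<dots>, F N]\<rangle> - y k\<bar>)\<close>. This is its subgradient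
  with respect to the slice \<open>F i t\<close> obtained by selecting \<open>sgn 0 = 0\<close> at the kinks; the matrix sum
  is written entrywise.\<close>

definition subgrad_slice ::
  "nat \<Rightarrow> (nat \<Rightarrow> nat) \<Rightarrow> (nat \<Rightarrow> nat) \<Rightarrow> nat \<Rightarrow> (nat \<Rightarrow> tensor) \<Rightarrow> (nat \<Rightarrow> real) \<Rightarrow> factors
    \<Rightarrow> nat \<Rightarrow> nat \<Rightarrow> real mat" where
  "subgrad_slice N d r m A y F i t = mat (r (i - 1)) (r i) (\<lambda>(a, b).
     1 / real m * (\<Sum>k<m. sgn (tensor_inner N d (A k) (tt_tensor N F) - y k) *
       (\<Sum>s\<in>{s \<in> tensor_idx N d. s i = t}. A k s *
          mat_prod (r i) (map (\<lambda>j. transpose_mat (F j (s j)))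
            (rev [1..<i] @ rev [Suc i..<Suc N])) $$ (a, b))))"

definition subgrad ::
  "nat \<Rightarrow> (nat \<Rightarrow> nat) \<Rightarrow> (nat \<Rightarrow> nat) \<Rightarrow> nat \<Rightarrow> (nat \<Rightarrow> tensor) \<Rightarrow> (nat \<Rightarrow> real) \<Rightarrow> factors
    \<Rightarrow> nat \<Rightarrow> real mat" where
  "subgrad N d r m A y F i = vstack (d i) (r (i - 1)) (r i) (subgrad_slice N d r m A y F i)"

definition tangent_proj ::
  "nat \<Rightarrow> (nat \<Rightarrow> nat) \<Rightarrow> (nat \<Rightarrow> nat) \<Rightarrow> factors \<Rightarrow> nat \<Rightarrow> real mat \<Rightarrow> real mat" where
  "tangent_proj N d r F i U =
     (if i = N then U
      else U - (1/2) \<cdot>\<^sub>m (left_unf d r F i *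
             (transpose_mat U * left_unf d r F i + transpose_mat (left_unf d r F i) * U)))"

end

theory Submission
  imports
    Defs
    "Jordan_Normal_Form.Schur_Decomposition"
    "Jordan_Normal_Form.Spectral_Radius"
    "HOL-Analysis.L2_Norm"
begin

text \<open>Write \<open>Y\<close> for the optimally rotated factors of \<open>Xs\<close>, \<open>D i = L(F i) - L(Y i)\<close> and
  \<open>E = \<parallel>X - Xs\<parallel>\<close>. By multilinearity, the sum of the inner products with the unprojected subgradients is
  the signed average of \<open>\<langle>A k, X - Xs + H\<rangle>\<close>, where \<open>H\<close> is a sum of tensors that contain two difference
  factors \<open>D i\<close>, \<open>D j\<close>, the factors of \<open>F\<close> to the left of \<open>D j\<close> and those of \<open>Y\<close> to the right of it.
  Sharpness bounds the contribution of \<open>X - Xs\<close> from below by a multiple of \<open>E\<close>; each tensor in \<open>H\<close> has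
  TT ranks \<open>r\<close>, so the RIP applies to it separately, and left-orthogonality bounds its norm by
  \<open>\<parallel>D i\<parallel> \<parallel>D j\<parallel> sigma_max\<close>. The normal component of \<open>D i\<close> is \<open>L(F i) D i\<^sup>T D i / 2\<close>, which is quadratic
  too. The quadratic terms are absorbed because \<open>dist\<^sup>2 \<le> 8 (N + 1 + \<Sum> r i) kappa\<^sup>2 E\<^sup>2\<close>: the left singular
  subspaces of the unfoldings of \<open>X\<close> and \<open>Xs\<close> are aligned one by one, through the orthogonal polar factor
  of the (invertible) matrix of their inner products, and the distance of the aligned bases controls
  each \<open>D i\<close>.\<close>

section \<open>Real symmetric matrices and singular values\<close>

text \<open>The claim speaks of the minimising rotations, yet nothing is computed about them: they
  are only compared with competitors, chosen separately for each interface. This is possible because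
  rotating the factors multiplies the left interface matrix at \<open>k\<close> by
  \<open>R k\<close> alone. The price is the factor \<open>N + 1 + \<Sum> r i\<close>: a factor
  inherits the errors of the interfaces at both of its ends, and the left one is amplified by
  \<open>r i\<close>, the squared Frobenius norm of a left-orthogonal factor. Mode 1 has no error on
  its left, so \<open>r 1\<close> is absent. The mixed terms contribute \<open>(N - 1) / 2\<close>
  and the normal components 3/4, together \<open>(2 * N + 1) / 4\<close>. The radius
  \<open>b\<close> lets all quadratic terms consume at most half of the sharpness bound, and it
  forces \<open>12 * E \<le> smin\<close>, which makes the matrices of inner products invertible. A
  second obstacle is that singular values are entries of a sorted list of roots, taken from a Gram
  matrix as large as the unfolding is wide. They are reached through a Gram matrix of size
  \<open>r k\<close>, which the rank hypothesis makes positive definite.\<close>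

lemma mult_mat_index_sum:
  assumes "A \<in> carrier_mat n m" "B \<in> carrier_mat m q" "i < n" "j < q"
  shows "(A * B) $$ (i, j) = (\<Sum>k<m. A $$ (i, k) * B $$ (k, j))"
  using assms by (simp add: scalar_prod_def atLeast0LessThan)

text \<open>A complex eigenvalue \<open>k\<close> exists; comparing the Hermitian form at an
  eigenvector with its conjugate gives \<open>cnj k = k\<close>, so the real part of
  \<open>k\<close> is a root of the real characteristic polynomial.\<close>

lemma real_symmetric_eigenvalue:
  fixes A :: "real mat"
  assumes A: "A \<in> carrier_mat n n" and sym: "transpose_mat A = A" and n: "n > 0"
  obtains e where "eigenvalue A e"
proof -
  define B where "B = map_mat complex_of_real A"
  have B: "B \<in> carrier_mat n n" using A by (simp add: B_def)
  have Bsym: "B $$ (i, j) = B $$ (j, i)" if "i < n" "j < n" for i j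
    using that A arg_cong[OF sym, of "\<lambda>M. M $$ (i, j)"] by (simp add: B_def)
  have Bcnj: "cnj (B $$ (i, j)) = B $$ (i, j)" if "i < n" "j < n" for i j
    using that A by (simp add: B_def)
  obtain k where "eigenvalue B k"
    using spectrum_non_empty[OF B] n by (auto simp: spectrum_def)
  then obtain w where w: "w \<in> carrier_vec n" "w \<noteq> 0\<^sub>v n" "B *\<^sub>v w = k \<cdot>\<^sub>v w"
    using B by (auto simp: eigenvalue_def eigenvector_def)
  have Bw: "(\<Sum>j<n. B $$ (i, j) * w $ j) = k * w $ i" if "i < n" for i
    using that B w(1) arg_cong[OF w(3), of "\<lambda>v. v $ i"] by (simp add: scalar_prod_def atLeast0LessThan)
  define S where "S = (\<Sum>i<n. cnj (w $ i) * w $ i)"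
  have S: "S = of_real (\<Sum>i<n. (cmod (w $ i))\<^sup>2)"
    unfolding S_def by (simp add: mult.commute[of "cnj _"] flip: complex_norm_square)
  have "(\<Sum>i<n. (cmod (w $ i))\<^sup>2) \<noteq> 0"
  proof
    assume "(\<Sum>i<n. (cmod (w $ i))\<^sup>2) = 0"
    then have "w $ i = 0" if "i < n" for i using that by (simp add: sum_nonneg_eq_0_iff)
    then have "w = 0\<^sub>v n" using w(1) by (intro eq_vecI) auto
    with w(2) show False ..
  qed
  then have S0: "S \<noteq> 0" unfolding S of_real_eq_0_iff .
  have cS: "cnj S = S" unfolding S by simp
  define q where "q = (\<Sum>i<n. \<Sum>j<n. cnj (w $ i) * (B $$ (i, j) * w $ j))"
  have q: "q = k * S" unfolding q_def S_def sum_distrib_left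
    by (intro sum.cong refl) (simp add: Bw flip: sum_distrib_left)
  have "cnj q = (\<Sum>i<n. \<Sum>j<n. w $ i * (B $$ (i, j) * cnj (w $ j)))"
    unfolding q_def by (simp add: Bcnj)
  also have "\<dots> = q"
    unfolding q_def by (subst sum.swap) (auto intro!: sum.cong simp: Bsym)
  finally have "cnj k * S = k * S" using q cS by simp
  then have "cnj k = k" using S0 by simp
  then have kr: "k = of_real (Re k)" by (simp add: complex_eq_iff)
  have "poly (char_poly B) k = 0" using \<open>eigenvalue B k\<close> eigenvalue_root_char_poly[OF B] by simp
  moreover have "char_poly B = map_poly complex_of_real (char_poly A)"
    unfolding B_def by (rule of_real_hom.char_poly_hom[OF A])
  ultimately have "poly (char_poly A) (Re k) = 0"
    by (metis kr of_real_hom.poly_map_poly of_real_eq_0_iff)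
  then show thesis using eigenvalue_root_char_poly[OF A] that by simp
qed

text \<open>A Householder reflection.\<close>
lemma orthogonal_mat_with_first_column:
  fixes v :: "real vec"
  assumes v: "v \<in> carrier_vec n" and unit: "v \<bullet> v = 1" and n: "n > 0"
  obtains W where "W \<in> carrier_mat n n" "transpose_mat W = W" "W * W = 1\<^sub>m n" "col W 0 = v"
proof (cases "v = unit_vec n 0")
  case True
  then show ?thesis using n by (intro that[of "1\<^sub>m n"]) auto
next
  case False
  define w where "w i = v $ i - (if i = 0 then 1 else 0)" for i
  define c where "c = (\<Sum>i<n. w i * w i)"
  have vv: "(\<Sum>i<n. v $ i * v $ i) = 1"
    using unit v by (simp add: scalar_prod_def atLeast0LessThan)
  have c: "c = 2 - 2 * v $ 0"
  proof -
    have "c = (\<Sum>i<n. v $ i * v $ i + (if i = 0 then 1 - 2 * v $ 0 else 0))"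
      unfolding c_def w_def by (intro sum.cong) (auto simp: algebra_simps)
    then show ?thesis using vv n by (simp add: sum.distrib)
  qed
  have c0: "c \<noteq> 0"
  proof
    assume "c = 0"
    then have "w i = 0" if "i < n" for i using that unfolding c_def by (simp add: sum_nonneg_eq_0_iff)
    then have "v = unit_vec n 0" using v n by (intro eq_vecI) (auto simp: w_def)
    with False show False ..
  qed
  define W where "W = mat n n (\<lambda>(i, j). (if i = j then 1 else 0) - 2 * w i * w j / c)"
  have W: "W \<in> carrier_mat n n" by (simp add: W_def)
  have "W * W = 1\<^sub>m n"
  proof (intro eq_matI)
    fix i j assume ij: "i < dim_row (1\<^sub>m n :: real mat)" "j < dim_col (1\<^sub>m n :: real mat)"
    have "(W * W) $$ (i, j) = (\<Sum>k<n. W $$ (i, k) * W $$ (k, j))"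
      using mult_mat_index_sum[OF W W] ij by simp
    also have "\<dots> = (\<Sum>k<n. (if k = i then W $$ (i, j) else 0) - 2 * w i / c * (if k = j then w j else 0)
        + 4 * w i * w j / (c * c) * (w k * w k))"
      using ij by (intro sum.cong) (auto simp: W_def divide_simps algebra_simps)
    also have "\<dots> = (if i = j then 1 else 0) - 4 * w i * w j / c + 4 * w i * w j / (c * c) * c"
      unfolding sum.distrib sum_subtractf sum_distrib_left[symmetric] c_def[symmetric]
      using ij by (simp add: W_def)
    also have "\<dots> = 1\<^sub>m n $$ (i, j)" using ij c0 by simp
    finally show "(W * W) $$ (i, j) = 1\<^sub>m n $$ (i, j)" .
  qed (auto simp: W_def)
  moreover have "col W 0 = v"
  proof (intro eq_vecI)
    fix i assume i: "i < dim_vec v"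
    \<comment> \<open>Column 0 of \<open>W\<close> is the first unit vector minus
      \<open>(2 * w 0 / c)\<close> times \<open>w\<close>; this identity turns it into the first
      unit vector plus \<open>w\<close>, which is \<open>v\<close>.\<close>
    have "2 * w 0 = - c" using c by (simp add: w_def)
    have "2 * w i * w 0 / c = w i * (2 * w 0) / c" by simp
    also have "\<dots> = - w i" unfolding \<open>2 * w 0 = - c\<close> using c0 by simp
    finally have "2 * w i * w 0 / c = - w i" .
    then show "col W 0 $ i = v $ i" using i v n by (auto simp: W_def w_def)
  qed (use v in \<open>auto simp: W_def\<close>)
  moreover have "transpose_mat W = W" by (intro eq_matI) (auto simp: W_def)
  ultimately show ?thesis using W that by blast
qed

text \<open>Deflation: the reflection \<open>W\<close> takes the first unit vector to a unit
  eigenvector, so \<open>W * A * W\<close> has a 1 x 1 block split off, on both sides by symmetry,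
  and the induction hypothesis handles the other block.\<close>

theorem real_symmetric_diagonalization:
  fixes A :: "real mat"
  assumes "A \<in> carrier_mat n n" "transpose_mat A = A"
  shows "\<exists>P l. P \<in> carrier_mat n n \<and> transpose_mat P * P = 1\<^sub>m n \<and>
    transpose_mat P * A * P = mat_diag n l"
  using assms
proof (induction n arbitrary: A)
  case 0
  then show ?case by (intro exI[of _ "1\<^sub>m 0"] exI[of _ "\<lambda>_. 0"]) (auto simp: mat_diag_def)
next
  case (Suc n)
  note A = Suc.prems(1)
  obtain e where "eigenvalue A e" using real_symmetric_eigenvalue[OF Suc.prems] by auto
  then obtain u where u: "u \<in> carrier_vec (Suc n)" "u \<noteq> 0\<^sub>v (Suc n)" "A *\<^sub>v u = e \<cdot>\<^sub>v u"
    using A by (auto simp: eigenvalue_def eigenvector_def)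
  have uu: "u \<bullet> u > 0"
  proof -
    have "u \<bullet> u = (\<Sum>i<Suc n. u $ i * u $ i)"
      using u(1) by (simp add: scalar_prod_def atLeast0LessThan)
    moreover have "\<dots> \<noteq> 0"
    proof
      assume "(\<Sum>i<Suc n. u $ i * u $ i) = 0"
      then have "\<forall>i\<in>{..<Suc n}. u $ i * u $ i = 0"
        by (subst (asm) sum_nonneg_eq_0_iff) auto
      then have "u = 0\<^sub>v (Suc n)" using u(1) by (intro eq_vecI) auto
      with u(2) show False ..
    qed
    moreover have "0 \<le> (\<Sum>i<Suc n. u $ i * u $ i)" by (intro sum_nonneg) auto
    ultimately show ?thesis by linarith
  qed
  define v where "v = (1 / sqrt (u \<bullet> u)) \<cdot>\<^sub>v u"
  have v: "v \<in> carrier_vec (Suc n)" using u by (simp add: v_def)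
  have vv: "v \<bullet> v = 1"
    using uu u(1) unfolding v_def by (simp add: field_simps)
  have Av: "A *\<^sub>v v = e \<cdot>\<^sub>v v"
    unfolding v_def using A u by (simp add: mult_mat_vec smult_smult_assoc mult.commute)
  obtain W where W: "W \<in> carrier_mat (Suc n) (Suc n)" "transpose_mat W = W" "W * W = 1\<^sub>m (Suc n)"
    and W0: "col W 0 = v"
    using orthogonal_mat_with_first_column[OF v vv] by auto
  define B where "B = W * A * W"
  have B: "B \<in> carrier_mat (Suc n) (Suc n)" using W A by (simp add: B_def)
  have Bsym: "transpose_mat B = B"
    unfolding B_def using W A Suc.prems(2)
    by (simp add: transpose_mult[of _ "Suc n" "Suc n" _ "Suc n"] assoc_mult_mat[of _ "Suc n" "Suc n" _ "Suc n" _ "Suc n"])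
  have "col B 0 = (W * A) *\<^sub>v col W 0"
    unfolding B_def using W A by (subst col_mult2[of _ "Suc n" "Suc n" _ "Suc n"]) auto
  also have "\<dots> = W *\<^sub>v (A *\<^sub>v v)" using W A v W0 by (simp add: assoc_mult_mat_vec[of _ "Suc n" "Suc n" _ "Suc n"])
  also have "\<dots> = e \<cdot>\<^sub>v (W *\<^sub>v v)" using W A v Av by (simp add: mult_mat_vec)
  also have "W *\<^sub>v v = col (W * W) 0" using W W0 by (subst col_mult2[of _ "Suc n" "Suc n" _ "Suc n"]) auto
  also have "\<dots> = unit_vec (Suc n) 0" using W by simp
  finally have col0: "col B 0 = e \<cdot>\<^sub>v unit_vec (Suc n) 0" .
  have B0: "B $$ (i, 0) = (if i = 0 then e else 0)" if "i < Suc n" for i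
    using that B arg_cong[OF col0, of "\<lambda>v. v $ i"] by auto
  have B0': "B $$ (0, i) = (if i = 0 then e else 0)" if "i < Suc n" for i
    using that B B0[OF that] arg_cong[OF Bsym, of "\<lambda>M. M $$ (i, 0)"] by auto
  define A' where "A' = mat n n (\<lambda>(i, j). B $$ (Suc i, Suc j))"
  have A': "A' \<in> carrier_mat n n" by (simp add: A'_def)
  have "B $$ (i, j) = B $$ (j, i)" if "i < Suc n" "j < Suc n" for i j
    using that B arg_cong[OF Bsym, of "\<lambda>M. M $$ (j, i)"] by auto
  then have A'sym: "transpose_mat A' = A'" by (intro eq_matI) (auto simp: A'_def)
  have Bblock: "B = four_block_mat (mat 1 1 (\<lambda>_. e)) (0\<^sub>m 1 n) (0\<^sub>m n 1) A'"
  proof (rule eq_matI)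
    fix i j
    assume *: "i < dim_row (four_block_mat (mat 1 1 (\<lambda>_. e)) (0\<^sub>m 1 n) (0\<^sub>m n 1) A')"
      "j < dim_col (four_block_mat (mat 1 1 (\<lambda>_. e)) (0\<^sub>m 1 n) (0\<^sub>m n 1) A')"
    then show "B $$ (i, j) = four_block_mat (mat 1 1 (\<lambda>_. e)) (0\<^sub>m 1 n) (0\<^sub>m n 1) A' $$ (i, j)"
      using B0[of i] B0'[of j] by (auto simp: A'_def)
  qed (use B in \<open>auto simp: A'_def\<close>)
  obtain P' l' where P': "P' \<in> carrier_mat n n" "transpose_mat P' * P' = 1\<^sub>m n"
    "transpose_mat P' * A' * P' = mat_diag n l'"
    using Suc.IH[OF A' A'sym] by auto
  define Q where "Q = four_block_mat (1\<^sub>m 1) (0\<^sub>m 1 n) (0\<^sub>m n 1) P'"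
  have Q: "Q \<in> carrier_mat (Suc n) (Suc n)" using P' by (auto simp: Q_def)
  have Qt: "transpose_mat Q = four_block_mat (1\<^sub>m 1) (0\<^sub>m 1 n) (0\<^sub>m n 1) (transpose_mat P')"
    unfolding Q_def using P' by (subst transpose_four_block_mat[of _ 1 1 _ n _ n]) auto
  have QQ: "transpose_mat Q * Q = 1\<^sub>m (Suc n)"
    unfolding Qt unfolding Q_def using P'
    by (subst mult_four_block_mat[of _ 1 1 _ n _ n _ _ 1 _ n]) auto
  have "transpose_mat Q * B * Q = four_block_mat (mat 1 1 (\<lambda>_. e)) (0\<^sub>m 1 n) (0\<^sub>m n 1) (transpose_mat P' * A' * P')"
    unfolding Qt unfolding Q_def Bblock using P' A'
    by (subst mult_four_block_mat[of _ 1 1 _ n _ n _ _ 1 _ n], auto)+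
  also have "\<dots> = mat_diag (Suc n) (case_nat e l')"
    unfolding P' by (rule eq_matI) (auto simp: mat_diag_def split: nat.split)
  finally have D: "transpose_mat Q * B * Q = mat_diag (Suc n) (case_nat e l')" .
  have Pt: "transpose_mat (W * Q) = transpose_mat Q * W"
    using W Q by (simp add: transpose_mult[of _ "Suc n" "Suc n" _ "Suc n"])
  note assoc = assoc_mult_mat[of _ "Suc n" "Suc n" _ "Suc n" _ "Suc n"]
  have "transpose_mat (W * Q) * (W * Q) = transpose_mat Q * ((W * W) * Q)"
    unfolding Pt using W(1) Q by (simp add: assoc)
  also have "\<dots> = 1\<^sub>m (Suc n)" unfolding W(3) using Q QQ by simp
  finally have 1: "transpose_mat (W * Q) * (W * Q) = 1\<^sub>m (Suc n)" .
  have "transpose_mat (W * Q) * A * (W * Q) = transpose_mat Q * B * Q"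
    unfolding Pt B_def using W(1) Q A by (simp add: assoc)
  with 1 D show ?case using W(1) Q by (intro exI[of _ "W * Q"] exI[of _ "case_nat e l'"]) auto
qed

lemma real_symmetric_eigenbasis:
  fixes A :: "real mat"
  assumes A: "A \<in> carrier_mat n n" and sym: "transpose_mat A = A"
  obtains P l where "P \<in> carrier_mat n n" "transpose_mat P * P = 1\<^sub>m n" "P * transpose_mat P = 1\<^sub>m n"
    "transpose_mat P * A * P = mat_diag n l"
    "\<And>i j. i < n \<Longrightarrow> j < n \<Longrightarrow> A $$ (i, j) = (\<Sum>k<n. l k * P $$ (i, k) * P $$ (j, k))"
    "\<And>i j. i < n \<Longrightarrow> j < n \<Longrightarrow> (\<Sum>k<n. P $$ (i, k) * P $$ (j, k)) = (if i = j then 1 else 0)"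
    "\<And>i j. i < n \<Longrightarrow> j < n \<Longrightarrow> (\<Sum>k<n. P $$ (k, i) * P $$ (k, j)) = (if i = j then 1 else 0)"
    "char_poly A = (\<Prod>k<n. [:- l k, 1:])"
proof -
  obtain P l where P: "P \<in> carrier_mat n n" and PP: "transpose_mat P * P = 1\<^sub>m n"
    and D: "transpose_mat P * A * P = mat_diag n l"
    using real_symmetric_diagonalization[OF A sym] by auto
  have PP': "P * transpose_mat P = 1\<^sub>m n"
    using mat_mult_left_right_inverse[OF _ P PP] P by simp
  note assoc = assoc_mult_mat[of _ n n _ n _ n]
  have "P * mat_diag n l * transpose_mat P = (P * transpose_mat P) * (A * (P * transpose_mat P))"
    unfolding D[symmetric] using P A by (simp add: assoc)
  also have "\<dots> = A" unfolding PP' using A by simp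
  finally have A_eq: "A = P * mat_diag n l * transpose_mat P" ..
  have "similar_mat A (mat_diag n l)"
    unfolding similar_mat_def
    by (rule exI[of _ P], rule exI[of _ "transpose_mat P"], rule similar_mat_witI[of _ _ n])
      (use P A PP PP' A_eq in auto)
  then have "char_poly A = char_poly (mat_diag n l)" by (rule char_poly_similar)
  also have "\<dots> = (\<Prod>a\<leftarrow>diag_mat (mat_diag n l). [:- a, 1:])"
    by (rule char_poly_upper_triangular[of _ n]) (auto simp: mat_diag_def)
  also have "diag_mat (mat_diag n l) = map l [0..<n]"
    unfolding diag_mat_def by (simp add: mat_diag_def)
  also have "(\<Prod>a\<leftarrow>map l [0..<n]. [:- a, 1:]) = (\<Prod>k<n. [:- l k, 1:])"
    by (simp add: comp_def interv_sum_list_conv_sum_set_nat atLeast0LessThan prod.distinct_set_conv_list[symmetric])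
  finally have cp: "char_poly A = (\<Prod>k<n. [:- l k, 1:])" .
  show thesis
  proof (rule that[OF P PP PP' D _ _ _ cp])
    fix i j assume ij: "i < n" "j < n"
    have "A $$ (i, j) = (\<Sum>k<n. (P * mat_diag n l) $$ (i, k) * transpose_mat P $$ (k, j))"
      using P ij by (subst A_eq, subst mult_mat_index_sum[of _ n n _ n]) auto
    also have "\<dots> = (\<Sum>k<n. l k * P $$ (i, k) * P $$ (j, k))"
      using P ij by (intro sum.cong refl) (simp add: mat_diag_mult_right)
    finally show "A $$ (i, j) = (\<Sum>k<n. l k * P $$ (i, k) * P $$ (j, k))" .
    show "(\<Sum>k<n. P $$ (i, k) * P $$ (j, k)) = (if i = j then 1 else 0)"
      using arg_cong[OF PP', of "\<lambda>M. M $$ (i, j)"] P ij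
      by (subst (asm) mult_mat_index_sum[of _ n n _ n]) auto
    show "(\<Sum>k<n. P $$ (k, i) * P $$ (k, j)) = (if i = j then 1 else 0)"
      using arg_cong[OF PP, of "\<lambda>M. M $$ (i, j)"] P ij
      by (subst (asm) mult_mat_index_sum[of _ n n _ n]) auto
  qed
qed

text \<open>The shear \<open>T\<close> conjugates the block triangular matrices \<open>K\<close> and
  \<open>L\<close>, whose diagonal blocks are \<open>C C\<^sup>T\<close> and 0, respectively 0 and
  \<open>C\<^sup>T C\<close>. Powers of the indeterminate stand on both sides so that no order
  between \<open>r\<close> and \<open>q\<close> is assumed.\<close>

lemma char_poly_gram_swap:
  fixes C :: "real mat"
  assumes C: "C \<in> carrier_mat r q"
  shows "char_poly (C * transpose_mat C) * [:0, 1:] ^ q = char_poly (transpose_mat C * C) * [:0, 1:] ^ r"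
proof -
  let ?A = "C * transpose_mat C" and ?B = "transpose_mat C * C"
  have A: "?A \<in> carrier_mat r r" and B: "?B \<in> carrier_mat q q" using C by auto
  \<comment> \<open>The rule that splits the characteristic polynomial of a block triangular matrix
    asks for linear factors in both diagonal blocks; all four blocks are symmetric.\<close>
  have linear: "\<exists>es. char_poly S = (\<Prod>a\<leftarrow>es. [:- a, 1:])"
    if S: "S \<in> carrier_mat n n" "transpose_mat S = S" for S :: "real mat" and n
  proof -
    obtain l where "char_poly S = (\<Prod>k<n. [:- l k, 1:])"
      by (rule real_symmetric_eigenbasis[OF S])
    also have "\<dots> = (\<Prod>a\<leftarrow>map l [0..<n]. [:- a, 1:])"
      by (simp add: comp_def atLeast0LessThan prod.distinct_set_conv_list[symmetric])
    finally show ?thesis by blast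
  qed
  have symA: "transpose_mat ?A = ?A" and symB: "transpose_mat ?B = ?B"
    using C by (simp_all add: transpose_mult[of _ r q _ r] transpose_mult[of _ q r _ q])
  have zero: "char_poly (0\<^sub>m n n :: real mat) = [:0, 1:] ^ n" for n
  proof -
    have "diag_mat (0\<^sub>m n n :: real mat) = replicate n 0"
      by (rule nth_equalityI) (auto simp: diag_mat_def)
    moreover have "char_poly (0\<^sub>m n n :: real mat) = (\<Prod>a\<leftarrow>diag_mat (0\<^sub>m n n). [:- a, 1:])"
      by (rule char_poly_upper_triangular[of _ n]) auto
    ultimately show ?thesis by (simp add: prod_list_replicate)
  qed
  define K where "K = four_block_mat ?A (0\<^sub>m r q) (transpose_mat C) (0\<^sub>m q q)"
  define L where "L = four_block_mat (0\<^sub>m r r) (0\<^sub>m r q) (transpose_mat C) ?B"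
  define T where "T = four_block_mat (1\<^sub>m r) C (0\<^sub>m q r) (1\<^sub>m q)"
  define T' where "T' = four_block_mat (1\<^sub>m r) (- C) (0\<^sub>m q r) (1\<^sub>m q)"
  have carr: "K \<in> carrier_mat (r + q) (r + q)" "L \<in> carrier_mat (r + q) (r + q)"
    "T \<in> carrier_mat (r + q) (r + q)" "T' \<in> carrier_mat (r + q) (r + q)"
    using C by (auto simp: K_def L_def T_def T'_def)
  have neg0: "- (0\<^sub>m q q :: real mat) = 0\<^sub>m q q" by (intro eq_matI) auto
  have TT': "T * T' = 1\<^sub>m (r + q)" unfolding T_def T'_def using C
    by (subst mult_four_block_mat[of _ r r _ q _ q _ _ r _ q]) (auto simp: neg0)
  have T'T: "T' * T = 1\<^sub>m (r + q)" using mat_mult_left_right_inverse[OF carr(3,4) TT'] .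
  have "K * T = T * L" unfolding K_def T_def L_def using C
    by (subst (1 2) mult_four_block_mat[of _ r r _ q _ q _ _ r _ q])
      (auto simp: assoc_mult_mat[of _ r q _ r _ q])
  then have "K = T * L * T'"
    using carr TT' by (metis assoc_mult_mat right_mult_one_mat)
  then have "similar_mat K L"
    unfolding similar_mat_def
    by (intro exI[of _ T] exI[of _ T'] similar_mat_witI[of _ _ "r + q"] TT' T'T carr)
  then have "char_poly K = char_poly L" by (rule char_poly_similar)
  moreover have "char_poly K = char_poly ?A * char_poly (0\<^sub>m q q)"
    by (rule char_poly_0_block'[OF K_def linear[OF A symA] linear[of _ q]]) (use A C in auto)
  moreover have "char_poly L = char_poly (0\<^sub>m r r) * char_poly ?B"
    by (rule char_poly_0_block'[OF L_def linear[of _ r] linear[OF B symB]]) (use B C in auto)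
  ultimately show ?thesis by (simp add: zero mult.commute)
qed

text \<open>Subadditivity over rank-one summands. The empty sum is included, and gives rank 0 for
  the unfoldings of a zero tensor.\<close>

lemma rank_le_card_of_sum:
  fixes M :: "real mat"
  assumes "finite K" "M \<in> carrier_mat n q"
    "\<And>i j. i < n \<Longrightarrow> j < q \<Longrightarrow> M $$ (i, j) = (\<Sum>k\<in>K. f k i * g k j)"
  shows "vec_space.rank n M \<le> card K"
  using assms
proof (induction K arbitrary: M rule: finite_induct)
  case empty
  then have "M = 0\<^sub>m n q" by (intro eq_matI) auto
  then show ?case by (simp add: vec_space.rank_0I)
next
  case (insert k K)
  define M1 where "M1 = mat n q (\<lambda>(i, j). f k i * g k j)"
  define M2 where "M2 = mat n q (\<lambda>(i, j). \<Sum>k\<in>K. f k i * g k j)"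
  have "M = M1 + M2" using insert by (intro eq_matI) (auto simp: M1_def M2_def)
  then have "vec_space.rank n M \<le> vec_space.rank n M1 + vec_space.rank n M2"
    using vec_space.rank_subadditive[of M1 n q M2] by (simp add: M1_def M2_def)
  moreover have "vec_space.rank n M1 \<le> 1"
    by (rule vec_space.rank_le_1_product_entries[of _ _ q]) (auto simp: M1_def)
  moreover have "vec_space.rank n M2 \<le> card K"
    by (rule insert.IH) (auto simp: M2_def)
  ultimately show ?case using insert by simp
qed

lemma sorted_list_of_multiset_add_zeros:
  fixes X :: "real multiset"
  assumes "\<forall>x\<in>#X. 0 \<le> x"
  shows "sorted_list_of_multiset (X + replicate_mset k 0) = replicate k 0 @ sorted_list_of_multiset X"
proof -
  let ?ys = "replicate k 0 @ sorted_list_of_multiset X"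
  have "mset ?ys = X + replicate_mset k 0" by simp
  moreover have "sorted ?ys" using assms by (auto simp: sorted_append)
  ultimately show ?thesis
    by (metis sorted_list_of_multiset_mset sorted_sort_id)
qed

text \<open>The columns of \<open>V\<close> are orthonormal, so
  \<open>M\<^sup>T M = C\<^sup>T C\<close>, whose spectrum is that of the \<open>r\<close> x
  \<open>r\<close> matrix \<open>C C\<^sup>T\<close> up to zeros; the quadratic form of the latter
  lies between its extreme eigenvalues. The rank hypothesis makes these positive, so position
  \<open>r\<close> of the sorted list holds the smallest of them and not a zero.\<close>

lemma singular_value_bounds:
  fixes M V C :: "real mat"
  assumes V: "V \<in> carrier_mat n r" and C: "C \<in> carrier_mat r q" and M: "M = V * C"
    and VV: "transpose_mat V * V = 1\<^sub>m r" and rank: "mat_rank M = r" and r: "r > 0"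
  shows "0 < singular_value r M"
    and "(singular_value r M)\<^sup>2 * (\<Sum>a<r. (u a)\<^sup>2) \<le> (\<Sum>j<q. (\<Sum>a<r. u a * C $$ (a, j))\<^sup>2)"
    and "(\<Sum>j<q. (\<Sum>a<r. u a * C $$ (a, j))\<^sup>2) \<le> (singular_value 1 M)\<^sup>2 * (\<Sum>a<r. (u a)\<^sup>2)"
    and "singular_value r M \<le> singular_value 1 M"
proof -
  have Mc: "M \<in> carrier_mat n q" using V C M by simp
  have rankM: "vec_space.rank n M = r" using rank Mc by (simp add: mat_rank_def)
  have rq: "r \<le> q" using vec_space.rank_le_nc[OF Mc] rankM by simp
  have "transpose_mat M * M = transpose_mat C * (transpose_mat V * V) * C"
    unfolding M using V C
    by (simp add: transpose_mult[of _ n r _ q] assoc_mult_mat[of _ q r _ n _ q]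
        assoc_mult_mat[of _ q r _ r _ q] assoc_mult_mat[of _ r n _ r _ q])
  also have "\<dots> = transpose_mat C * C" unfolding VV using C by simp
  finally have MM: "transpose_mat M * M = transpose_mat C * C" .
  let ?A = "C * transpose_mat C"
  have A: "?A \<in> carrier_mat r r" using C by simp
  have symA: "transpose_mat ?A = ?A" using C by (simp add: transpose_mult[of _ r q _ r])
  obtain P l where P: "P \<in> carrier_mat r r"
    and Al: "\<And>i j. i < r \<Longrightarrow> j < r \<Longrightarrow> ?A $$ (i, j) = (\<Sum>k<r. l k * P $$ (i, k) * P $$ (j, k))"
    and PPr: "\<And>i j. i < r \<Longrightarrow> j < r \<Longrightarrow> (\<Sum>k<r. P $$ (i, k) * P $$ (j, k)) = (if i = j then 1 else 0)"
    and PPc: "\<And>i j. i < r \<Longrightarrow> j < r \<Longrightarrow> (\<Sum>k<r. P $$ (k, i) * P $$ (k, j)) = (if i = j then 1 else 0)"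
    and cp: "char_poly ?A = (\<Prod>k<r. [:- l k, 1:])"
    by (rule real_symmetric_eigenbasis[OF A symA]) (rule that; assumption)
  have quad: "(\<Sum>a<r. \<Sum>b<r. v a * v b * (\<Sum>k<r. h k * P $$ (a, k) * P $$ (b, k)))
      = (\<Sum>k<r. h k * (\<Sum>a<r. v a * P $$ (a, k))\<^sup>2)" for v h
  proof -
    have "(\<Sum>a<r. \<Sum>b<r. v a * v b * (\<Sum>k<r. h k * P $$ (a, k) * P $$ (b, k)))
      = (\<Sum>a<r. \<Sum>b<r. \<Sum>k<r. h k * (v a * P $$ (a, k)) * (v b * P $$ (b, k)))"
      by (simp add: sum_distrib_left mult_ac)
    also have "\<dots> = (\<Sum>a<r. \<Sum>k<r. \<Sum>b<r. h k * (v a * P $$ (a, k)) * (v b * P $$ (b, k)))"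
      by (intro sum.cong refl sum.swap)
    also have "\<dots> = (\<Sum>k<r. \<Sum>a<r. \<Sum>b<r. h k * (v a * P $$ (a, k)) * (v b * P $$ (b, k)))"
      by (rule sum.swap)
    also have "\<dots> = (\<Sum>k<r. h k * (\<Sum>a<r. v a * P $$ (a, k))\<^sup>2)"
      by (intro sum.cong refl) (simp add: power2_eq_square sum_product sum_distrib_left mult_ac)
    finally show ?thesis .
  qed
  have norm: "(\<Sum>k<r. (\<Sum>a<r. v a * P $$ (a, k))\<^sup>2) = (\<Sum>a<r. (v a)\<^sup>2)" for v
    using quad[of v "\<lambda>_. 1"] by (simp add: PPr power2_eq_square if_distrib cong: if_cong)
  have form: "(\<Sum>j<q. (\<Sum>a<r. v a * C $$ (a, j))\<^sup>2) = (\<Sum>k<r. l k * (\<Sum>a<r. v a * P $$ (a, k))\<^sup>2)" for v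
  proof -
    have "(\<Sum>j<q. (\<Sum>a<r. v a * C $$ (a, j))\<^sup>2)
      = (\<Sum>j<q. \<Sum>a<r. \<Sum>b<r. v a * v b * (C $$ (a, j) * C $$ (b, j)))"
      by (simp add: power2_eq_square sum_product mult_ac)
    also have "\<dots> = (\<Sum>a<r. \<Sum>j<q. \<Sum>b<r. v a * v b * (C $$ (a, j) * C $$ (b, j)))"
      by (rule sum.swap)
    also have "\<dots> = (\<Sum>a<r. \<Sum>b<r. \<Sum>j<q. v a * v b * (C $$ (a, j) * C $$ (b, j)))"
      by (intro sum.cong refl sum.swap)
    also have "\<dots> = (\<Sum>a<r. \<Sum>b<r. v a * v b * ?A $$ (a, b))"
      using C by (intro sum.cong refl) (simp add: sum_distrib_left scalar_prod_def atLeast0LessThan)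
    also have "\<dots> = (\<Sum>a<r. \<Sum>b<r. v a * v b * (\<Sum>k<r. l k * P $$ (a, k) * P $$ (b, k)))"
      by (intro sum.cong refl arg_cong2[of _ _ _ _ "(*)"] Al) auto
    finally show ?thesis unfolding quad .
  qed
  \<comment> \<open>Evaluating the form at the \<open>k\<close>-th eigenvector writes
    \<open>l k\<close> as a sum of squares.\<close>
  have col: "(\<Sum>j<q. (\<Sum>a<r. P $$ (a, k) * C $$ (a, j))\<^sup>2) = l k" if "k < r" for k
  proof -
    have "(\<Sum>j<q. (\<Sum>a<r. P $$ (a, k) * C $$ (a, j))\<^sup>2) = (\<Sum>i<r. if i = k then l k else 0)"
      unfolding form using that by (intro sum.cong refl) (simp add: PPc)
    then show ?thesis using that by simp
  qed
  \<comment> \<open>A zero eigenvalue makes a nontrivial combination of the rows of \<open>C\<close>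
    vanish. Solving it for row \<open>a0\<close> writes \<open>M\<close> with \<open>r - 1\<close>
    rank-one terms, against the rank hypothesis.\<close>
  have l_pos: "0 < l k" if k: "k < r" for k
  proof (rule ccontr)
    assume "\<not> 0 < l k"
    moreover have "0 \<le> l k" unfolding col[OF k, symmetric] by (intro sum_nonneg) auto
    ultimately have "l k = 0" by simp
    then have zero: "(\<Sum>a<r. P $$ (a, k) * C $$ (a, j)) = 0" if "j < q" for j
      using col[OF k] that by (simp add: sum_nonneg_eq_0_iff)
    obtain a0 where a0: "a0 < r" "P $$ (a0, k) \<noteq> 0"
    proof (rule ccontr)
      assume "\<not> thesis"
      then have "P $$ (a, k) = 0" if "a < r" for a using that \<open>\<And>a0. \<lbrakk>a0 < r; P $$ (a0, k) \<noteq> 0\<rbrakk> \<Longrightarrow> thesis\<close> by blast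
      then show False using PPc[OF k k] by simp
    qed
    have "vec_space.rank n M \<le> card ({..<r} - {a0})"
    proof (rule rank_le_card_of_sum[OF _ Mc])
      fix i j assume ij: "i < n" "j < q"
      let ?c = "P $$ (a0, k)"
      have "(\<Sum>a\<in>{..<r} - {a0}. P $$ (a, k) * C $$ (a, j)) = - ?c * C $$ (a0, j)"
        using zero[OF ij(2)] a0 by (simp add: sum.remove[of "{..<r}" a0])
      then have C0: "C $$ (a0, j) = - (\<Sum>a\<in>{..<r} - {a0}. P $$ (a, k) * C $$ (a, j)) / ?c"
        using a0 by (simp add: field_simps)
      have "M $$ (i, j) = (\<Sum>a<r. V $$ (i, a) * C $$ (a, j))"
        unfolding M using mult_mat_index_sum[OF V C ij] .
      also have "\<dots> = V $$ (i, a0) * C $$ (a0, j) + (\<Sum>a\<in>{..<r} - {a0}. V $$ (i, a) * C $$ (a, j))"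
        using a0 by (simp add: sum.remove[of "{..<r}" a0])
      also have "\<dots> = (\<Sum>a\<in>{..<r} - {a0}. (V $$ (i, a) - V $$ (i, a0) * P $$ (a, k) / ?c) * C $$ (a, j))"
        unfolding C0
        by (simp add: algebra_simps sum_subtractf sum_distrib_left sum_divide_distrib)
      finally show "M $$ (i, j) = \<dots>" .
    qed simp
    then show False using a0 rankM r by simp
  qed
  define X where "X = image_mset l (mset_set {..<r})"
  have szX: "size X = r" and setX: "set_mset X = l ` {..<r}" by (auto simp: X_def)
  have proots_x: "proots ([:0, 1:] ^ k :: real poly) = replicate_mset k 0" for k
    by (induction k) (simp_all add: proots_mult del: mult_pCons_left mult_pCons_right)
  have "proots (char_poly ?A * [:0, 1:] ^ q) = X + replicate_mset q 0"
  proof -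
    have "(\<Sum>k\<in>K. {#l k#}) = image_mset l (mset_set K)" if "finite K" for K
      using that by (induction K rule: finite_induct) auto
    then show ?thesis
      by (simp add: proots_mult proots_x cp X_def proots_prod)
  qed
  \<comment> \<open>The root multiset of a product is the sum of the root multisets only for
    non-zero factors; this one is monic.\<close>
  moreover have "char_poly (transpose_mat C * C) \<noteq> 0"
    using degree_monic_char_poly[of "transpose_mat C * C" q] C by (metis carrier_matI index_mult_mat(2,3) index_transpose_mat(2) leading_coeff_0_iff one_neq_zero carrier_matD(2))
  then have "proots (char_poly (transpose_mat C * C) * [:0, 1:] ^ r)
      = proots (char_poly (transpose_mat C * C)) + replicate_mset r 0"
    by (simp add: proots_mult proots_x)
  ultimately have "proots (char_poly (transpose_mat C * C)) + replicate_mset r 0 = X + replicate_mset (q - r) 0 + replicate_mset r 0"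
    unfolding char_poly_gram_swap[OF C] using rq
    by (auto simp: multiset_eq_iff)
  then have proots: "proots (char_poly (transpose_mat M * M)) = X + replicate_mset (q - r) 0"
    unfolding MM by simp
  define ys where "ys = sorted_list_of_multiset X"
  have ys: "length ys = r" "sorted ys" "set ys = l ` {..<r}"
    unfolding ys_def using szX setX
    by (simp_all flip: size_mset add: sorted_sorted_list_of_multiset) 
  have slist: "sorted_list_of_multiset (X + replicate_mset (q - r) 0) = replicate (q - r) 0 @ ys"
    unfolding ys_def by (rule sorted_list_of_multiset_add_zeros) (use l_pos setX in \<open>auto simp: less_imp_le\<close>)
  \<comment> \<open>The \<open>q - r\<close> zeros come first in the increasing list, hence last
    after the reversal, and do not disturb the first \<open>r\<close> places.\<close>
  have sv: "singular_value k M = sqrt (ys ! (r - k))" if "0 < k" "k \<le> r" for k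
  proof -
    have k: "k - 1 < length (rev ys)" "r - Suc (k - 1) = r - k" using that ys(1) by auto
    then show ?thesis
      unfolding singular_value_def proots slist by (simp add: nth_append rev_nth ys(1))
  qed
  have min: "ys ! 0 \<le> l k" and max: "l k \<le> ys ! (r - 1)" if k: "k < r" for k
  proof -
    obtain i where i: "i < r" "ys ! i = l k" using ys k by (metis image_eqI in_set_conv_nth lessThan_iff)
    show "ys ! 0 \<le> l k" "l k \<le> ys ! (r - 1)"
      using sorted_nth_mono[OF ys(2), of 0 i] sorted_nth_mono[OF ys(2), of i "r - 1"] i ys(1) by auto
  qed
  have "ys ! 0 \<in> l ` {..<r}" using ys r by (metis nth_mem)
  then have pos: "0 < ys ! 0" using l_pos by auto
  have pos': "0 < ys ! (r - 1)" using l_pos[OF r] max[OF r] by linarith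
  show "0 < singular_value r M" using sv[of r] r pos by simp
  have "ys ! 0 \<le> ys ! (r - 1)" using min[OF r] max[OF r] by linarith
  then show "singular_value r M \<le> singular_value 1 M" using sv[of r] sv[of 1] r by simp
  let ?w = "\<lambda>k. (\<Sum>a<r. u a * P $$ (a, k))\<^sup>2"
  have "(singular_value r M)\<^sup>2 * (\<Sum>k<r. ?w k) \<le> (\<Sum>k<r. l k * ?w k)"
    unfolding sum_distrib_left using sv[of r] r pos min
    by (intro sum_mono mult_right_mono) auto
  then show "(singular_value r M)\<^sup>2 * (\<Sum>a<r. (u a)\<^sup>2) \<le> (\<Sum>j<q. (\<Sum>a<r. u a * C $$ (a, j))\<^sup>2)"
    by (simp only: form norm)
  have "(\<Sum>k<r. l k * ?w k) \<le> (singular_value 1 M)\<^sup>2 * (\<Sum>k<r. ?w k)"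
    unfolding sum_distrib_left using sv[of 1] r pos' max
    by (intro sum_mono mult_right_mono) auto
  then show "(\<Sum>j<q. (\<Sum>a<r. u a * C $$ (a, j))\<^sup>2) \<le> (singular_value 1 M)\<^sup>2 * (\<Sum>a<r. (u a)\<^sup>2)"
    by (simp only: form norm)
qed

text \<open>The orthogonal polar factor of \<open>G\<close>; the trace hypothesis makes \<open>G\<close> invertible.\<close>
lemma orthogonal_factor_of_contraction:
  fixes G :: "real mat"
  assumes G: "G \<in> carrier_mat r r"
    and contr: "\<And>u. (\<Sum>i<r. (\<Sum>j<r. G $$ (i, j) * u j)\<^sup>2) \<le> (\<Sum>j<r. (u j)\<^sup>2)"
    and trace: "real r - (\<Sum>i<r. \<Sum>j<r. (G $$ (i, j))\<^sup>2) < 1"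
  obtains R where "R \<in> carrier_mat r r" "transpose_mat R * R = 1\<^sub>m r"
    "(\<Sum>i<r. \<Sum>j<r. (G $$ (i, j))\<^sup>2) \<le> (\<Sum>i<r. \<Sum>j<r. R $$ (i, j) * G $$ (i, j))"
proof -
  let ?A = "transpose_mat G * G"
  have A: "?A \<in> carrier_mat r r" and symA: "transpose_mat ?A = ?A"
    using G by (auto simp: transpose_mult[of _ r r _ r])
  obtain P l where P: "P \<in> carrier_mat r r"
    and PP': "P * transpose_mat P = 1\<^sub>m r"
    and D: "transpose_mat P * ?A * P = mat_diag r l"
    and PPr: "\<And>i j. i < r \<Longrightarrow> j < r \<Longrightarrow> (\<Sum>k<r. P $$ (i, k) * P $$ (j, k)) = (if i = j then 1 else 0)"
    and PPc: "\<And>i j. i < r \<Longrightarrow> j < r \<Longrightarrow> (\<Sum>k<r. P $$ (k, i) * P $$ (k, j)) = (if i = j then 1 else 0)"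
    by (rule real_symmetric_eigenbasis[OF A symA]) (rule that; assumption)
  note assoc = assoc_mult_mat[of _ r r _ r _ r]
  define H where "H = G * P"
  have H: "H \<in> carrier_mat r r" using G P by (simp add: H_def)
  have HH: "transpose_mat H * H = mat_diag r l"
    unfolding D[symmetric] H_def using G P by (simp add: transpose_mult[of _ r r _ r] assoc)
  have Hi: "H $$ (i, k) = (\<Sum>j<r. G $$ (i, j) * P $$ (j, k))" if "i < r" "k < r" for i k
    unfolding H_def using mult_mat_index_sum[OF G P that] .
  have l: "(\<Sum>i<r. (H $$ (i, k))\<^sup>2) = l k" if "k < r" for k
    using arg_cong[OF HH, of "\<lambda>M. M $$ (k, k)"] H that
    by (subst (asm) mult_mat_index_sum[of _ r r _ r]) (auto simp: mat_diag_def power2_eq_square)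
  have l0: "0 \<le> l k" if "k < r" for k unfolding l[OF that, symmetric] by (intro sum_nonneg) auto
  have l1: "l k \<le> 1" if "k < r" for k
    using contr[of "\<lambda>j. P $$ (j, k)"] that PPc[OF that that] by (simp add: Hi power2_eq_square flip: l)
  have row: "(\<Sum>k<r. (H $$ (i, k))\<^sup>2) = (\<Sum>j<r. (G $$ (i, j))\<^sup>2)" if "i < r" for i
  proof -
    have "(\<Sum>k<r. (H $$ (i, k))\<^sup>2) = (\<Sum>k<r. \<Sum>j<r. \<Sum>j'<r. G $$ (i, j) * G $$ (i, j') * (P $$ (j, k) * P $$ (j', k)))"
      using that by (simp add: Hi power2_eq_square sum_product mult_ac)
    also have "\<dots> = (\<Sum>j<r. \<Sum>k<r. \<Sum>j'<r. G $$ (i, j) * G $$ (i, j') * (P $$ (j, k) * P $$ (j', k)))"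
      by (rule sum.swap)
    also have "\<dots> = (\<Sum>j<r. \<Sum>j'<r. \<Sum>k<r. G $$ (i, j) * G $$ (i, j') * (P $$ (j, k) * P $$ (j', k)))"
      by (intro sum.cong refl sum.swap)
    also have "\<dots> = (\<Sum>j<r. (G $$ (i, j))\<^sup>2)"
      by (simp add: sum_distrib_left[symmetric] PPr power2_eq_square if_distrib cong: if_cong)
    finally show ?thesis .
  qed
  have sum_l: "(\<Sum>k<r. l k) = (\<Sum>i<r. \<Sum>j<r. (G $$ (i, j))\<^sup>2)"
  proof -
    have "(\<Sum>k<r. l k) = (\<Sum>k<r. \<Sum>i<r. (H $$ (i, k))\<^sup>2)" by (simp add: l)
    also have "\<dots> = (\<Sum>i<r. \<Sum>k<r. (H $$ (i, k))\<^sup>2)" by (rule sum.swap)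
    finally show ?thesis by (simp add: row)
  qed
  \<comment> \<open>The numbers \<open>1 - l i\<close> are nonnegative and sum to less than 1, so
    none of them reaches 1.\<close>
  have lpos: "0 < l k" if k: "k < r" for k
  proof -
    have "1 - l k \<le> (\<Sum>i<r. 1 - l i)"
      by (rule member_le_sum) (use k l1 in auto)
    also have "\<dots> < 1" using trace by (simp add: sum_subtractf sum_l)
    finally show ?thesis by simp
  qed
  define W where "W = mat_diag r (\<lambda>k. 1 / sqrt (l k))"
  have W: "W \<in> carrier_mat r r" "transpose_mat W = W" by (auto simp: W_def mat_diag_def intro!: eq_matI)
  have WW: "W * mat_diag r l * W = 1\<^sub>m r"
    unfolding W_def mat_diag_mult_left[OF mat_diag_dim]
  proof (subst mat_diag_mult_right[of _ r r])
    have "1 / sqrt (l k) * l k * (1 / sqrt (l k)) = 1" if "k < r" for k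
      using lpos[OF that] by simp
    then show "mat r r (\<lambda>(i, j). mat r r (\<lambda>(i, j). 1 / sqrt (l i) * mat_diag r l $$ (i, j)) $$ (i, j) *
        (1 / sqrt (l j))) = 1\<^sub>m r"
      by (intro eq_matI) (auto simp: mat_diag_def)
  qed simp
  \<comment> \<open>This is \<open>G\<close> times the inverse square root of
    \<open>G\<^sup>T G\<close>, the root being formed in the eigenbasis \<open>P\<close>.\<close>
  define R where "R = H * W * transpose_mat P"
  have R: "R \<in> carrier_mat r r" using H W P by (simp add: R_def)
  have Rt: "transpose_mat R = P * (W * transpose_mat H)"
    unfolding R_def using H W P by (simp add: transpose_mult[of _ r r _ r])
  have "transpose_mat R * R = P * ((W * (transpose_mat H * H) * W) * transpose_mat P)"
    unfolding Rt unfolding R_def using H W P by (simp add: assoc)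
  also have "\<dots> = 1\<^sub>m r" unfolding HH WW using P PP' by simp
  finally have RR: "transpose_mat R * R = 1\<^sub>m r" .
  have Rij: "R $$ (i, j) = (\<Sum>k<r. H $$ (i, k) / sqrt (l k) * P $$ (j, k))" if "i < r" "j < r" for i j
    unfolding R_def using that H W P
    by (subst mult_mat_index_sum[of _ r r _ r]) (auto simp: W_def mat_diag_mult_right[OF H])
  have "(\<Sum>j<r. R $$ (i, j) * G $$ (i, j)) = (\<Sum>k<r. (H $$ (i, k))\<^sup>2 / sqrt (l k))" if "i < r" for i
  proof -
    have "(\<Sum>j<r. R $$ (i, j) * G $$ (i, j)) = (\<Sum>j<r. \<Sum>k<r. H $$ (i, k) / sqrt (l k) * (G $$ (i, j) * P $$ (j, k)))"
      using that by (simp add: Rij sum_distrib_left sum_distrib_right mult_ac)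
    also have "\<dots> = (\<Sum>k<r. \<Sum>j<r. H $$ (i, k) / sqrt (l k) * (G $$ (i, j) * P $$ (j, k)))"
      by (rule sum.swap)
    also have "\<dots> = (\<Sum>k<r. (H $$ (i, k))\<^sup>2 / sqrt (l k))"
      unfolding sum_distrib_left[symmetric] using that by (simp add: Hi power2_eq_square)
    finally show ?thesis .
  qed
  then have "(\<Sum>i<r. \<Sum>j<r. R $$ (i, j) * G $$ (i, j)) = (\<Sum>i<r. \<Sum>k<r. (H $$ (i, k))\<^sup>2 / sqrt (l k))"
    by simp
  also have "\<dots> = (\<Sum>k<r. \<Sum>i<r. (H $$ (i, k))\<^sup>2 / sqrt (l k))" by (rule sum.swap)
  also have "\<dots> = (\<Sum>k<r. sqrt (l k))"
    by (intro sum.cong refl) (use lpos in \<open>auto simp: l real_div_sqrt less_imp_le simp flip: sum_divide_distrib\<close>)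
  \<comment> \<open>The trace of \<open>R\<^sup>T G\<close> is the sum of the singular values of
    \<open>G\<close>. These lie in [0, 1] because \<open>G\<close> is a contraction, so each
    dominates its square.\<close>
  also have "\<dots> \<ge> (\<Sum>k<r. l k)"
  proof (intro sum_mono)
    fix k assume "k \<in> {..<r}"
    then have "0 \<le> l k" "l k \<le> 1" using l0 l1 by auto
    then have "l k * l k \<le> l k" by (simp add: mult_left_le)
    then show "l k \<le> sqrt (l k)" by (intro real_le_rsqrt) (simp add: power2_eq_square)
  qed
  finally show thesis using that[OF R RR] sum_l by simp
qed

section \<open>Multi-indices on blocks of modes and their mixed-radix numbering\<close>

lemma sum_mult_lessThan:
  fixes g :: "nat \<Rightarrow> nat \<Rightarrow> 'a::comm_monoid_add"
  shows "(\<Sum>p<n * k. g (p div k) (p mod k)) = (\<Sum>t<n. \<Sum>a<k. g t a)"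
proof -
  have "(\<Sum>p<n * k. g (p div k) (p mod k)) = (\<Sum>t<n. \<Sum>p\<in>{t * k..<t * k + k}. g (p div k) (p mod k))"
    by (rule sum.nat_group[symmetric])
  also have "\<dots> = (\<Sum>t<n. \<Sum>a<k. g t a)"
  proof (rule sum.cong[OF refl])
    fix t
    have "(\<Sum>p\<in>{t * k..<t * k + k}. g (p div k) (p mod k)) = (\<Sum>a\<in>{0..<k}. g ((a + t * k) div k) ((a + t * k) mod k))"
      using sum.shift_bounds_nat_ivl[of "\<lambda>p. g (p div k) (p mod k)" 0 "t * k" k] by (simp add: add.commute)
    also have "\<dots> = (\<Sum>a<k. g t a)"
      by (intro sum.cong) auto
    finally show "(\<Sum>p\<in>{t * k..<t * k + k}. g (p div k) (p mod k)) = (\<Sum>a<k. g t a)" .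
  qed
  finally show ?thesis .
qed

text \<open>The lower bound is exclusive, so that \<open>idx d 0 k\<close> and
  \<open>idx d k N\<close> index the rows and the columns of the \<open>k\<close>-th
  unfolding.\<close>

definition idx :: "(nat \<Rightarrow> nat) \<Rightarrow> nat \<Rightarrow> nat \<Rightarrow> (nat \<Rightarrow> nat) set" where
  "idx d m n = PiE {Suc m..n} (\<lambda>i. {..<d i})"

definition merge :: "nat \<Rightarrow> (nat \<Rightarrow> nat) \<Rightarrow> (nat \<Rightarrow> nat) \<Rightarrow> nat \<Rightarrow> nat" where
  "merge k s t = (\<lambda>j. if j \<le> k then s j else t j)"

text \<open>The decoding inside \<open>unfold_idx\<close>, for one block of modes; rows and columns
  become two instances of it.\<close>

definition digits :: "(nat \<Rightarrow> nat) \<Rightarrow> nat \<Rightarrow> nat \<Rightarrow> nat \<Rightarrow> nat \<Rightarrow> nat" where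
  "digits d m n p = (\<lambda>j\<in>{Suc m..n}. (p div (\<Prod>l\<in>{Suc m..<j}. d l)) mod d j)"

lemma tensor_idx_eq: "tensor_idx N d = idx d 0 N"
  by (simp add: tensor_idx_def idx_def)

lemma finite_idx [simp]: "finite (idx d m n)"
  unfolding idx_def by (intro finite_PiE) auto

lemma idx_less: "s \<in> idx d m n \<Longrightarrow> m < j \<Longrightarrow> j \<le> n \<Longrightarrow> s j < d j"
  by (auto simp: idx_def PiE_iff)

lemma idx_self: "idx d m m = {\<lambda>_. undefined}"
  by (simp add: idx_def)

lemma sum_idx_Suc:
  assumes "m \<le> n"
  shows "(\<Sum>s\<in>idx d m (Suc n). h s) = (\<Sum>s\<in>idx d m n. \<Sum>t<d (Suc n). h (s(Suc n := t)))"
proof -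
  have *: "{Suc m..Suc n} = insert (Suc n) {Suc m..n}" using assms by auto
  have "(\<Sum>s\<in>idx d m (Suc n). h s) = (\<Sum>(t, s)\<in>{..<d (Suc n)} \<times> idx d m n. h (s(Suc n := t)))"
    unfolding idx_def * PiE_insert_eq
    by (subst sum.reindex) (auto simp: split_def intro!: inj_combinator[unfolded split_def] sum.cong)
  also have "\<dots> = (\<Sum>t<d (Suc n). \<Sum>s\<in>idx d m n. h (s(Suc n := t)))"
    by (simp add: sum.cartesian_product)
  also have "\<dots> = (\<Sum>s\<in>idx d m n. \<Sum>t<d (Suc n). h (s(Suc n := t)))" by (rule sum.swap)
  finally show ?thesis .
qed

lemma merge_in_idx:
  assumes "s \<in> idx d m k" "t \<in> idx d k n" "m \<le> k" "k \<le> n"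
  shows "merge k s t \<in> idx d m n"
  using assms by (auto simp: idx_def merge_def PiE_iff extensional_def Pi_iff)

lemma sum_idx_split:
  assumes "m \<le> k" "k \<le> n"
  shows "(\<Sum>s\<in>idx d m n. h s) = (\<Sum>s\<in>idx d m k. \<Sum>t\<in>idx d k n. h (merge k s t))"
  using assms(2)
proof (induction n arbitrary: h rule: dec_induct)
  case base
  have "merge k s (\<lambda>_. undefined) = s" if "s \<in> idx d m k" for s
    using that by (auto simp: idx_def merge_def PiE_iff extensional_def)
  then show ?case by (simp add: idx_self)
next
  case (step n)
  have "merge k s (t(Suc n := x)) = (merge k s t)(Suc n := x)" for s t x
    using step by (auto simp: merge_def)
  then show ?case using step assms(1) by (simp add: sum_idx_Suc)
qed

text \<open>Mode \<open>n + 1\<close> runs slowest, so its position is the quotient of the number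
  and the remaining modes are decoded from the remainder.\<close>

lemma digits_Suc:
  assumes "m \<le> n" "p < (\<Prod>j\<in>{Suc m..n}. d j)" "t < d (Suc n)"
  shows "digits d m (Suc n) (t * (\<Prod>j\<in>{Suc m..n}. d j) + p) = (digits d m n p)(Suc n := t)"
proof
  fix j
  let ?P = "\<Prod>j\<in>{Suc m..n}. d j"
  consider "j = Suc n" | "j \<in> {Suc m..n}" | "j \<notin> {Suc m..Suc n}" using assms(1) by fastforce
  then show "digits d m (Suc n) (t * ?P + p) j = ((digits d m n p)(Suc n := t)) j"
  proof cases
    case 1
    have "{Suc m..<Suc n} = {Suc m..n}" by auto
    moreover have "(x * P + y) div P = x" if "y < P" for x y P :: nat
      using that by (intro div_nat_eqI) (auto simp: algebra_simps)
    from this[OF assms(2)] have "(t * ?P + p) div ?P = t" .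
    ultimately show ?thesis using 1 assms by (simp add: digits_def)
  next
    case 2
    let ?Q = "\<Prod>l\<in>{Suc m..<j}. d l" and ?S = "\<Prod>l\<in>{Suc j..n}. d l"
    have "{Suc m..n} = {Suc m..<j} \<union> insert j {Suc j..n}" using 2 by auto
    then have P: "?P = ?Q * (d j * ?S)"
    proof -
      have "prod d ({Suc m..<j} \<union> insert j {Suc j..n}) = ?Q * prod d (insert j {Suc j..n})"
        by (rule prod.union_disjoint) auto
      then show ?thesis using \<open>{Suc m..n} = _\<close> by simp
    qed
    have "(t * ?P + p) div ?Q mod d j = p div ?Q mod d j"
    proof (cases "?Q = 0")
      case True
      then show ?thesis by (simp only: div_by_0)
    next
      case False
      \<comment> \<open>After division by \<open>?Q\<close> the top digit contributes a multiple of
        \<open>d j\<close>, which \<open>mod d j\<close> removes.\<close>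
      have "t * ?P + p = p + ?Q * (t * (d j * ?S))" unfolding P by simp
      then have "(t * ?P + p) div ?Q = p div ?Q + d j * (t * ?S)"
        using div_mult_self2[OF False, of p "t * (d j * ?S)"]
        by (simp only: mult.left_commute mult.commute mult.assoc add.commute)
      then show ?thesis by simp
    qed
    then show ?thesis using 2 by (simp add: digits_def)
  next
    case 3
    then have "j \<noteq> Suc n" using assms(1) by auto
    with 3 show ?thesis by (auto simp: digits_def)
  qed
qed

text \<open>The bijection between numbers and multi-indices in the form of a sum identity, which an
  induction on the slowest mode proves without an explicit inverse.\<close>

lemma sum_digits:
  assumes "m \<le> n"
  shows "(\<Sum>p<(\<Prod>j\<in>{Suc m..n}. d j). h (digits d m n p)) = (\<Sum>s\<in>idx d m n. h s)"
  using assms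
proof (induction n arbitrary: h rule: dec_induct)
  case base
  then show ?case by (simp add: idx_self digits_def restrict_def)
next
  case (step n)
  let ?P = "\<Prod>j\<in>{Suc m..n}. d j"
  have "{Suc m..Suc n} = insert (Suc n) {Suc m..n}" using step by auto
  then have "(\<Prod>j\<in>{Suc m..Suc n}. d j) = d (Suc n) * ?P" by simp
  then have "(\<Sum>p<(\<Prod>j\<in>{Suc m..Suc n}. d j). h (digits d m (Suc n) p))
      = (\<Sum>p<d (Suc n) * ?P. h (digits d m (Suc n) (p div ?P * ?P + p mod ?P)))"
    unfolding div_mult_mod_eq by (simp only:)
  also have "\<dots> = (\<Sum>t<d (Suc n). \<Sum>p<?P. h (digits d m (Suc n) (t * ?P + p)))"
    by (rule sum_mult_lessThan[where g = "\<lambda>t p. h (digits d m (Suc n) (t * ?P + p))"])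
  also have "\<dots> = (\<Sum>t<d (Suc n). \<Sum>p<?P. h ((digits d m n p)(Suc n := t)))"
    using step by (simp add: digits_Suc)
  also have "\<dots> = (\<Sum>t<d (Suc n). \<Sum>s\<in>idx d m n. h (s(Suc n := t)))"
    by (intro sum.cong refl step.IH)
  also have "\<dots> = (\<Sum>s\<in>idx d m n. \<Sum>t<d (Suc n). h (s(Suc n := t)))" by (rule sum.swap)
  also have "\<dots> = (\<Sum>s\<in>idx d m (Suc n). h s)" using step by (simp add: sum_idx_Suc)
  finally show ?case .
qed

lemma digits_in_idx:
  assumes "p < (\<Prod>j\<in>{Suc m..n}. d j)"
  shows "digits d m n p \<in> idx d m n"
proof -
  have "d j > 0" if "j \<in> {Suc m..n}" for j
  proof (rule ccontr)
    assume "\<not> d j > 0"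
    then have "(\<Prod>j\<in>{Suc m..n}. d j) = 0" using that by (intro prod_zero) auto
    with assms show False by simp
  qed
  then show ?thesis by (auto simp: digits_def idx_def)
qed

lemma unfold_idx_merge:
  assumes "i \<le> N"
  shows "unfold_idx N d i p q = merge i (digits d 0 i p) (digits d i N q)"
  using assms by (auto simp: unfold_idx_def merge_def digits_def fun_eq_iff)

lemma Cauchy_Schwarz_sum:
  fixes f g :: "'a \<Rightarrow> real"
  shows "(\<Sum>i\<in>A. f i * g i)\<^sup>2 \<le> (\<Sum>i\<in>A. (f i)\<^sup>2) * (\<Sum>i\<in>A. (g i)\<^sup>2)"
proof -
  have "\<bar>\<Sum>i\<in>A. f i * g i\<bar> \<le> (\<Sum>i\<in>A. \<bar>f i\<bar> * \<bar>g i\<bar>)"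
    by (rule order_trans[OF sum_abs]) (simp add: abs_mult)
  also have "\<dots> \<le> L2_set f A * L2_set g A" by (rule L2_set_mult_ineq)
  finally have "(\<Sum>i\<in>A. f i * g i)\<^sup>2 \<le> (L2_set f A * L2_set g A)\<^sup>2"
    by (rule abs_le_square_iff[THEN iffD1, OF order_trans]) simp
  then show ?thesis
    by (simp add: L2_set_def power_mult_distrib sum_nonneg)
qed

section \<open>Partial products of a tensor train\<close>

text \<open>The row vector \<open>F 1 (s 1) \<cdots> F k (s k)\<close> and the column vector
  \<open>F (k+1) (s (k+1)) \<cdots> F N (s N)\<close>.\<close>

fun lvec :: "(nat \<Rightarrow> nat) \<Rightarrow> factors \<Rightarrow> nat \<Rightarrow> (nat \<Rightarrow> nat) \<Rightarrow> nat \<Rightarrow> real" where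
  "lvec r F 0 s b = 1"
| "lvec r F (Suc k) s b = (\<Sum>a<r k. lvec r F k s a * F (Suc k) (s (Suc k)) $$ (a, b))"

definition rvec :: "nat \<Rightarrow> factors \<Rightarrow> nat \<Rightarrow> (nat \<Rightarrow> nat) \<Rightarrow> nat \<Rightarrow> real" where
  "rvec N F k s a = mat_prod 1 (map (\<lambda>i. F i (s i)) [Suc k..<Suc N]) $$ (a, 0)"

lemma tt_factors_carrier:
  "tt_factors N d r F \<Longrightarrow> 1 \<le> i \<Longrightarrow> i \<le> N \<Longrightarrow> t < d i \<Longrightarrow> F i t \<in> carrier_mat (r (i - 1)) (r i)"
  by (auto simp: tt_factors_def)

lemma lvec_cong:
  assumes "\<And>j. 1 \<le> j \<Longrightarrow> j \<le> k \<Longrightarrow> F j (s j) = F' j (s' j)"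
  shows "lvec r F k s = lvec r F' k s'"
proof
  show "lvec r F k s b = lvec r F' k s' b" for b
    using assms by (induction k arbitrary: b) auto
qed

lemma rvec_cong:
  assumes "\<And>j. k < j \<Longrightarrow> j \<le> N \<Longrightarrow> F j (s j) = F' j (s' j)"
  shows "rvec N F k s = rvec N F' k s'"
  unfolding rvec_def using assms by (intro ext arg_cong[of _ _ "\<lambda>x. mat_prod 1 x $$ (_, 0)"]) auto

lemma rvec_last: "rvec N F N s 0 = 1"
  by (simp add: rvec_def mat_prod_def)

lemma tt_tensor_rvec: "tt_tensor N F s = rvec N F 0 s 0"
  by (simp add: tt_tensor_def rvec_def)

lemma tt_tensor_cong:
  assumes "\<And>j. 1 \<le> j \<Longrightarrow> j \<le> N \<Longrightarrow> F j (s j) = F' j (s' j)"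
  shows "tt_tensor N F s = tt_tensor N F' s'"
  unfolding tt_tensor_rvec using assms by (subst rvec_cong[of 0 N F s F' s']) auto

lemma mat_prod_carrier:
  assumes F: "tt_factors N d r F" and "k \<le> N" and s: "\<And>j. k < j \<Longrightarrow> j \<le> N \<Longrightarrow> s j < d j"
  shows "mat_prod 1 (map (\<lambda>i. F i (s i)) [Suc k..<Suc N]) \<in> carrier_mat (r k) 1"
  using assms(2) s
proof (induction k rule: inc_induct)
  case base
  then show ?case using F by (simp add: mat_prod_def tt_factors_def)
next
  case (step k)
  have "F (Suc k) (s (Suc k)) \<in> carrier_mat (r k) (r (Suc k))"
    using tt_factors_carrier[OF F, of "Suc k" "s (Suc k)"] step.hyps step.prems[of "Suc k"] by auto
  then show ?case
    using step by (simp add: upt_conv_Cons[of "Suc k" "Suc N"] mat_prod_def del: upt_Suc)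
qed

lemma rvec_step:
  assumes F: "tt_factors N d r F" and "k < N" and s: "\<And>j. k < j \<Longrightarrow> j \<le> N \<Longrightarrow> s j < d j" and a: "a < r k"
  shows "rvec N F k s a = (\<Sum>b<r (Suc k). F (Suc k) (s (Suc k)) $$ (a, b) * rvec N F (Suc k) s b)"
proof -
  have 1: "F (Suc k) (s (Suc k)) \<in> carrier_mat (r k) (r (Suc k))"
    using tt_factors_carrier[OF F, of "Suc k" "s (Suc k)"] \<open>k < N\<close> s[of "Suc k"] by auto
  have 2: "mat_prod 1 (map (\<lambda>i. F i (s i)) [Suc (Suc k)..<Suc N]) \<in> carrier_mat (r (Suc k)) 1"
    by (rule mat_prod_carrier[OF F]) (use assms in auto)
  have "rvec N F k s a = (F (Suc k) (s (Suc k)) * mat_prod 1 (map (\<lambda>i. F i (s i)) [Suc (Suc k)..<Suc N])) $$ (a, 0)"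
    using \<open>k < N\<close> by (simp add: rvec_def upt_conv_Cons[of "Suc k" "Suc N"] mat_prod_def del: upt_Suc)
  then show ?thesis
    using mult_mat_index_sum[OF 1 2 a] by (simp add: rvec_def)
qed

lemma tt_tensor_split:
  assumes F: "tt_factors N d r F" and s: "\<And>j. 0 < j \<Longrightarrow> j \<le> N \<Longrightarrow> s j < d j" and "k \<le> N"
  shows "tt_tensor N F s = (\<Sum>a<r k. lvec r F k s a * rvec N F k s a)"
  using \<open>k \<le> N\<close>
proof (induction k)
  case 0
  then show ?case using F by (simp add: tt_tensor_rvec tt_factors_def)
next
  case (Suc k)
  then have "tt_tensor N F s = (\<Sum>a<r k. lvec r F k s a * rvec N F k s a)" by simp
  also have "\<dots> = (\<Sum>a<r k. \<Sum>b<r (Suc k). lvec r F k s a * F (Suc k) (s (Suc k)) $$ (a, b) * rvec N F (Suc k) s b)"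
    using Suc.prems by (intro sum.cong refl) (subst rvec_step[OF F], auto simp: sum_distrib_left s mult.assoc)
  also have "\<dots> = (\<Sum>b<r (Suc k). \<Sum>a<r k. lvec r F k s a * F (Suc k) (s (Suc k)) $$ (a, b) * rvec N F (Suc k) s b)"
    by (rule sum.swap)
  finally show ?case by (simp add: sum_distrib_right)
qed

text \<open>Exhibits linearity in slot \<open>i\<close>: neither \<open>lvec\<close> at
  \<open>i - 1\<close> nor \<open>rvec\<close> at \<open>i\<close> involves factor
  \<open>i\<close>.\<close>

lemma tt_tensor_mid:
  assumes F: "tt_factors N d r F" and s: "\<And>j. 0 < j \<Longrightarrow> j \<le> N \<Longrightarrow> s j < d j" and "1 \<le> i" "i \<le> N"
  shows "tt_tensor N F s = (\<Sum>a<r (i - 1). \<Sum>b<r i. lvec r F (i - 1) s a * F i (s i) $$ (a, b) * rvec N F i s b)"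
proof -
  obtain k where k: "i = Suc k" using \<open>1 \<le> i\<close> by (cases i) auto
  have "tt_tensor N F s = (\<Sum>b<r (Suc k). lvec r F (Suc k) s b * rvec N F (Suc k) s b)"
    by (rule tt_tensor_split[OF F s]) (use assms k in auto)
  also have "\<dots> = (\<Sum>b<r (Suc k). \<Sum>a<r k. lvec r F k s a * F (Suc k) (s (Suc k)) $$ (a, b) * rvec N F (Suc k) s b)"
    by (simp add: sum_distrib_right)
  also have "\<dots> = (\<Sum>a<r k. \<Sum>b<r (Suc k). lvec r F k s a * F (Suc k) (s (Suc k)) $$ (a, b) * rvec N F (Suc k) s b)"
    by (rule sum.swap)
  finally show ?thesis by (simp add: k)
qed

section \<open>Norm bounds\<close>

text \<open>A condition on one mode only, so that it survives the replacement of other factors;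
  families that mix factors of \<open>F\<close>, of \<open>Y\<close> and differences are orthogonal
  in some modes but not in all.\<close>

definition left_orth_at :: "(nat \<Rightarrow> nat) \<Rightarrow> (nat \<Rightarrow> nat) \<Rightarrow> factors \<Rightarrow> nat \<Rightarrow> bool" where
  "left_orth_at d r F i \<longleftrightarrow> (\<forall>b<r i. \<forall>c<r i.
     (\<Sum>t<d i. \<Sum>a<r (i - 1). F i t $$ (a, b) * F i t $$ (a, c)) = (if b = c then 1 else 0))"

definition factor_norm_sq :: "(nat \<Rightarrow> nat) \<Rightarrow> (nat \<Rightarrow> nat) \<Rightarrow> factors \<Rightarrow> nat \<Rightarrow> real" where
  "factor_norm_sq d r F i = (\<Sum>t<d i. \<Sum>a<r (i - 1). \<Sum>b<r i. (F i t $$ (a, b))\<^sup>2)"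

text \<open>\<open>left_op_bound\<close> and \<open>right_op_bound\<close> bound the squared operator norm of the interface matrices
  with rows \<open>lvec r F k s\<close> and \<open>rvec N F k s\<close>; \<open>left_frob_sq\<close> is a squared Frobenius norm.\<close>

definition left_op_bound :: "(nat \<Rightarrow> nat) \<Rightarrow> (nat \<Rightarrow> nat) \<Rightarrow> factors \<Rightarrow> nat \<Rightarrow> real \<Rightarrow> bool" where
  "left_op_bound d r F k c \<longleftrightarrow> (\<forall>u. (\<Sum>s\<in>idx d 0 k. (\<Sum>a<r k. lvec r F k s a * u a)\<^sup>2) \<le> c * (\<Sum>a<r k. (u a)\<^sup>2))"

definition left_frob_sq :: "(nat \<Rightarrow> nat) \<Rightarrow> (nat \<Rightarrow> nat) \<Rightarrow> factors \<Rightarrow> nat \<Rightarrow> real" where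
  "left_frob_sq d r F k = (\<Sum>s\<in>idx d 0 k. \<Sum>a<r k. (lvec r F k s a)\<^sup>2)"

definition right_op_bound :: "nat \<Rightarrow> (nat \<Rightarrow> nat) \<Rightarrow> (nat \<Rightarrow> nat) \<Rightarrow> factors \<Rightarrow> nat \<Rightarrow> real \<Rightarrow> bool" where
  "right_op_bound N d r F k c \<longleftrightarrow> (\<forall>u. (\<Sum>s\<in>idx d k N. (\<Sum>a<r k. u a * rvec N F k s a)\<^sup>2) \<le> c * (\<Sum>a<r k. (u a)\<^sup>2))"

lemma lvec_upd: "lvec r F k (s(Suc k := t)) = lvec r F k s"
  by (rule lvec_cong) auto

lemma lvec_merge: "j \<le> k \<Longrightarrow> lvec r F j (merge k s t) = lvec r F j s"
  by (rule lvec_cong) (auto simp: merge_def)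

lemma rvec_merge: "k \<le> j \<Longrightarrow> rvec N F j (merge k s t) = rvec N F j t"
  by (rule rvec_cong) (auto simp: merge_def)

text \<open>Once the Gram matrix of interface \<open>k\<close> is the identity, the one of interface
  \<open>k + 1\<close> reduces to the Gram matrix of the left unfolding of factor
  \<open>k + 1\<close>.\<close>

lemma left_gram:
  assumes "r 0 = 1" "\<And>i. 1 \<le> i \<Longrightarrow> i \<le> k \<Longrightarrow> left_orth_at d r F i" "b < r k" "c < r k"
  shows "(\<Sum>s\<in>idx d 0 k. lvec r F k s b * lvec r F k s c) = (if b = c then 1 else 0)"
  using assms(2-)
proof (induction k arbitrary: b c)
  case 0
  then show ?case using assms(1) by (simp add: idx_self)
next
  case (Suc k)
  let ?F = "\<lambda>t. F (Suc k) t"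
  have "(\<Sum>s\<in>idx d 0 (Suc k). lvec r F (Suc k) s b * lvec r F (Suc k) s c)
    = (\<Sum>s\<in>idx d 0 k. \<Sum>t<d (Suc k). (\<Sum>a<r k. lvec r F k s a * ?F t $$ (a, b)) * (\<Sum>a<r k. lvec r F k s a * ?F t $$ (a, c)))"
    by (simp add: sum_idx_Suc lvec_upd)
  also have "\<dots> = (\<Sum>s\<in>idx d 0 k. \<Sum>t<d (Suc k). \<Sum>a<r k. \<Sum>a'<r k. ?F t $$ (a, b) * ?F t $$ (a', c) * (lvec r F k s a * lvec r F k s a'))"
    by (simp add: sum_product mult_ac)
  also have "\<dots> = (\<Sum>t<d (Suc k). \<Sum>s\<in>idx d 0 k. \<Sum>a<r k. \<Sum>a'<r k. ?F t $$ (a, b) * ?F t $$ (a', c) * (lvec r F k s a * lvec r F k s a'))"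
    by (rule sum.swap)
  also have "\<dots> = (\<Sum>t<d (Suc k). \<Sum>a<r k. \<Sum>s\<in>idx d 0 k. \<Sum>a'<r k. ?F t $$ (a, b) * ?F t $$ (a', c) * (lvec r F k s a * lvec r F k s a'))"
    by (intro sum.cong refl sum.swap)
  also have "\<dots> = (\<Sum>t<d (Suc k). \<Sum>a<r k. \<Sum>a'<r k. \<Sum>s\<in>idx d 0 k. ?F t $$ (a, b) * ?F t $$ (a', c) * (lvec r F k s a * lvec r F k s a'))"
    by (intro sum.cong refl sum.swap)
  also have "\<dots> = (\<Sum>t<d (Suc k). \<Sum>a<r k. \<Sum>a'<r k. ?F t $$ (a, b) * ?F t $$ (a', c) * (if a = a' then 1 else 0))"
    unfolding sum_distrib_left[symmetric] using Suc by (intro sum.cong refl) simp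
  also have "\<dots> = (\<Sum>t<d (Suc k). \<Sum>a<r k. ?F t $$ (a, b) * ?F t $$ (a, c))"
    by (intro sum.cong refl) (simp add: if_distrib cong: if_cong)
  also have "\<dots> = (if b = c then 1 else 0)"
    using Suc.prems(1)[of "Suc k"] Suc.prems(2,3) by (simp add: left_orth_at_def)
  finally show ?case .
qed

text \<open>Orthonormal columns preserve the norm. The row index set is arbitrary because rows are
  multi-indices for interface matrices, but pairs \<open>(t, a)\<close> for left unfoldings.\<close>

lemma sum_square_gram:
  fixes n :: nat
  assumes "finite I" "\<And>a b. a < n \<Longrightarrow> b < n \<Longrightarrow> (\<Sum>s\<in>I. v s a * v s b) = (if a = b then 1 else 0)"
  shows "(\<Sum>s\<in>I. (\<Sum>a<n. v s a * u a)\<^sup>2) = (\<Sum>a<n. (u a)\<^sup>2 :: real)"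
proof -
  have "(\<Sum>s\<in>I. (\<Sum>a<n. v s a * u a)\<^sup>2) = (\<Sum>s\<in>I. \<Sum>a<n. \<Sum>b<n. u a * u b * (v s a * v s b))"
    by (simp add: power2_eq_square sum_product mult_ac)
  also have "\<dots> = (\<Sum>a<n. \<Sum>s\<in>I. \<Sum>b<n. u a * u b * (v s a * v s b))" by (rule sum.swap)
  also have "\<dots> = (\<Sum>a<n. \<Sum>b<n. \<Sum>s\<in>I. u a * u b * (v s a * v s b))"
    by (intro sum.cong refl sum.swap)
  also have "\<dots> = (\<Sum>a<n. \<Sum>b<n. u a * u b * (if a = b then 1 else 0))"
    unfolding sum_distrib_left[symmetric] using assms by (intro sum.cong refl) simp
  also have "\<dots> = (\<Sum>a<n. (u a)\<^sup>2)"
  proof (intro sum.cong refl)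
    fix a assume "a \<in> {..<n}"
    moreover have "(\<Sum>b<n. u a * u b * (if a = b then 1 else 0)) = (\<Sum>b<n. if b = a then u a * u a else 0)"
      by (intro sum.cong) auto
    ultimately show "(\<Sum>b<n. u a * u b * (if a = b then 1 else 0)) = (u a)\<^sup>2"
      by (simp add: power2_eq_square)
  qed
  finally show ?thesis .
qed

lemma left_isometry:
  assumes "r 0 = 1" "\<And>i. 1 \<le> i \<Longrightarrow> i \<le> k \<Longrightarrow> left_orth_at d r F i"
  shows "(\<Sum>s\<in>idx d 0 k. (\<Sum>a<r k. lvec r F k s a * u a)\<^sup>2) = (\<Sum>a<r k. (u a)\<^sup>2)"
  by (rule sum_square_gram) (use left_gram[OF assms] in auto)

lemma left_op_bound_left_orthogonal:
  assumes "r 0 = 1" "\<And>i. 1 \<le> i \<Longrightarrow> i \<le> k \<Longrightarrow> left_orth_at d r F i"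
  shows "left_op_bound d r F k 1"
  unfolding left_op_bound_def using left_isometry[OF assms] by simp

text \<open>Interface \<open>k + 1\<close> is interface \<open>k\<close>, acting on each slice
  separately, composed with the isometry given by the left unfolding of factor
  \<open>k + 1\<close>.\<close>

lemma left_op_bound_Suc:
  assumes "left_op_bound d r F k c" "left_orth_at d r F (Suc k)"
  shows "left_op_bound d r F (Suc k) c"
  unfolding left_op_bound_def
proof
  fix u
  let ?w = "\<lambda>t a. \<Sum>b<r (Suc k). F (Suc k) t $$ (a, b) * u b"
  have w: "(\<Sum>b<r (Suc k). (\<Sum>a<r k. lvec r F k s a * F (Suc k) t $$ (a, b)) * u b) = (\<Sum>a<r k. lvec r F k s a * ?w t a)" for s t
    unfolding sum_distrib_right sum_distrib_left by (subst sum.swap) (simp add: mult.assoc)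
  have "(\<Sum>s\<in>idx d 0 (Suc k). (\<Sum>b<r (Suc k). lvec r F (Suc k) s b * u b)\<^sup>2)
    = (\<Sum>s\<in>idx d 0 k. \<Sum>t<d (Suc k). (\<Sum>a<r k. lvec r F k s a * ?w t a)\<^sup>2)"
    by (simp add: sum_idx_Suc lvec_upd w)
  also have "\<dots> = (\<Sum>t<d (Suc k). \<Sum>s\<in>idx d 0 k. (\<Sum>a<r k. lvec r F k s a * ?w t a)\<^sup>2)" by (rule sum.swap)
  also have "\<dots> \<le> (\<Sum>t<d (Suc k). c * (\<Sum>a<r k. (?w t a)\<^sup>2))"
    using assms(1) unfolding left_op_bound_def by (intro sum_mono) simp
  also have "\<dots> = c * (\<Sum>(t, a)\<in>{..<d (Suc k)} \<times> {..<r k}. (\<Sum>b<r (Suc k). F (Suc k) t $$ (a, b) * u b)\<^sup>2)"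
    by (simp add: sum_distrib_left sum.cartesian_product split_def)
  also have "(\<Sum>(t, a)\<in>{..<d (Suc k)} \<times> {..<r k}. (\<Sum>b<r (Suc k). F (Suc k) t $$ (a, b) * u b)\<^sup>2) = (\<Sum>b<r (Suc k). (u b)\<^sup>2)"
    unfolding split_def
    by (rule sum_square_gram)
      (use assms(2) in \<open>auto simp: left_orth_at_def sum.cartesian_product'\<close>)
  finally show "(\<Sum>s\<in>idx d 0 (Suc k). (\<Sum>a<r (Suc k). lvec r F (Suc k) s a * u a)\<^sup>2) \<le> c * (\<Sum>a<r (Suc k). (u a)\<^sup>2)" .
qed

lemma left_op_bound_range:
  assumes "left_op_bound d r F i c" "\<And>k. i < k \<Longrightarrow> k \<le> j \<Longrightarrow> left_orth_at d r F k" "i \<le> j"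
  shows "left_op_bound d r F j c"
  using assms(3,2)
proof (induction j rule: dec_induct)
  case base
  then show ?case using assms(1) by simp
next
  case (step j)
  then show ?case by (intro left_op_bound_Suc) auto
qed

text \<open>Operator norm times Frobenius norm bounds the Frobenius norm of a product. This is how a
  difference factor, which is not orthogonal, is crossed at the cost of its own norm.\<close>

lemma left_frob_sq_Suc_le:
  assumes "left_op_bound d r F k c"
  shows "left_frob_sq d r F (Suc k) \<le> c * factor_norm_sq d r F (Suc k)"
proof -
  have "left_frob_sq d r F (Suc k) = (\<Sum>s\<in>idx d 0 k. \<Sum>t<d (Suc k). \<Sum>b<r (Suc k). (\<Sum>a<r k. lvec r F k s a * F (Suc k) t $$ (a, b))\<^sup>2)"
    by (simp add: left_frob_sq_def sum_idx_Suc lvec_upd)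
  also have "\<dots> = (\<Sum>t<d (Suc k). \<Sum>s\<in>idx d 0 k. \<Sum>b<r (Suc k). (\<Sum>a<r k. lvec r F k s a * F (Suc k) t $$ (a, b))\<^sup>2)"
    by (rule sum.swap)
  also have "\<dots> = (\<Sum>t<d (Suc k). \<Sum>b<r (Suc k). \<Sum>s\<in>idx d 0 k. (\<Sum>a<r k. lvec r F k s a * F (Suc k) t $$ (a, b))\<^sup>2)"
    by (intro sum.cong refl sum.swap)
  also have "\<dots> \<le> (\<Sum>t<d (Suc k). \<Sum>b<r (Suc k). c * (\<Sum>a<r k. (F (Suc k) t $$ (a, b))\<^sup>2))"
    using assms unfolding left_op_bound_def by (intro sum_mono) simp
  also have "\<dots> = c * (\<Sum>t<d (Suc k). \<Sum>b<r (Suc k). \<Sum>a<r k. (F (Suc k) t $$ (a, b))\<^sup>2)"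
    by (simp add: sum_distrib_left)
  also have "(\<Sum>t<d (Suc k). \<Sum>b<r (Suc k). \<Sum>a<r k. (F (Suc k) t $$ (a, b))\<^sup>2) = factor_norm_sq d r F (Suc k)"
    unfolding factor_norm_sq_def diff_Suc_1 by (rule sum.cong[OF refl], rule sum.swap)
  finally show ?thesis .
qed

text \<open>Reads the norm of a single factor off an interface matrix, where two tensor trains can
  be compared.\<close>

lemma left_frob_sq_Suc_isometry:
  assumes "r 0 = 1" "\<And>i. 1 \<le> i \<Longrightarrow> i \<le> k \<Longrightarrow> left_orth_at d r F i"
  shows "left_frob_sq d r F (Suc k) = factor_norm_sq d r F (Suc k)"
proof -
  have "left_frob_sq d r F (Suc k) = (\<Sum>s\<in>idx d 0 k. \<Sum>t<d (Suc k). \<Sum>b<r (Suc k). (\<Sum>a<r k. lvec r F k s a * F (Suc k) t $$ (a, b))\<^sup>2)"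
    by (simp add: left_frob_sq_def sum_idx_Suc lvec_upd)
  also have "\<dots> = (\<Sum>t<d (Suc k). \<Sum>s\<in>idx d 0 k. \<Sum>b<r (Suc k). (\<Sum>a<r k. lvec r F k s a * F (Suc k) t $$ (a, b))\<^sup>2)"
    by (rule sum.swap)
  also have "\<dots> = (\<Sum>t<d (Suc k). \<Sum>b<r (Suc k). \<Sum>s\<in>idx d 0 k. (\<Sum>a<r k. lvec r F k s a * F (Suc k) t $$ (a, b))\<^sup>2)"
    by (intro sum.cong refl sum.swap)
  also have "\<dots> = (\<Sum>t<d (Suc k). \<Sum>b<r (Suc k). \<Sum>a<r k. (F (Suc k) t $$ (a, b))\<^sup>2)"
    by (simp add: left_isometry[OF assms])
  also have "\<dots> = factor_norm_sq d r F (Suc k)"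
    unfolding factor_norm_sq_def diff_Suc_1 by (rule sum.cong[OF refl], rule sum.swap)
  finally show ?thesis .
qed

lemma left_op_bound_of_frob:
  assumes "left_frob_sq d r F k \<le> c"
  shows "left_op_bound d r F k c"
  unfolding left_op_bound_def
proof
  fix u
  have "(\<Sum>s\<in>idx d 0 k. (\<Sum>a<r k. lvec r F k s a * u a)\<^sup>2)
    \<le> (\<Sum>s\<in>idx d 0 k. (\<Sum>a<r k. (lvec r F k s a)\<^sup>2) * (\<Sum>a<r k. (u a)\<^sup>2))"
    by (intro sum_mono Cauchy_Schwarz_sum)
  also have "\<dots> = left_frob_sq d r F k * (\<Sum>a<r k. (u a)\<^sup>2)" by (simp add: left_frob_sq_def sum_distrib_right)
  also have "\<dots> \<le> c * (\<Sum>a<r k. (u a)\<^sup>2)" using assms by (intro mult_right_mono sum_nonneg) auto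
  finally show "(\<Sum>s\<in>idx d 0 k. (\<Sum>a<r k. lvec r F k s a * u a)\<^sup>2) \<le> c * (\<Sum>a<r k. (u a)\<^sup>2)" .
qed

lemma factor_norm_sq_nonneg: "0 \<le> factor_norm_sq d r F i"
  unfolding factor_norm_sq_def by (intro sum_nonneg) auto

lemma right_op_bound_last: "r N = 1 \<Longrightarrow> right_op_bound N d r F N 1"
  by (simp add: right_op_bound_def idx_self rvec_last power_mult_distrib)

lemma tensor_norm_sq: "(tensor_norm N d X)\<^sup>2 = (\<Sum>s\<in>idx d 0 N. (X s)\<^sup>2)"
  unfolding tensor_norm_def tensor_inner_def tensor_idx_eq
  by (subst real_sqrt_pow2) (auto intro!: sum_nonneg simp: power2_eq_square)

lemma tensor_norm_nonneg: "0 \<le> tensor_norm N d X"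
  unfolding tensor_norm_def tensor_inner_def by (intro real_sqrt_ge_zero sum_nonneg) auto

text \<open>The \<open>k\<close>-th unfolding is the left interface matrix times the right one:
  Frobenius norm of the former, operator norm of the latter.\<close>

lemma tensor_norm_tt_le:
  assumes F: "tt_factors N d r F" and "k \<le> N" and right_op_bound: "right_op_bound N d r F k c"
  shows "(tensor_norm N d (tt_tensor N F))\<^sup>2 \<le> c * left_frob_sq d r F k"
proof -
  have "(tensor_norm N d (tt_tensor N F))\<^sup>2 = (\<Sum>s\<in>idx d 0 N. (\<Sum>a<r k. lvec r F k s a * rvec N F k s a)\<^sup>2)"
    unfolding tensor_norm_sq
    by (intro sum.cong refl arg_cong[of _ _ "\<lambda>x. x\<^sup>2"] tt_tensor_split[OF F _ \<open>k \<le> N\<close>]) (auto intro: idx_less)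
  also have "\<dots> = (\<Sum>s\<in>idx d 0 k. \<Sum>t\<in>idx d k N. (\<Sum>a<r k. lvec r F k s a * rvec N F k t a)\<^sup>2)"
    using \<open>k \<le> N\<close> by (subst sum_idx_split[of 0 k N]) (simp_all add: lvec_merge rvec_merge)
  also have "\<dots> \<le> (\<Sum>s\<in>idx d 0 k. c * (\<Sum>a<r k. (lvec r F k s a)\<^sup>2))"
    using right_op_bound unfolding right_op_bound_def by (intro sum_mono) blast
  also have "\<dots> = c * left_frob_sq d r F k" by (simp add: left_frob_sq_def sum_distrib_left)
  finally show ?thesis .
qed

section \<open>Left unfoldings\<close>

lemma left_unf_carrier [simp]: "left_unf d r F i \<in> carrier_mat (d i * r (i - 1)) (r i)"
  by (simp add: left_unf_def vstack_def)

lemma left_unf_index: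
  "p < d i * r (i - 1) \<Longrightarrow> b < r i \<Longrightarrow>
    left_unf d r F i $$ (p, b) = F i (p div r (i - 1)) $$ (p mod r (i - 1), b)"
  by (simp add: left_unf_def vstack_def)

lemma less_mult_div_mod:
  fixes p :: nat
  assumes "p < n * k"
  shows "p div k < n" "p mod k < k"
proof -
  have "k > 0" using assms by (cases k) auto
  then show "p div k < n" "p mod k < k" using assms by (auto simp: less_mult_imp_div_less)
qed

lemma left_orth_at_iff:
  "left_orth_at d r F i \<longleftrightarrow> transpose_mat (left_unf d r F i) * left_unf d r F i = 1\<^sub>m (r i)"
proof -
  let ?L = "left_unf d r F i"
  have *: "(transpose_mat ?L * ?L) $$ (b, c) = (\<Sum>t<d i. \<Sum>a<r (i - 1). F i t $$ (a, b) * F i t $$ (a, c))"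
    if "b < r i" "c < r i" for b c
  proof -
    have "(transpose_mat ?L * ?L) $$ (b, c) = (\<Sum>p<d i * r (i - 1). ?L $$ (p, b) * ?L $$ (p, c))"
      using that by (subst mult_mat_index_sum[of _ "r i" "d i * r (i - 1)" _ "r i"])
        (auto simp: carrier_matD[OF left_unf_carrier])
    also have "\<dots> = (\<Sum>p<d i * r (i - 1). F i (p div r (i - 1)) $$ (p mod r (i - 1), b) * F i (p div r (i - 1)) $$ (p mod r (i - 1), c))"
      using that by (intro sum.cong refl) (simp add: left_unf_index)
    also have "\<dots> = (\<Sum>t<d i. \<Sum>a<r (i - 1). F i t $$ (a, b) * F i t $$ (a, c))"
      by (rule sum_mult_lessThan)
    finally show ?thesis .
  qed
  have "transpose_mat ?L * ?L = 1\<^sub>m (r i) \<longleftrightarrow>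
    (\<forall>b<r i. \<forall>c<r i. (transpose_mat ?L * ?L) $$ (b, c) = 1\<^sub>m (r i) $$ (b, c))"
  proof
    assume "transpose_mat ?L * ?L = 1\<^sub>m (r i)"
    then show "\<forall>b<r i. \<forall>c<r i. (transpose_mat ?L * ?L) $$ (b, c) = 1\<^sub>m (r i) $$ (b, c)" by metis
  qed (auto intro!: eq_matI simp: carrier_matD[OF left_unf_carrier] simp del: index_mult_mat(1))
  then show ?thesis unfolding left_orth_at_def using * by simp
qed

lemma frob_inner_left_unf:
  "frob_inner (left_unf d r F i) (left_unf d r G i)
    = (\<Sum>t<d i. \<Sum>a<r (i - 1). \<Sum>b<r i. F i t $$ (a, b) * G i t $$ (a, b))"
proof -
  have "frob_inner (left_unf d r F i) (left_unf d r G i)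
    = (\<Sum>p<d i * r (i - 1). \<Sum>b<r i. F i (p div r (i - 1)) $$ (p mod r (i - 1), b) * G i (p div r (i - 1)) $$ (p mod r (i - 1), b))"
    unfolding frob_inner_def carrier_matD[OF left_unf_carrier]
    by (intro sum.cong refl) (simp add: left_unf_index)
  also have "\<dots> = (\<Sum>t<d i. \<Sum>a<r (i - 1). \<Sum>b<r i. F i t $$ (a, b) * G i t $$ (a, b))"
    by (rule sum_mult_lessThan[where g = "\<lambda>t a. \<Sum>b<r i. F i t $$ (a, b) * G i t $$ (a, b)"])
  finally show ?thesis .
qed

lemma frob_norm_sq: "(frob_norm A)\<^sup>2 = frob_inner A A"
  unfolding frob_norm_def frob_inner_def by (intro real_sqrt_pow2 sum_nonneg) auto

lemma frob_norm_left_unf: "(frob_norm (left_unf d r F i))\<^sup>2 = factor_norm_sq d r F i"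
  unfolding frob_norm_sq frob_inner_left_unf factor_norm_sq_def by (simp add: power2_eq_square)

lemma col_left_unf_last:
  assumes "r N = 1"
  shows "col (left_unf d r F N) 0 \<bullet> col (left_unf d r F N) 0 = factor_norm_sq d r F N"
proof -
  have "col (left_unf d r F N) 0 \<bullet> col (left_unf d r F N) 0 = frob_inner (left_unf d r F N) (left_unf d r F N)"
    using assms left_unf_carrier[of d r F N]
    by (auto simp: frob_inner_def scalar_prod_def atLeast0LessThan)
  then show ?thesis by (simp add: frob_inner_left_unf factor_norm_sq_def power2_eq_square)
qed

definition factor_diff :: "factors \<Rightarrow> factors \<Rightarrow> factors" where
  "factor_diff F G i t = F i t - G i t"

lemma left_unf_diff:
  assumes "tt_factors N d r F" "tt_factors N d r G" "1 \<le> i" "i \<le> N"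
  shows "left_unf d r F i - left_unf d r G i = left_unf d r (factor_diff F G) i"
proof (rule eq_matI)
  fix p b assume "p < dim_row (left_unf d r (factor_diff F G) i)" "b < dim_col (left_unf d r (factor_diff F G) i)"
  then have *: "p < d i * r (i - 1)" "b < r i" by (auto simp: carrier_matD[OF left_unf_carrier])
  note tt_factors_carrier[OF assms(1,3,4) less_mult_div_mod(1)[OF *(1)]]
    tt_factors_carrier[OF assms(2,3,4) less_mult_div_mod(1)[OF *(1)]]
  then show "(left_unf d r F i - left_unf d r G i) $$ (p, b) = left_unf d r (factor_diff F G) i $$ (p, b)"
    using * less_mult_div_mod[OF *(1)] by (simp add: left_unf_index factor_diff_def carrier_matD[OF left_unf_carrier])
qed (auto simp: carrier_matD[OF left_unf_carrier])

lemma tt_factors_factor_diff: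
  "tt_factors N d r F \<Longrightarrow> tt_factors N d r G \<Longrightarrow> tt_factors N d r (factor_diff F G)"
  by (auto simp: tt_factors_def factor_diff_def intro!: minus_carrier_mat)

lemma left_unf_mult:
  assumes F: "tt_factors N d r F" and i: "1 \<le> i" "i \<le> N" and K: "K \<in> carrier_mat (r i) (r i)"
  shows "left_unf d r F i * K = left_unf d r (F(i := \<lambda>t. F i t * K)) i"
proof (rule eq_matI)
  fix p b assume "p < dim_row (left_unf d r (F(i := \<lambda>t. F i t * K)) i)" "b < dim_col (left_unf d r (F(i := \<lambda>t. F i t * K)) i)"
  then have *: "p < d i * r (i - 1)" "b < r i" by (auto simp: carrier_matD[OF left_unf_carrier])
  note dm = less_mult_div_mod[OF *(1)]
  have "(left_unf d r F i * K) $$ (p, b) = (\<Sum>c<r i. F i (p div r (i - 1)) $$ (p mod r (i - 1), c) * K $$ (c, b))"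
    using * by (subst mult_mat_index_sum[OF left_unf_carrier[of d r F i] K]) (auto simp: left_unf_index intro!: sum.cong)
  also have "\<dots> = (F i (p div r (i - 1)) * K) $$ (p mod r (i - 1), b)"
    using mult_mat_index_sum[OF tt_factors_carrier[OF F i dm(1)] K dm(2) *(2)] by simp
  finally show "(left_unf d r F i * K) $$ (p, b) = left_unf d r (F(i := \<lambda>t. F i t * K)) i $$ (p, b)"
    using * by (simp add: left_unf_index)
qed (use K in \<open>auto simp: carrier_matD[OF left_unf_carrier]\<close>)

lemma frob_inner_commute:
  "A \<in> carrier_mat n m \<Longrightarrow> B \<in> carrier_mat n m \<Longrightarrow> frob_inner A B = frob_inner B A"
  by (simp add: frob_inner_def mult.commute)

lemma frob_inner_mult_right:
  assumes A: "A \<in> carrier_mat n m" and B: "B \<in> carrier_mat n k" and C: "C \<in> carrier_mat k m"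
  shows "frob_inner A (B * C) = frob_inner (transpose_mat B * A) C"
proof -
  have "frob_inner A (B * C) = (\<Sum>i<n. \<Sum>j<m. \<Sum>l<k. A $$ (i, j) * B $$ (i, l) * C $$ (l, j))"
    unfolding frob_inner_def carrier_matD[OF A]
    by (intro sum.cong refl) (subst mult_mat_index_sum[OF B C], auto simp: sum_distrib_left mult.assoc)
  also have "\<dots> = (\<Sum>i<n. \<Sum>l<k. \<Sum>j<m. A $$ (i, j) * B $$ (i, l) * C $$ (l, j))"
    by (intro sum.cong refl sum.swap)
  also have "\<dots> = (\<Sum>l<k. \<Sum>i<n. \<Sum>j<m. A $$ (i, j) * B $$ (i, l) * C $$ (l, j))" by (rule sum.swap)
  also have "\<dots> = (\<Sum>l<k. \<Sum>j<m. \<Sum>i<n. A $$ (i, j) * B $$ (i, l) * C $$ (l, j))"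
    by (intro sum.cong refl sum.swap)
  also have "\<dots> = (\<Sum>l<k. \<Sum>j<m. (\<Sum>i<n. transpose_mat B $$ (l, i) * A $$ (i, j)) * C $$ (l, j))"
    using B by (intro sum.cong refl) (simp add: sum_distrib_left sum_distrib_right mult_ac)
  also have "\<dots> = frob_inner (transpose_mat B * A) C"
    unfolding frob_inner_def using A B
    by (intro sum.cong) (auto simp: scalar_prod_def atLeast0LessThan mult.commute)
  finally show ?thesis .
qed

lemma frob_inner_transpose:
  assumes "A \<in> carrier_mat n m" "B \<in> carrier_mat n m"
  shows "frob_inner (transpose_mat A) (transpose_mat B) = frob_inner A B"
  using assms unfolding frob_inner_def by (subst sum.swap) (auto intro!: sum.cong)

lemma frob_inner_add_right:
  assumes "A \<in> carrier_mat n m" "B \<in> carrier_mat n m" "C \<in> carrier_mat n m"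
  shows "frob_inner A (B + C) = frob_inner A B + frob_inner A C"
  using assms by (simp add: frob_inner_def distrib_left sum.distrib)

lemma frob_inner_diff_right:
  assumes "A \<in> carrier_mat n m" "B \<in> carrier_mat n m" "C \<in> carrier_mat n m"
  shows "frob_inner A (B - C) = frob_inner A B - frob_inner A C"
  using assms by (simp add: frob_inner_def right_diff_distrib sum_subtractf)

lemma frob_inner_smult_right:
  assumes "A \<in> carrier_mat n m" "B \<in> carrier_mat n m"
  shows "frob_inner A (c \<cdot>\<^sub>m B) = c * frob_inner A B"
  using assms by (simp add: frob_inner_def sum_distrib_left mult.left_commute)

text \<open>The normal component \<open>(1/2) L (D\<^sup>T L + L\<^sup>T D)\<close> of \<open>D\<close> is quadratic in \<open>D\<close>, since both \<open>L\<close>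
  and \<open>L - D\<close> lie on the Stiefel manifold.\<close>
lemma frob_inner_tangent_proj:
  fixes L D U :: "real mat"
  assumes L: "L \<in> carrier_mat n m" and D: "D \<in> carrier_mat n m" and U: "U \<in> carrier_mat n m"
    and LL: "transpose_mat L * L = 1\<^sub>m m" and YY: "transpose_mat (L - D) * (L - D) = 1\<^sub>m m"
  shows "frob_inner D (U - (1/2) \<cdot>\<^sub>m (L * (transpose_mat U * L + transpose_mat L * U)))
    = frob_inner D U - 1/2 * frob_inner (L * (transpose_mat D * D)) U"
proof -
  have LD: "L - D \<in> carrier_mat n m" using D by (rule minus_carrier_mat)
  have "transpose_mat D * L + transpose_mat L * D = transpose_mat D * D"
  proof (rule eq_matI)
    fix i j assume "i < dim_row (transpose_mat D * D)" "j < dim_col (transpose_mat D * D)"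
    then have ij: "i < m" "j < m" using D by auto
    have 1: "(\<Sum>k<n. L $$ (k, i) * L $$ (k, j)) = 1\<^sub>m m $$ (i, j)"
      unfolding LL[symmetric] using ij L by (subst mult_mat_index_sum[of _ m n _ m]) auto
    have 2: "(\<Sum>k<n. (L $$ (k, i) - D $$ (k, i)) * (L $$ (k, j) - D $$ (k, j))) = 1\<^sub>m m $$ (i, j)"
      unfolding YY[symmetric] using ij L D LD by (subst mult_mat_index_sum[of _ m n _ m]) (auto simp del: transpose_minus)
    have "(\<Sum>k<n. D $$ (k, i) * L $$ (k, j)) + (\<Sum>k<n. L $$ (k, i) * D $$ (k, j)) = (\<Sum>k<n. D $$ (k, i) * D $$ (k, j))"
      using 1 2 by (simp add: algebra_simps sum.distrib sum_subtractf)
    then show "(transpose_mat D * L + transpose_mat L * D) $$ (i, j) = (transpose_mat D * D) $$ (i, j)"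
      using ij L D by (simp add: scalar_prod_def atLeast0LessThan)
  qed (use L D in auto)
  then have quad: "L * (transpose_mat D * L) + L * (transpose_mat L * D) = L * (transpose_mat D * D)"
    using L D by (simp add: mult_add_distrib_mat[of _ n m _ m, symmetric])
  \<comment> \<open>The normal projection is self-adjoint; each of its two terms is moved from
    \<open>U\<close> onto \<open>D\<close>, where \<open>quad\<close> applies.\<close>
  have "frob_inner D (L * (transpose_mat U * L)) = frob_inner (transpose_mat L * D) (transpose_mat U * L)"
    using L D U by (subst frob_inner_mult_right[of _ n m _ m]) auto
  also have "\<dots> = frob_inner (transpose_mat D * L) (transpose_mat L * U)"
    using L D U frob_inner_transpose[of "transpose_mat L * D" m m "transpose_mat U * L"]
    by (simp add: transpose_mult[of _ m n _ m])
  also have "\<dots> = frob_inner (L * (transpose_mat D * L)) U"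
    using L D U frob_inner_mult_right[of "transpose_mat D * L" m m "transpose_mat L" n U] by simp
  finally have e1: "frob_inner D (L * (transpose_mat U * L)) = frob_inner (L * (transpose_mat D * L)) U" .
  have "frob_inner D (L * (transpose_mat L * U)) = frob_inner (transpose_mat L * D) (transpose_mat L * U)"
    using L D U by (subst frob_inner_mult_right[of _ n m _ m]) auto
  also have "\<dots> = frob_inner (L * (transpose_mat L * D)) U"
    using L D U frob_inner_mult_right[of "transpose_mat L * D" m m "transpose_mat L" n U] by simp
  finally have e2: "frob_inner D (L * (transpose_mat L * U)) = frob_inner (L * (transpose_mat L * D)) U" .
  have "frob_inner D (L * (transpose_mat U * L + transpose_mat L * U))
    = frob_inner D (L * (transpose_mat U * L)) + frob_inner D (L * (transpose_mat L * U))"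
    using L D U by (simp add: mult_add_distrib_mat[of _ n m _ m] frob_inner_add_right[of _ n m])
  also have "\<dots> = frob_inner U (L * (transpose_mat D * L)) + frob_inner U (L * (transpose_mat L * D))"
    unfolding e1 e2 using L D U by (simp add: frob_inner_commute[of U n m])
  also have "\<dots> = frob_inner U (L * (transpose_mat D * D))"
    unfolding quad[symmetric] using L D U by (simp add: frob_inner_add_right[of _ n m])
  also have "\<dots> = frob_inner (L * (transpose_mat D * D)) U"
    using L D U by (simp add: frob_inner_commute[of U n m])
  finally show ?thesis
    using L D U by (simp add: frob_inner_diff_right[of _ n m] frob_inner_smult_right[of _ n m])
qed

section \<open>The subgradient\<close>

text \<open>Since \<open>r 0 = 1\<close>, the reversed transposed factors left of a slot multiply to
  a column. With a row \<open>T\<close> as the remaining part, the product is an outer product, and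
  the order of factors in the subgradient becomes harmless.\<close>

lemma mat_prod_transpose_left:
  assumes F: "tt_factors N d r F" and k: "k \<le> N" and s: "\<And>j. 0 < j \<Longrightarrow> j \<le> k \<Longrightarrow> s j < d j"
    and T: "T \<in> carrier_mat 1 q"
  shows "foldr (*) (map (\<lambda>j. transpose_mat (F j (s j))) (rev [1..<Suc k])) T \<in> carrier_mat (r k) q
    \<and> (\<forall>a<r k. \<forall>b<q. foldr (*) (map (\<lambda>j. transpose_mat (F j (s j))) (rev [1..<Suc k])) T $$ (a, b) = lvec r F k s a * T $$ (0, b))"
  using k s
proof (induction k)
  case 0
  then show ?case using F T by (auto simp: tt_factors_def)
next
  case (Suc k)
  let ?M = "foldr (*) (map (\<lambda>j. transpose_mat (F j (s j))) (rev [1..<Suc k])) T"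
  have IH: "?M \<in> carrier_mat (r k) q" "\<And>a b. a < r k \<Longrightarrow> b < q \<Longrightarrow> ?M $$ (a, b) = lvec r F k s a * T $$ (0, b)"
    using Suc by auto
  have Fk: "F (Suc k) (s (Suc k)) \<in> carrier_mat (r k) (r (Suc k))"
    using tt_factors_carrier[OF F, of "Suc k" "s (Suc k)"] Suc.prems by simp
  have step: "foldr (*) (map (\<lambda>j. transpose_mat (F j (s j))) (rev [1..<Suc (Suc k)])) T = transpose_mat (F (Suc k) (s (Suc k))) * ?M"
    by simp
  show ?case unfolding step
  proof (intro conjI allI impI)
    show "transpose_mat (F (Suc k) (s (Suc k))) * ?M \<in> carrier_mat (r (Suc k)) q"
      using Fk IH(1) by simp
    fix a b assume ab: "a < r (Suc k)" "b < q"
    have "(transpose_mat (F (Suc k) (s (Suc k))) * ?M) $$ (a, b) = (\<Sum>c<r k. F (Suc k) (s (Suc k)) $$ (c, a) * ?M $$ (c, b))"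
      using Fk IH(1) ab by (subst mult_mat_index_sum[of _ "r (Suc k)" "r k" _ q]) auto
    also have "\<dots> = lvec r F (Suc k) s a * T $$ (0, b)"
      using IH(2) ab by (simp add: sum_distrib_left sum_distrib_right mult_ac del: upt_Suc)
    finally show "(transpose_mat (F (Suc k) (s (Suc k))) * ?M) $$ (a, b) = lvec r F (Suc k) s a * T $$ (0, b)" .
  qed
qed

lemma mat_prod_transpose_right:
  assumes F: "tt_factors N d r F" and k: "i \<le> N" and s: "\<And>j. i < j \<Longrightarrow> j \<le> N \<Longrightarrow> s j < d j"
  shows "foldr (*) (map (\<lambda>j. transpose_mat (F j (s j))) (rev [Suc i..<Suc N])) (1\<^sub>m (r i))
    = transpose_mat (mat_prod 1 (map (\<lambda>j. F j (s j)) [Suc i..<Suc N]))"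
proof -
  \<comment> \<open>The fold over the reversed list applies factor \<open>k + 1\<close> first, so
    the induction carries along the product \<open>T\<close> accumulated so far.\<close>
  have gen: "foldr (*) (map (\<lambda>j. transpose_mat (F j (s j))) (rev [Suc k..<Suc N])) (transpose_mat T)
      = transpose_mat (T * mat_prod 1 (map (\<lambda>j. F j (s j)) [Suc k..<Suc N]))"
    if "i \<le> k" "k \<le> N" "T \<in> carrier_mat q (r k)" for k q T
    using that(2,1,3)
  proof (induction k arbitrary: T rule: inc_induct)
    case base
    then show ?case using F by (simp add: mat_prod_def tt_factors_def)
  next
    case (step k)
    let ?Fk = "F (Suc k) (s (Suc k))" and ?P = "mat_prod 1 (map (\<lambda>j. F j (s j)) [Suc (Suc k)..<Suc N])"
    have Fk: "?Fk \<in> carrier_mat (r k) (r (Suc k))"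
      using tt_factors_carrier[OF F, of "Suc k" "s (Suc k)"] step s by simp
    have P: "?P \<in> carrier_mat (r (Suc k)) 1"
      by (rule mat_prod_carrier[OF F]) (use step s in auto)
    have up: "[Suc k..<Suc N] = Suc k # [Suc (Suc k)..<Suc N]"
      using step by (simp add: upt_conv_Cons del: upt_Suc)
    have "foldr (*) (map (\<lambda>j. transpose_mat (F j (s j))) (rev [Suc k..<Suc N])) (transpose_mat T)
      = foldr (*) (map (\<lambda>j. transpose_mat (F j (s j))) (rev [Suc (Suc k)..<Suc N])) (transpose_mat (T * ?Fk))"
      unfolding up using step.prems Fk by (simp add: transpose_mult[of _ q "r k" _ "r (Suc k)"] del: upt_Suc)
    also have "\<dots> = transpose_mat ((T * ?Fk) * ?P)"
      by (rule step.IH) (use step Fk in auto)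
    also have "(T * ?Fk) * ?P = T * (?Fk * ?P)"
      using step.prems Fk P by (simp add: assoc_mult_mat[of _ q "r k" _ "r (Suc k)" _ 1])
    also have "?Fk * ?P = mat_prod 1 (map (\<lambda>j. F j (s j)) [Suc k..<Suc N])"
      unfolding up by (simp add: mat_prod_def del: upt_Suc)
    finally show ?case .
  qed
  from gen[of i "1\<^sub>m (r i)" "r i"] k mat_prod_carrier[OF F k s] show ?thesis by simp
qed

lemma subgrad_slice_index:
  assumes F: "tt_factors N d r F" and i: "1 \<le> i" "i \<le> N" and ab: "a < r (i - 1)" "b < r i"
  shows "subgrad_slice N d r m A y F i t $$ (a, b) =
    1 / real m * (\<Sum>k<m. sgn (tensor_inner N d (A k) (tt_tensor N F) - y k) *
       (\<Sum>s\<in>{s \<in> tensor_idx N d. s i = t}. A k s * (lvec r F (i - 1) s a * rvec N F i s b)))"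
proof -
  have "mat_prod (r i) (map (\<lambda>j. transpose_mat (F j (s j))) (rev [1..<i] @ rev [Suc i..<Suc N])) $$ (a, b)
      = lvec r F (i - 1) s a * rvec N F i s b" if "s \<in> tensor_idx N d" for s
  proof -
    have s: "s j < d j" if "0 < j" "j \<le> N" for j
      using \<open>s \<in> tensor_idx N d\<close> that idx_less by (auto simp: tensor_idx_eq)
    let ?P = "mat_prod 1 (map (\<lambda>j. F j (s j)) [Suc i..<Suc N])"
    have P: "?P \<in> carrier_mat (r i) 1" by (rule mat_prod_carrier[OF F]) (use i s in auto)
    have "mat_prod (r i) (map (\<lambda>j. transpose_mat (F j (s j))) (rev [1..<i] @ rev [Suc i..<Suc N]))
      = foldr (*) (map (\<lambda>j. transpose_mat (F j (s j))) (rev [1..<Suc (i - 1)])) (transpose_mat ?P)"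
      using mat_prod_transpose_right[OF F i(2), of s] i s
      by (simp add: mat_prod_def del: upt_Suc)
    then show ?thesis
      using mat_prod_transpose_left[OF F, of "i - 1" s "transpose_mat ?P" "r i"] P i ab s
      by (simp add: rvec_def del: upt_Suc)
  qed
  then show ?thesis
    unfolding subgrad_slice_def using ab by simp
qed

text \<open>By linearity in slot \<open>i\<close>, pairing with the subgradient amounts to inserting
  \<open>Z i\<close> into that slot; the signs stay those of the residual at
  \<open>F\<close>.\<close>

lemma frob_inner_subgrad:
  assumes F: "tt_factors N d r F" and Z: "tt_factors N d r (F(i := Z i))" and i: "1 \<le> i" "i \<le> N"
  shows "frob_inner (left_unf d r Z i) (subgrad N d r m A y F i)
    = 1 / real m * (\<Sum>k<m. sgn (tensor_inner N d (A k) (tt_tensor N F) - y k) *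
        tensor_inner N d (A k) (tt_tensor N (F(i := Z i))))"
proof -
  let ?w = "\<lambda>k. sgn (tensor_inner N d (A k) (tt_tensor N F) - y k)"
  let ?h = "\<lambda>k s a b. A k s * (lvec r F (i - 1) s a * Z i (s i) $$ (a, b) * rvec N F i s b)"
  \<comment> \<open>The position in mode \<open>i\<close> partitions the index set, which undoes the
    stacking of slices.\<close>
  have slice: "(\<Sum>t<d i. \<Sum>s\<in>{s \<in> tensor_idx N d. s i = t}. g s) = (\<Sum>s\<in>tensor_idx N d. g s)" for g :: "_ \<Rightarrow> real"
    by (rule sum.group) (use i in \<open>auto simp: tensor_idx_eq intro: idx_less\<close>)
  have inner: "tensor_inner N d (A k) (tt_tensor N (F(i := Z i)))
      = (\<Sum>s\<in>tensor_idx N d. \<Sum>a<r (i - 1). \<Sum>b<r i. ?h k s a b)" for k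
    unfolding tensor_inner_def
  proof (intro sum.cong refl)
    fix s assume s: "s \<in> tensor_idx N d"
    have "tt_tensor N (F(i := Z i)) s = (\<Sum>a<r (i - 1). \<Sum>b<r i.
        lvec r (F(i := Z i)) (i - 1) s a * Z i (s i) $$ (a, b) * rvec N (F(i := Z i)) i s b)"
      by (subst tt_tensor_mid[OF Z _ i]) (use s idx_less in \<open>auto simp: tensor_idx_eq\<close>)
    moreover have "lvec r (F(i := Z i)) (i - 1) s = lvec r F (i - 1) s"
      by (rule lvec_cong) (use i in auto)
    moreover have "rvec N (F(i := Z i)) i s = rvec N F i s"
      by (rule rvec_cong) auto
    ultimately show "A k s * tt_tensor N (F(i := Z i)) s = (\<Sum>a<r (i - 1). \<Sum>b<r i. ?h k s a b)"
      by (simp add: sum_distrib_left)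
  qed
  have "frob_inner (left_unf d r Z i) (subgrad N d r m A y F i)
    = frob_inner (left_unf d r Z i) (left_unf d r (\<lambda>i. subgrad_slice N d r m A y F i) i)"
    by (simp add: subgrad_def left_unf_def)
  also have "\<dots> = (\<Sum>t<d i. \<Sum>a<r (i - 1). \<Sum>b<r i. Z i t $$ (a, b) * subgrad_slice N d r m A y F i t $$ (a, b))"
    by (rule frob_inner_left_unf)
  also have "\<dots> = (\<Sum>t<d i. \<Sum>a<r (i - 1). \<Sum>b<r i. \<Sum>k<m. \<Sum>s\<in>{s \<in> tensor_idx N d. s i = t}. 1 / real m * (?w k * ?h k s a b))"
  proof (intro sum.cong refl)
    fix t a b assume "a \<in> {..<r (i - 1)}" "b \<in> {..<r i}"
    then show "Z i t $$ (a, b) * subgrad_slice N d r m A y F i t $$ (a, b) =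
      (\<Sum>k<m. \<Sum>s\<in>{s \<in> tensor_idx N d. s i = t}. 1 / real m * (?w k * ?h k s a b))"
      by (auto simp: subgrad_slice_index[OF F i] sum_distrib_left intro!: sum.cong)
  qed
  also have "\<dots> = (\<Sum>t<d i. \<Sum>a<r (i - 1). \<Sum>k<m. \<Sum>b<r i. \<Sum>s\<in>{s \<in> tensor_idx N d. s i = t}. 1 / real m * (?w k * ?h k s a b))"
    by (rule sum.cong[OF refl], rule sum.cong[OF refl], rule sum.swap)
  also have "\<dots> = (\<Sum>t<d i. \<Sum>k<m. \<Sum>a<r (i - 1). \<Sum>b<r i. \<Sum>s\<in>{s \<in> tensor_idx N d. s i = t}. 1 / real m * (?w k * ?h k s a b))"
    by (rule sum.cong[OF refl], rule sum.swap)
  also have "\<dots> = (\<Sum>k<m. \<Sum>t<d i. \<Sum>a<r (i - 1). \<Sum>b<r i. \<Sum>s\<in>{s \<in> tensor_idx N d. s i = t}. 1 / real m * (?w k * ?h k s a b))"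
    by (rule sum.swap)
  also have "\<dots> = (\<Sum>k<m. \<Sum>t<d i. \<Sum>a<r (i - 1). \<Sum>s\<in>{s \<in> tensor_idx N d. s i = t}. \<Sum>b<r i. 1 / real m * (?w k * ?h k s a b))"
    by (rule sum.cong[OF refl], rule sum.cong[OF refl], rule sum.cong[OF refl], rule sum.swap)
  also have "\<dots> = (\<Sum>k<m. \<Sum>t<d i. \<Sum>s\<in>{s \<in> tensor_idx N d. s i = t}. \<Sum>a<r (i - 1). \<Sum>b<r i. 1 / real m * (?w k * ?h k s a b))"
    by (rule sum.cong[OF refl], rule sum.cong[OF refl], rule sum.swap)
  also have "\<dots> = (\<Sum>k<m. \<Sum>s\<in>tensor_idx N d. \<Sum>a<r (i - 1). \<Sum>b<r i. 1 / real m * (?w k * ?h k s a b))"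
    by (simp only: slice)
  also have "\<dots> = 1 / real m * (\<Sum>k<m. ?w k * tensor_inner N d (A k) (tt_tensor N (F(i := Z i))))"
    unfolding inner by (simp only: sum_distrib_left)
  finally show ?thesis .
qed

section \<open>Rotated factors\<close>

definition rotate_factors :: "(nat \<Rightarrow> real mat) \<Rightarrow> factors \<Rightarrow> factors" where
  "rotate_factors R F i t = transpose_mat (R (i - 1)) * F i t * R i"

lemma left_unf_rot_eq: "left_unf_rot d r R F i = left_unf d r (rotate_factors R F) i"
  by (simp add: left_unf_rot_def left_unf_def rotate_factors_def[abs_def])

lemma rotations_carrier:
  assumes "rotations N r R" "r 0 = 1" "r N = 1" "i \<le> N"
  shows "R i \<in> carrier_mat (r i) (r i)" "transpose_mat (R i) * R i = 1\<^sub>m (r i)" "R i * transpose_mat (R i) = 1\<^sub>m (r i)"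
proof -
  consider "i = 0" | "i = N" | "i \<in> {1..N-1}" using assms(4) by fastforce
  then have "R i \<in> carrier_mat (r i) (r i) \<and> transpose_mat (R i) * R i = 1\<^sub>m (r i)"
  proof cases
    case 1
    then show ?thesis using assms(1,2) by (simp add: rotations_def)
  next
    case 2
    then show ?thesis using assms(1,3) by (simp add: rotations_def)
  next
    case 3
    then show ?thesis using assms(1) by (simp add: rotations_def)
  qed
  then show 1: "R i \<in> carrier_mat (r i) (r i)" and 2: "transpose_mat (R i) * R i = 1\<^sub>m (r i)"
    by auto
  show "R i * transpose_mat (R i) = 1\<^sub>m (r i)"
    using mat_mult_left_right_inverse[OF _ 1 2] 1 by simp
qed

lemma tt_factors_rotate_factors:
  assumes F: "tt_factors N d r F" and R: "rotations N r R"
  shows "tt_factors N d r (rotate_factors R F)"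
proof -
  have r: "r 0 = 1" "r N = 1" using F by (auto simp: tt_factors_def)
  have "rotate_factors R F i t \<in> carrier_mat (r (i - 1)) (r i)" if "1 \<le> i" "i \<le> N" "t < d i" for i t
  proof -
    have "R i \<in> carrier_mat (r i) (r i)" "R (i - 1) \<in> carrier_mat (r (i - 1)) (r (i - 1))"
      using rotations_carrier(1)[OF R r] that by auto
    then show ?thesis
      unfolding rotate_factors_def using tt_factors_carrier[OF F that]
      by (intro mult_carrier_mat[of _ _ "r i"] mult_carrier_mat[of _ _ "r (i - 1)"]) auto
  qed
  then show ?thesis using r by (auto simp: tt_factors_def)
qed

text \<open>\<open>R j\<close> and its transpose meet between neighbouring factors and cancel; only
  the rotation at the right end of the partial product is left.\<close>

lemma lvec_rotate_factors:
  assumes F: "tt_factors N d r F" and R: "rotations N r R" and "k \<le> N"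
    and s: "\<And>j. 0 < j \<Longrightarrow> j \<le> k \<Longrightarrow> s j < d j" and "b < r k"
  shows "lvec r (rotate_factors R F) k s b = (\<Sum>a<r k. lvec r F k s a * R k $$ (a, b))"
  using assms(3-)
proof (induction k arbitrary: b)
  case 0
  then show ?case using R F by (simp add: rotations_def tt_factors_def)
next
  case (Suc k)
  have r: "r 0 = 1" "r N = 1" using F by (auto simp: tt_factors_def)
  let ?F = "F (Suc k) (s (Suc k))"
  have Fk: "?F \<in> carrier_mat (r k) (r (Suc k))"
    using tt_factors_carrier[OF F, of "Suc k" "s (Suc k)"] Suc.prems by simp
  have Rk: "R k \<in> carrier_mat (r k) (r k)" "R k * transpose_mat (R k) = 1\<^sub>m (r k)"
    and Rk': "R (Suc k) \<in> carrier_mat (r (Suc k)) (r (Suc k))"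
    using rotations_carrier[OF R r, of k] rotations_carrier[OF R r, of "Suc k"] Suc.prems(1) by auto
  let ?Y = "rotate_factors R F (Suc k) (s (Suc k))"
  have Y: "?Y \<in> carrier_mat (r k) (r (Suc k))" using Fk Rk Rk' by (simp add: rotate_factors_def)
  have "R k * ?Y = (R k * transpose_mat (R k)) * (?F * R (Suc k))"
    using Fk Rk(1) Rk' unfolding rotate_factors_def
    by (simp add: assoc_mult_mat[of _ "r k" "r k" _ "r k" _ "r (Suc k)"]
        assoc_mult_mat[of _ "r k" "r k" _ "r (Suc k)" _ "r (Suc k)"])
  also have "\<dots> = ?F * R (Suc k)" unfolding Rk(2) using Fk Rk' by simp
  finally have RY: "R k * ?Y = ?F * R (Suc k)" .
  have "lvec r (rotate_factors R F) (Suc k) s b = (\<Sum>a<r k. (\<Sum>c<r k. lvec r F k s c * R k $$ (c, a)) * ?Y $$ (a, b))"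
    using Suc by simp
  also have "\<dots> = (\<Sum>c<r k. \<Sum>a<r k. lvec r F k s c * (R k $$ (c, a) * ?Y $$ (a, b)))"
    unfolding sum_distrib_right by (subst sum.swap) (simp add: mult.assoc)
  also have "\<dots> = (\<Sum>c<r k. lvec r F k s c * (R k * ?Y) $$ (c, b))"
    using Suc.prems by (intro sum.cong refl) (subst mult_mat_index_sum[OF Rk(1) Y], auto simp: sum_distrib_left)
  also have "\<dots> = (\<Sum>c<r k. \<Sum>e<r (Suc k). lvec r F k s c * (?F $$ (c, e) * R (Suc k) $$ (e, b)))"
    unfolding RY using Suc.prems by (intro sum.cong refl) (subst mult_mat_index_sum[OF Fk Rk'], auto simp: sum_distrib_left)
  also have "\<dots> = (\<Sum>e<r (Suc k). \<Sum>c<r k. lvec r F k s c * (?F $$ (c, e) * R (Suc k) $$ (e, b)))"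
    by (rule sum.swap)
  also have "\<dots> = (\<Sum>e<r (Suc k). lvec r F (Suc k) s e * R (Suc k) $$ (e, b))"
    by (simp add: sum_distrib_right mult.assoc)
  finally show ?case .
qed

lemma tt_tensor_lvec:
  assumes F: "tt_factors N d r F" and s: "s \<in> tensor_idx N d"
  shows "tt_tensor N F s = lvec r F N s 0"
proof -
  have "r N = 1" using F by (simp add: tt_factors_def)
  moreover have "tt_tensor N F s = (\<Sum>a<r N. lvec r F N s a * rvec N F N s a)"
    by (rule tt_tensor_split[OF F]) (use s idx_less in \<open>auto simp: tensor_idx_eq\<close>)
  ultimately show ?thesis by (simp add: rvec_last)
qed

lemma tt_decomp_rotate_factors:
  assumes F: "tt_decomp N d r F X" and R: "rotations N r R"
  shows "tt_decomp N d r (rotate_factors R F) X"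
proof -
  have F': "tt_factors N d r F" and r: "r N = 1" and RN: "R N = 1\<^sub>m 1"
    using F R by (auto simp: tt_decomp_def tt_factors_def rotations_def)
  have "tt_tensor N (rotate_factors R F) s = tt_tensor N F s" if s: "s \<in> tensor_idx N d" for s
  proof -
    have "lvec r (rotate_factors R F) N s 0 = (\<Sum>a<r N. lvec r F N s a * R N $$ (a, 0))"
      by (rule lvec_rotate_factors[OF F' R]) (use s r idx_less in \<open>auto simp: tensor_idx_eq\<close>)
    then show ?thesis
      using tt_tensor_lvec[OF F' s] tt_tensor_lvec[OF tt_factors_rotate_factors[OF F' R] s] r RN by simp
  qed
  then show ?thesis using F tt_factors_rotate_factors[OF F' R] by (simp add: tt_decomp_def)
qed

text \<open>The rotated left unfolding is the original one multiplied by a block-diagonal orthogonal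
  matrix on the left and by \<open>R i\<close> on the right.\<close>

lemma left_orth_at_rotate_factors:
  assumes F: "tt_factors N d r F" and R: "rotations N r R" and i: "1 \<le> i" "i \<le> N" and lo: "left_orth_at d r F i"
  shows "left_orth_at d r (rotate_factors R F) i"
  unfolding left_orth_at_def
proof (intro allI impI)
  fix b c assume bc: "b < r i" "c < r i"
  have r: "r 0 = 1" "r N = 1" using F by (auto simp: tt_factors_def)
  let ?Q = "R (i - 1)" and ?R = "R i" and ?p = "r (i - 1)"
  have Q: "?Q \<in> carrier_mat ?p ?p" "?Q * transpose_mat ?Q = 1\<^sub>m ?p"
    and Ri: "?R \<in> carrier_mat (r i) (r i)" "transpose_mat ?R * ?R = 1\<^sub>m (r i)"
    using rotations_carrier[OF R r, of "i - 1"] rotations_carrier[OF R r, of i] i by auto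
  have "(\<Sum>a<?p. rotate_factors R F i t $$ (a, b) * rotate_factors R F i t $$ (a, c))
      = (\<Sum>e<r i. \<Sum>f<r i. ?R $$ (e, b) * ?R $$ (f, c) * (\<Sum>a<?p. F i t $$ (a, e) * F i t $$ (a, f)))"
    if t: "t < d i" for t
  proof -
    note Ft = tt_factors_carrier[OF F i t]
    let ?Y = "rotate_factors R F i t" and ?G = "F i t"
    have Y: "?Y \<in> carrier_mat ?p (r i)" using Ft Q Ri by (simp add: rotate_factors_def)
    have Y_eq: "?Y = transpose_mat ?Q * (?G * ?R)"
      unfolding rotate_factors_def using Ft Q Ri by (simp add: assoc_mult_mat[of _ ?p ?p _ "r i" _ "r i"])
    have GR: "?G * ?R \<in> carrier_mat ?p (r i)" using Ft Ri by simp
    have "transpose_mat ?Y * ?Y = transpose_mat (?G * ?R) * ((?Q * transpose_mat ?Q) * (?G * ?R))"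
      unfolding Y_eq using GR Q(1)
      by (simp add: transpose_mult[of _ ?p ?p _ "r i"] assoc_mult_mat[of _ "r i" ?p _ ?p _ "r i"] assoc_mult_mat[of _ ?p ?p _ ?p _ "r i"])
    also have "\<dots> = transpose_mat (?G * ?R) * (?G * ?R)" unfolding Q(2) left_mult_one_mat[OF GR] ..
    finally have YY: "transpose_mat ?Y * ?Y = transpose_mat (?G * ?R) * (?G * ?R)" .
    have gram: "(transpose_mat Z * Z) $$ (b, c) = (\<Sum>a<?p. Z $$ (a, b) * Z $$ (a, c))"
      if "Z \<in> carrier_mat ?p (r i)" for Z :: "real mat"
      using that bc by (subst mult_mat_index_sum[of _ "r i" ?p _ "r i"]) auto
    have "(\<Sum>a<?p. ?Y $$ (a, b) * ?Y $$ (a, c)) = (transpose_mat ?Y * ?Y) $$ (b, c)"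
      using gram[OF Y] by simp
    also have "\<dots> = (\<Sum>a<?p. (?G * ?R) $$ (a, b) * (?G * ?R) $$ (a, c))"
      unfolding YY by (rule gram[OF GR])
    also have "\<dots> = (\<Sum>a<?p. (\<Sum>e<r i. ?G $$ (a, e) * ?R $$ (e, b)) * (\<Sum>f<r i. ?G $$ (a, f) * ?R $$ (f, c)))"
      using bc by (intro sum.cong refl) (simp add: mult_mat_index_sum[OF Ft Ri(1)] del: index_mult_mat)
    also have "\<dots> = (\<Sum>a<?p. \<Sum>e<r i. \<Sum>f<r i. ?R $$ (e, b) * ?R $$ (f, c) * (?G $$ (a, e) * ?G $$ (a, f)))"
      by (simp add: sum_product mult_ac)
    also have "\<dots> = (\<Sum>e<r i. \<Sum>a<?p. \<Sum>f<r i. ?R $$ (e, b) * ?R $$ (f, c) * (?G $$ (a, e) * ?G $$ (a, f)))"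
      by (rule sum.swap)
    also have "\<dots> = (\<Sum>e<r i. \<Sum>f<r i. \<Sum>a<?p. ?R $$ (e, b) * ?R $$ (f, c) * (?G $$ (a, e) * ?G $$ (a, f)))"
      by (rule sum.cong[OF refl], rule sum.swap)
    finally show ?thesis by (simp add: sum_distrib_left)
  qed
  then have "(\<Sum>t<d i. \<Sum>a<?p. rotate_factors R F i t $$ (a, b) * rotate_factors R F i t $$ (a, c))
      = (\<Sum>t<d i. \<Sum>e<r i. \<Sum>f<r i. ?R $$ (e, b) * ?R $$ (f, c) * (\<Sum>a<?p. F i t $$ (a, e) * F i t $$ (a, f)))"
    by simp
  also have "\<dots> = (\<Sum>e<r i. \<Sum>t<d i. \<Sum>f<r i. ?R $$ (e, b) * ?R $$ (f, c) * (\<Sum>a<?p. F i t $$ (a, e) * F i t $$ (a, f)))"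
    by (rule sum.swap)
  also have "\<dots> = (\<Sum>e<r i. \<Sum>f<r i. \<Sum>t<d i. ?R $$ (e, b) * ?R $$ (f, c) * (\<Sum>a<?p. F i t $$ (a, e) * F i t $$ (a, f)))"
    by (rule sum.cong[OF refl], rule sum.swap)
  also have "\<dots> = (\<Sum>e<r i. \<Sum>f<r i. if e = f then ?R $$ (e, b) * ?R $$ (e, c) else 0)"
    unfolding sum_distrib_left[symmetric] using lo by (intro sum.cong refl) (simp add: left_orth_at_def)
  also have "\<dots> = (transpose_mat ?R * ?R) $$ (b, c)"
    using Ri(1) bc by (subst mult_mat_index_sum[of _ "r i" "r i" _ "r i"]) auto
  finally show "(\<Sum>t<d i. \<Sum>a<?p. rotate_factors R F i t $$ (a, b) * rotate_factors R F i t $$ (a, c)) = (if b = c then 1 else 0)"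
    unfolding Ri(2) using bc by simp
qed

section \<open>Singular values of the unfoldings\<close>

text \<open>Cutting after mode \<open>k\<close> writes the unfolding as \<open>V * C\<close>, and
  left-orthogonality up to that mode makes the columns of \<open>V\<close> orthonormal. The singular
  values of the unfolding therefore control the right interface of every such decomposition.\<close>

lemma unfolding_singular_value_bounds:
  assumes F: "tt_decomp N d r F X" and lo: "\<And>i. 1 \<le> i \<Longrightarrow> i \<le> k \<Longrightarrow> left_orth_at d r F i"
    and k: "k \<le> N" and rank: "mat_rank (unfolding_mat N d k X) = r k" and pos: "r k > 0"
  shows "0 < singular_value (r k) (unfolding_mat N d k X)"
    and "(singular_value (r k) (unfolding_mat N d k X))\<^sup>2 * (\<Sum>a<r k. (u a)\<^sup>2)
      \<le> (\<Sum>t\<in>idx d k N. (\<Sum>a<r k. u a * rvec N F k t a)\<^sup>2)"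
    and "right_op_bound N d r F k ((singular_value 1 (unfolding_mat N d k X))\<^sup>2)"
    and "singular_value (r k) (unfolding_mat N d k X) \<le> singular_value 1 (unfolding_mat N d k X)"
proof -
  have Ff: "tt_factors N d r F" and r0: "r 0 = 1" using F by (auto simp: tt_decomp_def tt_factors_def)
  define P where "P = (\<Prod>j\<in>{1..k}. d j)"
  define Q where "Q = (\<Prod>j\<in>{Suc k..N}. d j)"
  define V where "V = mat P (r k) (\<lambda>(p, a). lvec r F k (digits d 0 k p) a)"
  define C where "C = mat (r k) Q (\<lambda>(a, q). rvec N F k (digits d k N q) a)"
  have V: "V \<in> carrier_mat P (r k)" and C: "C \<in> carrier_mat (r k) Q" by (auto simp: V_def C_def)
  have M: "unfolding_mat N d k X = V * C"
  proof (rule eq_matI)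
    fix p q assume "p < dim_row (V * C)" "q < dim_col (V * C)"
    then have pq: "p < P" "q < Q" by (auto simp: V_def C_def)
    let ?s = "digits d 0 k p" and ?t = "digits d k N q"
    have s: "?s \<in> idx d 0 k" and t: "?t \<in> idx d k N"
      using digits_in_idx[where p = p and m = 0 and n = k and d = d] digits_in_idx[where p = q and m = k and n = N and d = d] pq by (auto simp: P_def Q_def)
    have m: "merge k ?s ?t \<in> tensor_idx N d" unfolding tensor_idx_eq using merge_in_idx[OF s t] k by simp
    have "unfolding_mat N d k X $$ (p, q) = tt_tensor N F (merge k ?s ?t)"
      using pq k F m by (simp add: unfolding_mat_def P_def Q_def unfold_idx_merge tt_decomp_def)
    also have "\<dots> = (\<Sum>a<r k. lvec r F k (merge k ?s ?t) a * rvec N F k (merge k ?s ?t) a)"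
      by (rule tt_tensor_split[OF Ff _ k]) (use m idx_less in \<open>auto simp: tensor_idx_eq\<close>)
    also have "\<dots> = (V * C) $$ (p, q)"
      using pq by (subst mult_mat_index_sum[OF V C]) (auto simp: V_def C_def lvec_merge rvec_merge)
    finally show "unfolding_mat N d k X $$ (p, q) = (V * C) $$ (p, q)" .
  qed (auto simp: unfolding_mat_def V_def C_def P_def Q_def)
  have VV: "transpose_mat V * V = 1\<^sub>m (r k)"
  proof (rule eq_matI)
    fix b c assume "b < dim_row (1\<^sub>m (r k) :: real mat)" "c < dim_col (1\<^sub>m (r k) :: real mat)"
    then have bc: "b < r k" "c < r k" by auto
    have "(transpose_mat V * V) $$ (b, c) = (\<Sum>p<P. V $$ (p, b) * V $$ (p, c))"
      using V bc by (subst mult_mat_index_sum[of _ "r k" P _ "r k"]) auto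
    also have "\<dots> = (\<Sum>p<P. lvec r F k (digits d 0 k p) b * lvec r F k (digits d 0 k p) c)"
      using bc by (intro sum.cong) (auto simp: V_def)
    also have "\<dots> = (\<Sum>s\<in>idx d 0 k. lvec r F k s b * lvec r F k s c)"
      using sum_digits[of 0 k "\<lambda>s. lvec r F k s b * lvec r F k s c" d] by (simp add: P_def)
    also have "\<dots> = 1\<^sub>m (r k) $$ (b, c)" using left_gram[OF r0 lo bc] bc by simp
    finally show "(transpose_mat V * V) $$ (b, c) = 1\<^sub>m (r k) $$ (b, c)" .
  qed (auto simp: V_def)
  have tail: "(\<Sum>q<Q. (\<Sum>a<r k. u a * C $$ (a, q))\<^sup>2) = (\<Sum>t\<in>idx d k N. (\<Sum>a<r k. u a * rvec N F k t a)\<^sup>2)" for u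
  proof -
    have "(\<Sum>q<Q. (\<Sum>a<r k. u a * C $$ (a, q))\<^sup>2) = (\<Sum>q<Q. (\<Sum>a<r k. u a * rvec N F k (digits d k N q) a)\<^sup>2)"
      by (intro sum.cong refl arg_cong[of _ _ "\<lambda>x. x\<^sup>2"]) (auto simp: C_def)
    then show ?thesis
      using sum_digits[OF k, of "\<lambda>t. (\<Sum>a<r k. u a * rvec N F k t a)\<^sup>2" d] by (simp add: Q_def)
  qed
  note sv = singular_value_bounds[OF V C M VV rank pos]
  show "0 < singular_value (r k) (unfolding_mat N d k X)" by (rule sv)
  show "singular_value (r k) (unfolding_mat N d k X) \<le> singular_value 1 (unfolding_mat N d k X)" by (rule sv)
  show "(singular_value (r k) (unfolding_mat N d k X))\<^sup>2 * (\<Sum>a<r k. (u a)\<^sup>2)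
      \<le> (\<Sum>t\<in>idx d k N. (\<Sum>a<r k. u a * rvec N F k t a)\<^sup>2)"
    using sv(2)[of u] by (simp only: tail)
  show "right_op_bound N d r F k ((singular_value 1 (unfolding_mat N d k X))\<^sup>2)"
    unfolding right_op_bound_def using sv(3) by (simp only: tail) blast
qed

section \<open>Orthogonal projections and the Procrustes problem\<close>

text \<open>The vector \<open>(I - U U\<^sup>T) w\<close>: for orthonormal columns, the part of
  \<open>w\<close> orthogonal to their span.\<close>

definition proj_residual :: "'i set \<Rightarrow> nat \<Rightarrow> ('i \<Rightarrow> nat \<Rightarrow> real) \<Rightarrow> ('i \<Rightarrow> real) \<Rightarrow> 'i \<Rightarrow> real" where
  "proj_residual I n U w s = w s - (\<Sum>a<n. U s a * (\<Sum>s'\<in>I. U s' a * w s'))"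

lemma sum_proj_residual_sq:
  assumes I: "finite I" and U: "\<And>a b. a < n \<Longrightarrow> b < n \<Longrightarrow> (\<Sum>s\<in>I. U s a * U s b) = (if a = b then 1 else 0)"
  shows "(\<Sum>s\<in>I. (proj_residual I n U w s)\<^sup>2) = (\<Sum>s\<in>I. (w s)\<^sup>2) - (\<Sum>a<n. (\<Sum>s\<in>I. U s a * w s)\<^sup>2)"
proof -
  let ?c = "\<lambda>a. \<Sum>s\<in>I. U s a * w s"
  have "(\<Sum>s\<in>I. w s * (\<Sum>a<n. U s a * ?c a)) = (\<Sum>s\<in>I. \<Sum>a<n. U s a * w s * ?c a)"
    by (simp add: sum_distrib_left mult_ac)
  also have "\<dots> = (\<Sum>a<n. \<Sum>s\<in>I. U s a * w s * ?c a)" by (rule sum.swap)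
  also have "\<dots> = (\<Sum>a<n. (?c a)\<^sup>2)" by (simp add: power2_eq_square flip: sum_distrib_right)
  finally have 1: "(\<Sum>s\<in>I. w s * (\<Sum>a<n. U s a * ?c a)) = (\<Sum>a<n. (?c a)\<^sup>2)" .
  have 2: "(\<Sum>s\<in>I. (\<Sum>a<n. U s a * ?c a)\<^sup>2) = (\<Sum>a<n. (?c a)\<^sup>2)"
    by (rule sum_square_gram[OF I U])
  have "(\<Sum>s\<in>I. (proj_residual I n U w s)\<^sup>2) = (\<Sum>s\<in>I. (w s)\<^sup>2) - 2 * (\<Sum>s\<in>I. w s * (\<Sum>a<n. U s a * ?c a)) + (\<Sum>s\<in>I. (\<Sum>a<n. U s a * ?c a)\<^sup>2)"
    unfolding proj_residual_def power2_diff by (simp add: sum.distrib sum_subtractf sum_distrib_left mult.assoc)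
  then show ?thesis unfolding 1 2 by simp
qed

lemma bessel:
  fixes n :: nat
  assumes "finite I" "\<And>a b. a < n \<Longrightarrow> b < n \<Longrightarrow> (\<Sum>s\<in>I. U s a * U s b) = (if a = b then 1 else 0)"
  shows "(\<Sum>a<n. (\<Sum>s\<in>I. U s a * w s)\<^sup>2) \<le> (\<Sum>s\<in>I. (w s :: real)\<^sup>2)"
proof -
  have "0 \<le> (\<Sum>s\<in>I. (proj_residual I n U w s)\<^sup>2)" by (intro sum_nonneg) auto
  also have "\<dots> = (\<Sum>s\<in>I. (w s)\<^sup>2) - (\<Sum>a<n. (\<Sum>s\<in>I. U s a * w s)\<^sup>2)"
    by (rule sum_proj_residual_sq[OF assms])
  finally show ?thesis by simp
qed

lemma proj_residual_diff: "proj_residual I n U (\<lambda>s. v s - w s) s = proj_residual I n U v s - proj_residual I n U w s"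
  by (simp add: proj_residual_def right_diff_distrib sum_subtractf)

lemma proj_residual_sum: "proj_residual I n U (\<lambda>s. \<Sum>b<k. v s b * c b) s = (\<Sum>b<k. proj_residual I n U (\<lambda>s. v s b) s * c b)"
proof -
  have "(\<Sum>a<n. U s a * (\<Sum>s'\<in>I. U s' a * (\<Sum>b<k. v s' b * c b)))
      = (\<Sum>a<n. \<Sum>b<k. U s a * (\<Sum>s'\<in>I. U s' a * v s' b) * c b)"
  proof (intro sum.cong refl)
    fix a
    have "(\<Sum>s'\<in>I. U s' a * (\<Sum>b<k. v s' b * c b)) = (\<Sum>b<k. \<Sum>s'\<in>I. U s' a * v s' b * c b)"
      unfolding sum_distrib_left by (subst sum.swap) (simp add: mult.assoc)
    then show "U s a * (\<Sum>s'\<in>I. U s' a * (\<Sum>b<k. v s' b * c b))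
      = (\<Sum>b<k. U s a * (\<Sum>s'\<in>I. U s' a * v s' b) * c b)"
      by (simp add: sum_distrib_left sum_distrib_right mult.assoc)
  qed
  also have "\<dots> = (\<Sum>b<k. \<Sum>a<n. U s a * (\<Sum>s'\<in>I. U s' a * v s' b) * c b)" by (rule sum.swap)
  finally show ?thesis
    by (simp add: proj_residual_def left_diff_distrib sum_subtractf sum_distrib_right)
qed

lemma proj_residual_cong:
  assumes "\<And>s. s \<in> I \<Longrightarrow> v s = w s" "s \<in> I"
  shows "proj_residual I n U v s = proj_residual I n U w s"
  using assms by (simp add: proj_residual_def)

lemma proj_residual_basis:
  assumes "\<And>a b. a < n \<Longrightarrow> b < n \<Longrightarrow> (\<Sum>s\<in>I. U s a * U s b) = (if a = b then 1 else 0)" "b < n"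
  shows "proj_residual I n U (\<lambda>s. U s b) s = 0"
proof -
  have "(\<Sum>a<n. U s a * (\<Sum>s'\<in>I. U s' a * U s' b)) = (\<Sum>a<n. if a = b then U s b else 0)"
    using assms by (intro sum.cong refl) auto
  then show ?thesis using assms(2) by (simp add: proj_residual_def)
qed

text \<open>For \<open>G = V\<^sup>T U\<close>, \<open>\<eta>\<close> equals \<open>n\<close> minus
  the squared Frobenius norm of \<open>G\<close>, while the squared distance of \<open>U\<close>
  from \<open>V R\<close> is \<open>2 * n\<close> minus twice the inner product of \<open>R\<close>
  and \<open>G\<close>. The polar factor makes that inner product at least the squared norm;
  \<open>\<eta> < 1\<close> is its invertibility condition.\<close>

lemma procrustes_bound:
  fixes U V :: "'i \<Rightarrow> nat \<Rightarrow> real"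
  assumes I: "finite I"
    and U: "\<And>a b. a < n \<Longrightarrow> b < n \<Longrightarrow> (\<Sum>s\<in>I. U s a * U s b) = (if a = b then 1 else 0)"
    and V: "\<And>a b. a < n \<Longrightarrow> b < n \<Longrightarrow> (\<Sum>s\<in>I. V s a * V s b) = (if a = b then 1 else 0)"
    and \<eta>: "\<eta> = (\<Sum>b<n. \<Sum>s\<in>I. (proj_residual I n U (\<lambda>s. V s b) s)\<^sup>2)" "\<eta> < 1"
  obtains R where "R \<in> carrier_mat n n" "transpose_mat R * R = 1\<^sub>m n"
    "(\<Sum>s\<in>I. \<Sum>b<n. (U s b - (\<Sum>a<n. V s a * R $$ (a, b)))\<^sup>2) \<le> 2 * \<eta>"
proof -
  define G where "G = mat n n (\<lambda>(a, b). \<Sum>s\<in>I. V s a * U s b)"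
  have G: "G \<in> carrier_mat n n" by (simp add: G_def)
  have Gi: "G $$ (a, b) = (\<Sum>s\<in>I. V s a * U s b)" if "a < n" "b < n" for a b using that by (simp add: G_def)
  define g where "g = (\<Sum>a<n. \<Sum>b<n. (G $$ (a, b))\<^sup>2)"
  have "(\<Sum>s\<in>I. (proj_residual I n U (\<lambda>s. V s b) s)\<^sup>2) = 1 - (\<Sum>a<n. (G $$ (b, a))\<^sup>2)" if b: "b < n" for b
  proof -
    have "(\<Sum>s\<in>I. (proj_residual I n U (\<lambda>s. V s b) s)\<^sup>2) = (\<Sum>s\<in>I. (V s b)\<^sup>2) - (\<Sum>a<n. (\<Sum>s\<in>I. U s a * V s b)\<^sup>2)"
      by (rule sum_proj_residual_sq[OF I U])
    moreover have "(\<Sum>s\<in>I. (V s b)\<^sup>2) = 1" using V[OF b b] by (simp add: power2_eq_square)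
    ultimately show ?thesis using b by (simp add: Gi mult.commute)
  qed
  then have "\<eta> = (\<Sum>b<n. 1 - (\<Sum>a<n. (G $$ (b, a))\<^sup>2))" by (simp add: \<eta>(1))
  then have eta: "\<eta> = real n - g" by (simp add: sum_subtractf g_def)
  have "(\<Sum>a<n. (\<Sum>b<n. G $$ (a, b) * u b)\<^sup>2) \<le> (\<Sum>b<n. (u b)\<^sup>2)" for u
  proof -
    have "(\<Sum>b<n. G $$ (a, b) * u b) = (\<Sum>s\<in>I. V s a * (\<Sum>b<n. U s b * u b))" if "a < n" for a
    proof -
      have "(\<Sum>b<n. G $$ (a, b) * u b) = (\<Sum>b<n. \<Sum>s\<in>I. V s a * (U s b * u b))"
        using that by (simp add: Gi sum_distrib_right mult.assoc)
      also have "\<dots> = (\<Sum>s\<in>I. \<Sum>b<n. V s a * (U s b * u b))" by (rule sum.swap)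
      finally show ?thesis by (simp add: sum_distrib_left)
    qed
    then have "(\<Sum>a<n. (\<Sum>b<n. G $$ (a, b) * u b)\<^sup>2) = (\<Sum>a<n. (\<Sum>s\<in>I. V s a * (\<Sum>b<n. U s b * u b))\<^sup>2)" by simp
    also have "\<dots> \<le> (\<Sum>s\<in>I. (\<Sum>b<n. U s b * u b)\<^sup>2)" by (rule bessel[OF I V])
    also have "\<dots> = (\<Sum>b<n. (u b)\<^sup>2)" by (rule sum_square_gram[OF I U])
    finally show ?thesis .
  qed
  moreover have "real n - (\<Sum>a<n. \<Sum>b<n. (G $$ (a, b))\<^sup>2) < 1" using eta \<eta>(2) by (simp add: g_def)
  ultimately obtain R where R: "R \<in> carrier_mat n n" "transpose_mat R * R = 1\<^sub>m n"
    and RG: "g \<le> (\<Sum>a<n. \<Sum>b<n. R $$ (a, b) * G $$ (a, b))"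
    unfolding g_def by (rule orthogonal_factor_of_contraction[OF G])
  have "(\<Sum>a<n. (R $$ (a, b))\<^sup>2) = 1" if "b < n" for b
    using arg_cong[OF R(2), of "\<lambda>M. M $$ (b, b)"] R(1) that
    by (subst (asm) mult_mat_index_sum[of _ n n _ n]) (auto simp: power2_eq_square)
  then have VR: "(\<Sum>s\<in>I. (\<Sum>a<n. V s a * R $$ (a, b))\<^sup>2) = 1" if "b < n" for b
    using that by (simp add: sum_square_gram[OF I V])
  have UU: "(\<Sum>s\<in>I. (U s b)\<^sup>2) = 1" if "b < n" for b using U[OF that that] by (simp add: power2_eq_square)
  have cross: "(\<Sum>s\<in>I. U s b * (\<Sum>a<n. V s a * R $$ (a, b))) = (\<Sum>a<n. R $$ (a, b) * G $$ (a, b))" if "b < n" for b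
  proof -
    have "(\<Sum>s\<in>I. U s b * (\<Sum>a<n. V s a * R $$ (a, b))) = (\<Sum>s\<in>I. \<Sum>a<n. R $$ (a, b) * (V s a * U s b))"
      by (simp add: sum_distrib_left mult_ac)
    also have "\<dots> = (\<Sum>a<n. \<Sum>s\<in>I. R $$ (a, b) * (V s a * U s b))" by (rule sum.swap)
    finally show ?thesis using that by (simp add: Gi sum_distrib_left)
  qed
  have "(\<Sum>s\<in>I. \<Sum>b<n. (U s b - (\<Sum>a<n. V s a * R $$ (a, b)))\<^sup>2)
      = (\<Sum>b<n. \<Sum>s\<in>I. (U s b - (\<Sum>a<n. V s a * R $$ (a, b)))\<^sup>2)" by (rule sum.swap)
  also have "\<dots> = (\<Sum>b<n. 2 - 2 * (\<Sum>a<n. R $$ (a, b) * G $$ (a, b)))"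
  proof (rule sum.cong[OF refl])
    fix b assume "b \<in> {..<n}"
    then have b: "b < n" by simp
    have "(\<Sum>s\<in>I. (U s b - (\<Sum>a<n. V s a * R $$ (a, b)))\<^sup>2)
      = (\<Sum>s\<in>I. (U s b)\<^sup>2) + (\<Sum>s\<in>I. (\<Sum>a<n. V s a * R $$ (a, b))\<^sup>2) - 2 * (\<Sum>s\<in>I. U s b * (\<Sum>a<n. V s a * R $$ (a, b)))"
      unfolding power2_diff by (simp add: sum.distrib sum_subtractf sum_distrib_left mult.assoc)
    then show "(\<Sum>s\<in>I. (U s b - (\<Sum>a<n. V s a * R $$ (a, b)))\<^sup>2) = 2 - 2 * (\<Sum>a<n. R $$ (a, b) * G $$ (a, b))"
      unfolding UU[OF b] VR[OF b] cross[OF b] by simp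
  qed
  also have "\<dots> = 2 * real n - 2 * (\<Sum>b<n. \<Sum>a<n. R $$ (a, b) * G $$ (a, b))"
    by (simp add: sum_subtractf sum_distrib_left)
  also have "(\<Sum>b<n. \<Sum>a<n. R $$ (a, b) * G $$ (a, b)) = (\<Sum>a<n. \<Sum>b<n. R $$ (a, b) * G $$ (a, b))"
    by (rule sum.swap)
  also have "2 * real n - 2 * \<dots> \<le> 2 * \<eta>" using RG eta by simp
  finally show thesis using that R by blast
qed

section \<open>The factorization distance is controlled by the tensor distance\<close>

text \<open>Positive inner ranks are assumed because \<open>singular_value (r i)\<close> means
  nothing for \<open>r i = 0\<close>; that case is settled separately at the end.\<close>

locale tt_pair =
  fixes N :: nat and d r :: "nat \<Rightarrow> nat" and Xs X :: tensor and Fs F :: factors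
  assumes N2: "2 \<le> N"
    and Fs: "tt_decomp N d r Fs Xs" and los: "left_orthogonal N d r Fs"
    and ranks: "has_tt_ranks N d r Xs"
    and F: "tt_decomp N d r F X" and lo: "left_orthogonal N d r F"
    and pos: "\<And>i. i \<in> {1..N-1} \<Longrightarrow> 0 < r i"
begin

definition smin where "smin = sigma_min N d r Xs"
definition smax where "smax = sigma_max N d Xs"
definition E where "E = tensor_norm N d (\<lambda>s. X s - Xs s)"

lemma r0: "r 0 = 1" and rN: "r N = 1"
  using F by (auto simp: tt_decomp_def tt_factors_def)

lemma ttF: "tt_factors N d r F" and ttFs: "tt_factors N d r Fs"
  using F Fs by (auto simp: tt_decomp_def)

lemma loF: "1 \<le> i \<Longrightarrow> i < N \<Longrightarrow> left_orth_at d r F i" and loFs: "1 \<le> i \<Longrightarrow> i < N \<Longrightarrow> left_orth_at d r Fs i"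
  using lo los by (auto simp: left_orthogonal_def left_orth_at_iff)

lemma E_nonneg: "0 \<le> E"
  by (simp add: E_def tensor_norm_nonneg)

lemma E_sq: "E\<^sup>2 = (\<Sum>s\<in>idx d 0 N. (X s - Xs s)\<^sup>2)"
  by (simp add: E_def tensor_norm_sq)

lemma sv_bounds:
  assumes "1 \<le> k" "k < N"
  shows "smin \<le> singular_value (r k) (unfolding_mat N d k Xs)"
    "singular_value 1 (unfolding_mat N d k Xs) \<le> smax"
    "0 < singular_value (r k) (unfolding_mat N d k Xs)"
  using assms unfolding_singular_value_bounds(1)[OF Fs, of k] loFs ranks pos
  by (auto simp: smin_def smax_def sigma_min_def sigma_max_def has_tt_ranks_def intro!: Min_le Max_ge)

lemma smin_pos: "0 < smin"
proof -
  have "smin \<in> (\<lambda>i. singular_value (r i) (unfolding_mat N d i Xs)) ` {1..N-1}"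
    unfolding smin_def sigma_min_def using N2 by (intro Min_in) auto
  then obtain k where "k \<in> {1..N-1}" "smin = singular_value (r k) (unfolding_mat N d k Xs)" by blast
  then show ?thesis using sv_bounds(3)[of k] by auto
qed

text \<open>Formulated for any left-orthogonal decomposition of \<open>Xs\<close>, because it is
  applied both to \<open>Fs\<close> and to its rotations.\<close>

lemma tail_bounds:
  assumes G: "tt_decomp N d r G Xs" "\<And>i. 1 \<le> i \<Longrightarrow> i < N \<Longrightarrow> left_orth_at d r G i" and k: "1 \<le> k" "k < N"
  shows "smin\<^sup>2 * (\<Sum>a<r k. (u a)\<^sup>2) \<le> (\<Sum>t\<in>idx d k N. (\<Sum>a<r k. u a * rvec N G k t a)\<^sup>2)"
    and "right_op_bound N d r G k (smax\<^sup>2)"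
    and "smin \<le> smax"
proof -
  let ?M = "unfolding_mat N d k Xs"
  have rk: "mat_rank ?M = r k" "0 < r k" using ranks pos k by (auto simp: has_tt_ranks_def)
  have G': "\<And>i. 1 \<le> i \<Longrightarrow> i \<le> k \<Longrightarrow> left_orth_at d r G i" using G(2) k by auto
  have kN: "k \<le> N" using k by simp
  note b = unfolding_singular_value_bounds[OF G(1) G' kN rk]
  have sq: "0 \<le> (\<Sum>a<r k. (u a)\<^sup>2)" for u :: "nat \<Rightarrow> real" by (intro sum_nonneg) auto
  have s1: "0 \<le> singular_value 1 ?M" using b(1,4) by linarith
  show "smin\<^sup>2 * (\<Sum>a<r k. (u a)\<^sup>2) \<le> (\<Sum>t\<in>idx d k N. (\<Sum>a<r k. u a * rvec N G k t a)\<^sup>2)"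
    using b(2)[of u] mult_right_mono[OF power_mono[OF sv_bounds(1)[OF k] less_imp_le[OF smin_pos], of 2] sq[of u]]
    by linarith
  have "(singular_value 1 ?M)\<^sup>2 \<le> smax\<^sup>2"
    using sv_bounds(2)[OF k] s1 by (rule power_mono)
  then show "right_op_bound N d r G k (smax\<^sup>2)"
    using b(3) mult_right_mono[OF _ sq] unfolding right_op_bound_def by (meson order_trans)
  show "smin \<le> smax" using sv_bounds(1,2)[OF k] b(4) by linarith
qed


text \<open>The quantity that the rotations make small. It vanishes at \<open>k = 0\<close>, and at
  \<open>k = N\<close> it equals \<open>E\<^sup>2\<close> if \<open>G\<close> represents
  \<open>Xs\<close>.\<close>

definition frame_error where
  "frame_error G k = (\<Sum>s\<in>idx d 0 k. \<Sum>b<r k. (lvec r F k s b - lvec r G k s b)\<^sup>2)"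

lemma gramF: "k < N \<Longrightarrow> b < r k \<Longrightarrow> c < r k \<Longrightarrow>
    (\<Sum>s\<in>idx d 0 k. lvec r F k s b * lvec r F k s c) = (if b = c then 1 else 0)"
  using left_gram[where r = r and k = k and d = d and F = F, OF r0] loF by simp

lemma gramFs: "k < N \<Longrightarrow> b < r k \<Longrightarrow> c < r k \<Longrightarrow>
    (\<Sum>s\<in>idx d 0 k. lvec r Fs k s b * lvec r Fs k s c) = (if b = c then 1 else 0)"
  using left_gram[where r = r and k = k and d = d and F = Fs, OF r0] loFs by simp

lemma decomp_merge:
  assumes G: "tt_decomp N d r G Z" and k: "k \<le> N" and st: "s \<in> idx d 0 k" "t \<in> idx d k N"
  shows "Z (merge k s t) = (\<Sum>b<r k. lvec r G k s b * rvec N G k t b)"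
proof -
  have m: "merge k s t \<in> idx d 0 N" using merge_in_idx[OF st] k by simp
  then have "Z (merge k s t) = tt_tensor N G (merge k s t)"
    using G by (simp add: tt_decomp_def tensor_idx_eq)
  also have "\<dots> = (\<Sum>b<r k. lvec r G k (merge k s t) b * rvec N G k (merge k s t) b)"
    by (rule tt_tensor_split[of N d]) (use G m idx_less k in \<open>auto simp: tt_decomp_def\<close>)
  finally show ?thesis by (simp add: lvec_merge rvec_merge)
qed

text \<open>A Wedin-type argument: projecting off the span of the left interface of \<open>F\<close>
  annihilates the unfolding of \<open>X\<close>. The residual of the left interface of
  \<open>Fs\<close>, times the right interface of \<open>Fs\<close>, is then the residual of
  \<open>Xs - X\<close>, and that right interface shrinks no vector by more than
  \<open>smin\<close>.\<close>

lemma subspace_perturbation: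
  assumes k: "1 \<le> k" "k < N"
  shows "smin\<^sup>2 * (\<Sum>b<r k. \<Sum>s\<in>idx d 0 k. (proj_residual (idx d 0 k) (r k) (lvec r F k) (\<lambda>s. lvec r Fs k s b) s)\<^sup>2) \<le> E\<^sup>2"
proof -
  let ?I = "idx d 0 k" and ?J = "idx d k N" and ?rs = "proj_residual (idx d 0 k) (r k) (lvec r F k)"
  have kN: "k \<le> N" using k by simp
  note U = gramF[OF k(2)]
  have "smin\<^sup>2 * (\<Sum>b<r k. \<Sum>s\<in>?I. (?rs (\<lambda>s. lvec r Fs k s b) s)\<^sup>2)
      = (\<Sum>s\<in>?I. smin\<^sup>2 * (\<Sum>b<r k. (?rs (\<lambda>s. lvec r Fs k s b) s)\<^sup>2))"
    by (subst sum.swap) (simp add: sum_distrib_left)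
  also have "\<dots> \<le> (\<Sum>s\<in>?I. \<Sum>t\<in>?J. (\<Sum>b<r k. ?rs (\<lambda>s. lvec r Fs k s b) s * rvec N Fs k t b)\<^sup>2)"
    by (intro sum_mono tail_bounds(1)[OF Fs loFs k])
  also have "\<dots> = (\<Sum>t\<in>?J. \<Sum>s\<in>?I. (\<Sum>b<r k. ?rs (\<lambda>s. lvec r Fs k s b) s * rvec N Fs k t b)\<^sup>2)"
    by (rule sum.swap)
  also have "\<dots> \<le> (\<Sum>t\<in>?J. \<Sum>s\<in>?I. (Xs (merge k s t) - X (merge k s t))\<^sup>2)"
  proof (rule sum_mono)
    fix t assume t: "t \<in> ?J"
    have "(\<Sum>b<r k. ?rs (\<lambda>s. lvec r Fs k s b) s * rvec N Fs k t b) = ?rs (\<lambda>s. Xs (merge k s t) - X (merge k s t)) s"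
      if s: "s \<in> ?I" for s
    proof -
      have "?rs (\<lambda>s. X (merge k s t)) s = ?rs (\<lambda>s. \<Sum>b<r k. lvec r F k s b * rvec N F k t b) s"
        by (rule proj_residual_cong[OF _ s]) (rule decomp_merge[OF F kN _ t])
      also have "\<dots> = 0"
        unfolding proj_residual_sum using proj_residual_basis[OF U] by simp
      finally have "?rs (\<lambda>s. X (merge k s t)) s = 0" .
      moreover have "?rs (\<lambda>s. Xs (merge k s t)) s = ?rs (\<lambda>s. \<Sum>b<r k. lvec r Fs k s b * rvec N Fs k t b) s"
        by (rule proj_residual_cong[OF _ s]) (rule decomp_merge[OF Fs kN _ t])
      ultimately show ?thesis unfolding proj_residual_diff by (simp add: proj_residual_sum)
    qed
    then have "(\<Sum>s\<in>?I. (\<Sum>b<r k. ?rs (\<lambda>s. lvec r Fs k s b) s * rvec N Fs k t b)\<^sup>2)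
        = (\<Sum>s\<in>?I. (?rs (\<lambda>s. Xs (merge k s t) - X (merge k s t)) s)\<^sup>2)" by simp
    also have "\<dots> = (\<Sum>s\<in>?I. (Xs (merge k s t) - X (merge k s t))\<^sup>2)
        - (\<Sum>a<r k. (\<Sum>s\<in>?I. lvec r F k s a * (Xs (merge k s t) - X (merge k s t)))\<^sup>2)"
      by (rule sum_proj_residual_sq[OF finite_idx U])
    also have "\<dots> \<le> (\<Sum>s\<in>?I. (Xs (merge k s t) - X (merge k s t))\<^sup>2)"
      by (simp add: sum_nonneg)
    finally show "(\<Sum>s\<in>?I. (\<Sum>b<r k. ?rs (\<lambda>s. lvec r Fs k s b) s * rvec N Fs k t b)\<^sup>2)
      \<le> (\<Sum>s\<in>?I. (Xs (merge k s t) - X (merge k s t))\<^sup>2)" .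
  qed
  also have "\<dots> = (\<Sum>s\<in>?I. \<Sum>t\<in>?J. (Xs (merge k s t) - X (merge k s t))\<^sup>2)" by (rule sum.swap)
  also have "\<dots> = E\<^sup>2"
    unfolding E_sq using kN by (subst sum_idx_split[of 0 k N]) (simp_all add: power2_commute)
  finally show ?thesis .
qed

lemma exists_close_rotations:
  assumes small: "E < smin"
  obtains R where "rotations N r R" "\<And>k. 1 \<le> k \<Longrightarrow> k < N \<Longrightarrow> frame_error (rotate_factors R Fs) k \<le> 2 * (E\<^sup>2 / smin\<^sup>2)"
proof -
  have "\<exists>R. R \<in> carrier_mat (r k) (r k) \<and> transpose_mat R * R = 1\<^sub>m (r k) \<and>
     (\<Sum>s\<in>idx d 0 k. \<Sum>b<r k. (lvec r F k s b - (\<Sum>a<r k. lvec r Fs k s a * R $$ (a, b)))\<^sup>2) \<le> 2 * (E\<^sup>2 / smin\<^sup>2)"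
    if k: "1 \<le> k" "k < N" for k
  proof -
    let ?eta = "\<Sum>b<r k. \<Sum>s\<in>idx d 0 k. (proj_residual (idx d 0 k) (r k) (lvec r F k) (\<lambda>s. lvec r Fs k s b) s)\<^sup>2"
    have eta: "?eta \<le> E\<^sup>2 / smin\<^sup>2"
      using subspace_perturbation[OF k] smin_pos by (simp add: pos_le_divide_eq mult.commute)
    \<comment> \<open>Strictness is what the Procrustes step needs: it keeps \<open>?eta\<close>
      below 1.\<close>
    have "E\<^sup>2 < smin\<^sup>2" using small E_nonneg by (intro power_strict_mono) auto
    then have "E\<^sup>2 / smin\<^sup>2 < 1" using smin_pos by simp
    with eta have "?eta < 1" by linarith
    from procrustes_bound[OF finite_idx gramF[OF k(2)] gramFs[OF k(2)] refl this]
    obtain R where "R \<in> carrier_mat (r k) (r k)" "transpose_mat R * R = 1\<^sub>m (r k)"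
      "(\<Sum>s\<in>idx d 0 k. \<Sum>b<r k. (lvec r F k s b - (\<Sum>a<r k. lvec r Fs k s a * R $$ (a, b)))\<^sup>2) \<le> 2 * ?eta"
      by blast
    then show ?thesis using eta by (intro exI[of _ R]) linarith
  qed
  then have "\<forall>k. \<exists>R. 1 \<le> k \<longrightarrow> k < N \<longrightarrow> R \<in> carrier_mat (r k) (r k) \<and> transpose_mat R * R = 1\<^sub>m (r k) \<and>
     (\<Sum>s\<in>idx d 0 k. \<Sum>b<r k. (lvec r F k s b - (\<Sum>a<r k. lvec r Fs k s a * R $$ (a, b)))\<^sup>2) \<le> 2 * (E\<^sup>2 / smin\<^sup>2)"
    by blast
  from choice[OF this] obtain R where R: "\<And>k. 1 \<le> k \<Longrightarrow> k < N \<Longrightarrow> R k \<in> carrier_mat (r k) (r k) \<and> transpose_mat (R k) * R k = 1\<^sub>m (r k) \<and>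
     (\<Sum>s\<in>idx d 0 k. \<Sum>b<r k. (lvec r F k s b - (\<Sum>a<r k. lvec r Fs k s a * R k $$ (a, b)))\<^sup>2) \<le> 2 * (E\<^sup>2 / smin\<^sup>2)"
    by blast
  \<comment> \<open>The choice leaves the two ends open, and \<open>rotations\<close> prescribes
    them.\<close>
  define Q where "Q = R(0 := 1\<^sub>m 1, N := 1\<^sub>m 1)"
  have Q: "rotations N r Q" using R N2 by (auto simp: rotations_def Q_def)
  moreover have "frame_error (rotate_factors Q Fs) k \<le> 2 * (E\<^sup>2 / smin\<^sup>2)" if k: "1 \<le> k" "k < N" for k
  proof -
    have "frame_error (rotate_factors Q Fs) k = (\<Sum>s\<in>idx d 0 k. \<Sum>b<r k. (lvec r F k s b - (\<Sum>a<r k. lvec r Fs k s a * Q k $$ (a, b)))\<^sup>2)"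
      unfolding frame_error_def
    proof (intro sum.cong refl)
      fix s b assume "s \<in> idx d 0 k" "b \<in> {..<r k}"
      then show "(lvec r F k s b - lvec r (rotate_factors Q Fs) k s b)\<^sup>2
        = (lvec r F k s b - (\<Sum>a<r k. lvec r Fs k s a * Q k $$ (a, b)))\<^sup>2"
        using lvec_rotate_factors[OF ttFs Q, of k s b] k idx_less[of s d 0 k] by simp
    qed
    then show ?thesis using R[OF k] k by (simp add: Q_def)
  qed
  ultimately show thesis using that by blast
qed

text \<open>For left interfaces \<open>U\<close> of \<open>F\<close> and \<open>V\<close> of
  \<open>G\<close>, the difference of the two factors \<open>k + 1\<close>, multiplied by
  \<open>U k\<close>, is \<open>(U (k+1) - V (k+1)) - (U k - V k) * G (k+1)\<close>, slice by slice.
  Multiplication by \<open>U k\<close> preserves the norm.\<close>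

lemma factor_norm_sq_diff_le:
  assumes G: "tt_factors N d r G" and k: "Suc k \<le> N"
  shows "factor_norm_sq d r (factor_diff F G) (Suc k) \<le> 2 * frame_error G (Suc k) +
    2 * (\<Sum>s\<in>idx d 0 k. \<Sum>t<d (Suc k). \<Sum>b<r (Suc k). (\<Sum>a<r k. (lvec r F k s a - lvec r G k s a) * G (Suc k) t $$ (a, b))\<^sup>2)"
proof -
  let ?D = "factor_diff F G" and ?e = "\<lambda>s a. lvec r F k s a - lvec r G k s a"
  let ?H = "F(Suc k := ?D (Suc k))"
  have "factor_norm_sq d r ?D (Suc k) = factor_norm_sq d r ?H (Suc k)" by (simp add: factor_norm_sq_def)
  also have "\<dots> = left_frob_sq d r ?H (Suc k)"
    by (rule left_frob_sq_Suc_isometry[where r = r, OF r0, symmetric]) (use loF k in \<open>auto simp: left_orth_at_def\<close>)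
  also have "\<dots> = (\<Sum>s\<in>idx d 0 k. \<Sum>t<d (Suc k). \<Sum>b<r (Suc k). (\<Sum>a<r k. lvec r F k s a * ?D (Suc k) t $$ (a, b))\<^sup>2)"
  proof -
    have "lvec r ?H k s = lvec r F k s" for s by (rule lvec_cong) auto
    then show ?thesis by (simp add: left_frob_sq_def sum_idx_Suc lvec_upd)
  qed
  also have "\<dots> \<le> (\<Sum>s\<in>idx d 0 k. \<Sum>t<d (Suc k). \<Sum>b<r (Suc k).
      2 * (lvec r F (Suc k) (s(Suc k := t)) b - lvec r G (Suc k) (s(Suc k := t)) b)\<^sup>2
      + 2 * (\<Sum>a<r k. ?e s a * G (Suc k) t $$ (a, b))\<^sup>2)"
  proof (intro sum_mono)
    fix s t b assume tb: "t \<in> {..<d (Suc k)}" "b \<in> {..<r (Suc k)}"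
    have c: "F (Suc k) t \<in> carrier_mat (r k) (r (Suc k))" "G (Suc k) t \<in> carrier_mat (r k) (r (Suc k))"
      using tt_factors_carrier[OF ttF, of "Suc k" t] tt_factors_carrier[OF G, of "Suc k" t] k tb by auto
    let ?x = "lvec r F (Suc k) (s(Suc k := t)) b - lvec r G (Suc k) (s(Suc k := t)) b"
    let ?y = "\<Sum>a<r k. ?e s a * G (Suc k) t $$ (a, b)"
    have "(\<Sum>a<r k. lvec r F k s a * ?D (Suc k) t $$ (a, b)) = ?x - ?y"
      using c tb by (simp add: lvec_upd factor_diff_def sum_subtractf[symmetric] algebra_simps)
    moreover have "(?x - ?y)\<^sup>2 \<le> 2 * ?x\<^sup>2 + 2 * ?y\<^sup>2"
      using zero_le_power2[of "?x + ?y"] by (simp add: power2_eq_square algebra_simps)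
    ultimately show "(\<Sum>a<r k. lvec r F k s a * ?D (Suc k) t $$ (a, b))\<^sup>2 \<le> 2 * ?x\<^sup>2 + 2 * ?y\<^sup>2" by simp
  qed
  also have "\<dots> = 2 * frame_error G (Suc k) +
    2 * (\<Sum>s\<in>idx d 0 k. \<Sum>t<d (Suc k). \<Sum>b<r (Suc k). (\<Sum>a<r k. ?e s a * G (Suc k) t $$ (a, b))\<^sup>2)"
    by (simp only: frame_error_def sum_idx_Suc[OF le0] sum.distrib sum_distrib_left[symmetric])
  finally show ?thesis .
qed

lemma factor_norm_sq_left_orthogonal:
  assumes "left_orth_at d r G i"
  shows "factor_norm_sq d r G i = real (r i)"
proof -
  have "factor_norm_sq d r G i = (\<Sum>t<d i. \<Sum>b<r i. \<Sum>a<r (i - 1). G i t $$ (a, b) * G i t $$ (a, b))"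
    unfolding factor_norm_sq_def power2_eq_square by (rule sum.cong[OF refl], rule sum.swap)
  also have "\<dots> = (\<Sum>b<r i. \<Sum>t<d i. \<Sum>a<r (i - 1). G i t $$ (a, b) * G i t $$ (a, b))"
    by (rule sum.swap)
  finally show ?thesis using assms by (simp add: left_orth_at_def)
qed

text \<open>Cauchy-Schwarz charges the whole squared Frobenius norm of the left-orthogonal factor,
  which is its number of columns.\<close>

lemma factor_norm_sq_diff_inner:
  assumes G: "tt_factors N d r G" and lo: "left_orth_at d r G (Suc k)" and k: "Suc k \<le> N"
  shows "factor_norm_sq d r (factor_diff F G) (Suc k) \<le> 2 * frame_error G (Suc k) + 2 * real (r (Suc k)) * frame_error G k"
proof -
  let ?e = "\<lambda>s a. lvec r F k s a - lvec r G k s a"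
  have "(\<Sum>s\<in>idx d 0 k. \<Sum>t<d (Suc k). \<Sum>b<r (Suc k). (\<Sum>a<r k. ?e s a * G (Suc k) t $$ (a, b))\<^sup>2)
    \<le> (\<Sum>s\<in>idx d 0 k. \<Sum>t<d (Suc k). \<Sum>b<r (Suc k). (\<Sum>a<r k. (?e s a)\<^sup>2) * (\<Sum>a<r k. (G (Suc k) t $$ (a, b))\<^sup>2))"
    by (intro sum_mono Cauchy_Schwarz_sum)
  also have "\<dots> = frame_error G k * (\<Sum>t<d (Suc k). \<Sum>b<r (Suc k). \<Sum>a<r k. (G (Suc k) t $$ (a, b))\<^sup>2)"
    unfolding frame_error_def by (simp only: sum_distrib_left[symmetric] sum_distrib_right[symmetric])
  also have "(\<Sum>t<d (Suc k). \<Sum>b<r (Suc k). \<Sum>a<r k. (G (Suc k) t $$ (a, b))\<^sup>2) = factor_norm_sq d r G (Suc k)"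
    unfolding factor_norm_sq_def diff_Suc_1 by (rule sum.cong[OF refl], rule sum.swap)
  finally show ?thesis using factor_norm_sq_diff_le[OF G k] factor_norm_sq_left_orthogonal[OF lo] by (simp add: mult_ac)
qed

text \<open>The last factor is not left-orthogonal, but it is itself the right interface at
  \<open>N - 1\<close>, so \<open>smax\<close> replaces the rank; the frame error at
  \<open>N\<close> is the tensor error.\<close>

lemma factor_norm_sq_diff_last:
  assumes G: "tt_decomp N d r G Xs" "\<And>i. 1 \<le> i \<Longrightarrow> i < N \<Longrightarrow> left_orth_at d r G i"
  shows "factor_norm_sq d r (factor_diff F G) N \<le> 2 * E\<^sup>2 + 2 * smax\<^sup>2 * frame_error G (N - 1)"
proof -
  obtain k where k: "N = Suc k" "1 \<le> k" using N2 by (cases N) auto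
  have ttG: "tt_factors N d r G" using G(1) by (simp add: tt_decomp_def)
  let ?e = "\<lambda>s a. lvec r F k s a - lvec r G k s a"
  have E: "frame_error G N = E\<^sup>2"
    unfolding frame_error_def E_sq
  proof (rule sum.cong[OF refl])
    fix s assume s: "s \<in> idx d 0 N"
    then have "X s = lvec r F N s 0" "Xs s = lvec r G N s 0"
      using F G(1) tt_tensor_lvec[OF ttF, of s] tt_tensor_lvec[OF ttG, of s]
      by (auto simp: tt_decomp_def tensor_idx_eq)
    then show "(\<Sum>b<r N. (lvec r F N s b - lvec r G N s b)\<^sup>2) = (X s - Xs s)\<^sup>2" using rN by simp
  qed
  have "(\<Sum>s\<in>idx d 0 k. \<Sum>t<d (Suc k). \<Sum>b<r (Suc k). (\<Sum>a<r k. ?e s a * G (Suc k) t $$ (a, b))\<^sup>2)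
    \<le> (\<Sum>s\<in>idx d 0 k. smax\<^sup>2 * (\<Sum>a<r k. (?e s a)\<^sup>2))"
  proof (rule sum_mono)
    fix s
    have "rvec N G k (u(Suc k := t)) a = G (Suc k) t $$ (a, 0)" if "t < d (Suc k)" "a < r k" for u t a
    proof -
      have "rvec N G k (u(Suc k := t)) a = (\<Sum>b<r (Suc k). G (Suc k) t $$ (a, b) * rvec N G (Suc k) (u(Suc k := t)) b)"
        using rvec_step[OF ttG, of k "u(Suc k := t)" a] that k by (simp add: le_Suc_eq)
      then show ?thesis using rN k rvec_last[of N] by simp
    qed
    then have "(\<Sum>t<d (Suc k). \<Sum>b<r (Suc k). (\<Sum>a<r k. ?e s a * G (Suc k) t $$ (a, b))\<^sup>2)
        = (\<Sum>u\<in>idx d k N. (\<Sum>a<r k. ?e s a * rvec N G k u a)\<^sup>2)"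
      using rN k by (simp add: sum_idx_Suc idx_self)
    also have "\<dots> \<le> smax\<^sup>2 * (\<Sum>a<r k. (?e s a)\<^sup>2)"
      using tail_bounds(2)[OF G, of k] k by (simp add: right_op_bound_def)
    finally show "(\<Sum>t<d (Suc k). \<Sum>b<r (Suc k). (\<Sum>a<r k. ?e s a * G (Suc k) t $$ (a, b))\<^sup>2)
      \<le> smax\<^sup>2 * (\<Sum>a<r k. (?e s a)\<^sup>2)" .
  qed
  also have "\<dots> = smax\<^sup>2 * frame_error G k" by (simp add: frame_error_def sum_distrib_left)
  finally show ?thesis using factor_norm_sq_diff_le[OF ttG, of k] E k by simp
qed

abbreviation "S \<equiv> real N + 1 + (\<Sum>i=2..N-1. real (r i))"

definition obj where
  "obj G = (\<Sum>i=1..N-1. smax\<^sup>2 * factor_norm_sq d r (factor_diff F G) i) + factor_norm_sq d r (factor_diff F G) N"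

lemma dist_objective_eq:
  assumes R: "rotations N r R"
  shows "dist_objective N d r Xs F Fs R = obj (rotate_factors R Fs)"
proof -
  let ?Y = "rotate_factors R Fs"
  have Y: "tt_factors N d r ?Y" by (rule tt_factors_rotate_factors[OF ttFs R])
  have D: "left_unf d r F i - left_unf_rot d r R Fs i = left_unf d r (factor_diff F ?Y) i" if "1 \<le> i" "i \<le> N" for i
    unfolding left_unf_rot_eq by (rule left_unf_diff[OF ttF Y that])
  show ?thesis
    unfolding dist_objective_def obj_def smax_def[symmetric] Let_def using N2
    by (intro arg_cong2[of _ _ _ _ "(+)"] sum.cong refl) (auto simp: D frob_norm_left_unf col_left_unf_last[where r = r and N = N, OF rN])
qed

lemma tt_dist_le:
  assumes small: "E < smin" and R: "is_arg_min (dist_objective N d r Xs F Fs) (rotations N r) R"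
  shows "obj (rotate_factors R Fs) \<le> 8 * S * (smax / smin)\<^sup>2 * E\<^sup>2"
    and "tt_dist N d r Xs F Fs = sqrt (obj (rotate_factors R Fs))"
proof -
  have Rr: "rotations N r R" and Rmin: "\<And>Q. rotations N r Q \<Longrightarrow> dist_objective N d r Xs F Fs R \<le> dist_objective N d r Xs F Fs Q"
    using R by (auto simp: is_arg_min_def not_less)
  have "(INF Q\<in>{Q. rotations N r Q}. dist_objective N d r Xs F Fs Q) = dist_objective N d r Xs F Fs R"
    by (rule cInf_eq_minimum) (use Rr Rmin in auto)
  then show "tt_dist N d r Xs F Fs = sqrt (obj (rotate_factors R Fs))"
    unfolding tt_dist_def dist_objective_eq[OF Rr] by simp
  obtain Q where Q: "rotations N r Q" and e2: "\<And>k. 1 \<le> k \<Longrightarrow> k < N \<Longrightarrow> frame_error (rotate_factors Q Fs) k \<le> 2 * (E\<^sup>2 / smin\<^sup>2)"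
    using exists_close_rotations[OF small] by blast
  let ?Y = "rotate_factors Q Fs"
  define x where "x = E\<^sup>2 / smin\<^sup>2"
  have x0: "0 \<le> x" by (simp add: x_def)
  have Y: "tt_decomp N d r ?Y Xs" by (rule tt_decomp_rotate_factors[OF Fs Q])
  then have ttY: "tt_factors N d r ?Y" by (simp add: tt_decomp_def)
  have loY: "left_orth_at d r ?Y i" if "1 \<le> i" "i < N" for i
    by (rule left_orth_at_rotate_factors[OF ttFs Q]) (use that loFs in auto)
  have sm: "smin \<le> smax" using tail_bounds(3)[OF Fs loFs, of 1] N2 by simp
  have "E\<^sup>2 = smin\<^sup>2 * x" using smin_pos by (simp add: x_def)
  also have "\<dots> \<le> smax\<^sup>2 * x" using sm smin_pos x0 by (intro mult_right_mono power_mono) auto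
  finally have Ex: "E\<^sup>2 \<le> smax\<^sup>2 * x" .
  \<comment> \<open>This is why the sum of ranks starts at mode 2.\<close>
  have e20: "frame_error ?Y 0 = 0" by (simp add: frame_error_def)
  have inner: "factor_norm_sq d r (factor_diff F ?Y) i \<le> 4 * x + 4 * x * (if i = 1 then 0 else real (r i))"
    if iN: "i \<in> {1..N-1}" for i
  proof -
    have iN': "1 \<le> i" "i < N" using iN N2 by auto
    obtain k where k: "i = Suc k" using iN' by (cases i) auto
    have b: "factor_norm_sq d r (factor_diff F ?Y) i \<le> 2 * frame_error ?Y i + 2 * real (r i) * frame_error ?Y k"
      unfolding k by (rule factor_norm_sq_diff_inner[OF ttY]) (use iN' k loY in auto)
    have "frame_error ?Y i \<le> 2 * x" using e2[of i] iN' by (simp add: x_def)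
    moreover have "2 * real (r i) * frame_error ?Y k \<le> 4 * x * (if i = 1 then 0 else real (r i))"
    proof (cases "k = 0")
      case False
      then have "frame_error ?Y k \<le> 2 * x" using e2[of k] iN' k by (simp add: x_def)
      then have "2 * real (r i) * frame_error ?Y k \<le> 2 * real (r i) * (2 * x)" by (intro mult_left_mono) auto
      then show ?thesis using False k by (simp add: mult_ac)
    qed (use k e20 in simp)
    ultimately show ?thesis using b by linarith
  qed
  have "(\<Sum>i=1..N-1. factor_norm_sq d r (factor_diff F ?Y) i) \<le> (\<Sum>i=1..N-1. 4 * x + 4 * x * (if i = 1 then 0 else real (r i)))"
    by (intro sum_mono inner)
  also have "\<dots> = 4 * x * (real N - 1 + (\<Sum>i=1..N-1. if i = 1 then 0 else real (r i)))"
    using N2 by (simp add: sum.distrib sum_distrib_left[symmetric] algebra_simps)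
  also have "(\<Sum>i=1..N-1. if i = 1 then 0 else real (r i)) = (\<Sum>i=2..N-1. real (r i))"
  proof -
    have "{1..N-1} = insert 1 {2..N-1}" using N2 by auto
    then show ?thesis by simp
  qed
  finally have sum: "(\<Sum>i=1..N-1. factor_norm_sq d r (factor_diff F ?Y) i) \<le> 4 * x * (S - 2)"
    by (simp add: algebra_simps)
  have "factor_norm_sq d r (factor_diff F ?Y) N \<le> 2 * E\<^sup>2 + 2 * smax\<^sup>2 * frame_error ?Y (N - 1)"
    by (rule factor_norm_sq_diff_last[OF Y loY])
  also have "\<dots> \<le> 2 * (smax\<^sup>2 * x) + 2 * smax\<^sup>2 * (2 * x)"
    using e2[of "N - 1"] N2 Ex by (intro add_mono mult_left_mono) (auto simp: x_def)
  finally have last: "factor_norm_sq d r (factor_diff F ?Y) N \<le> 6 * (smax\<^sup>2 * x)"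
    by (simp add: mult.commute)
  have "obj (rotate_factors R Fs) \<le> obj ?Y"
    using Rmin[OF Q] dist_objective_eq[OF Rr] dist_objective_eq[OF Q] by simp
  also have "obj ?Y \<le> smax\<^sup>2 * (4 * x * (S - 2)) + 6 * (smax\<^sup>2 * x)"
    unfolding obj_def sum_distrib_left[symmetric] using sum last by (intro add_mono mult_left_mono) auto
  also have "\<dots> = smax\<^sup>2 * x * (4 * S - 2)" by (simp add: algebra_simps)
  \<comment> \<open>Rounded up from \<open>4 * S - 2\<close>, so that the distance is at most
    \<open>2 * g * E\<close> with \<open>g = sqrt (2 * S) * (smax / smin)\<close>, the expression in
    the denominator of the claim.\<close>
  also have "\<dots> \<le> smax\<^sup>2 * x * (8 * S)"
    using x0 by (intro mult_left_mono) (auto intro!: sum_nonneg add_nonneg_nonneg)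
  also have "\<dots> = 8 * S * (smax / smin)\<^sup>2 * E\<^sup>2" by (simp add: x_def power_divide)
  finally show "obj (rotate_factors R Fs) \<le> 8 * S * (smax / smin)\<^sup>2 * E\<^sup>2" .
qed

end

section \<open>Telescoping\<close>

definition splice :: "factors \<Rightarrow> factors \<Rightarrow> nat \<Rightarrow> factors" where
  "splice F G j = (\<lambda>k. if k < j then F k else G k)"

lemma tt_factors_splice:
  "tt_factors N d r F \<Longrightarrow> tt_factors N d r G \<Longrightarrow> tt_factors N d r (splice F G j)"
  by (auto simp: tt_factors_def splice_def)

lemma tt_factors_upd:
  "tt_factors N d r F \<Longrightarrow> tt_factors N d r G \<Longrightarrow> tt_factors N d r (F(i := G i))"
  by (auto simp: tt_factors_def)

lemma tt_tensor_factor_diff: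
  assumes P: "tt_factors N d r P" and A: "tt_factors N d r A" and B: "tt_factors N d r B"
    and j: "1 \<le> j" "j \<le> N" and s: "s \<in> tensor_idx N d"
  shows "tt_tensor N (P(j := factor_diff A B j)) s = tt_tensor N (P(j := A j)) s - tt_tensor N (P(j := B j)) s"
proof -
  have sl: "\<And>k. 0 < k \<Longrightarrow> k \<le> N \<Longrightarrow> s k < d k"
    using s idx_less by (auto simp: tensor_idx_eq)
  have split: "tt_tensor N (P(j := Z j)) s
      = (\<Sum>a<r (j - 1). \<Sum>b<r j. lvec r P (j - 1) s a * Z j (s j) $$ (a, b) * rvec N P j s b)"
    if Z: "tt_factors N d r Z" for Z
  proof -
    have "lvec r (P(j := Z j)) (j - 1) s = lvec r P (j - 1) s" by (rule lvec_cong) (use j in auto)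
    moreover have "rvec N (P(j := Z j)) j s = rvec N P j s" by (rule rvec_cong) auto
    ultimately show ?thesis
      using tt_tensor_mid[OF tt_factors_upd[OF P Z, of j] sl j] by simp
  qed
  have fd: "factor_diff A B j (s j) $$ (a, b) = A j (s j) $$ (a, b) - B j (s j) $$ (a, b)"
    if "a < r (j - 1)" "b < r j" for a b
    using tt_factors_carrier[OF A j sl[of j]] tt_factors_carrier[OF B j sl[of j]] j that
    by (simp add: factor_diff_def)
  then show ?thesis
    unfolding split[OF A] split[OF B] split[OF tt_factors_factor_diff[OF A B]] sum_subtractf[symmetric]
    by (intro sum.cong refl) (simp add: left_diff_distrib right_diff_distrib)
qed

text \<open>The lower end is free because the identity is used twice: from 0, to expand
  \<open>X - Xs\<close>, and from \<open>i\<close>, after slot \<open>i\<close> of \<open>F\<close>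
  has been replaced by a difference.\<close>

lemma tt_tensor_telescope:
  assumes A: "tt_factors N d r A" and B: "tt_factors N d r B" and "i \<le> N" and s: "s \<in> tensor_idx N d"
  shows "tt_tensor N A s - tt_tensor N (splice A B (Suc i)) s
    = (\<Sum>j=Suc i..N. tt_tensor N ((splice A B j)(j := factor_diff A B j)) s)"
proof -
  define f where "f j = tt_tensor N ((splice A B j)(j := factor_diff A B j)) s" for j
  have "(\<Sum>j=Suc i..n. f j)
      = tt_tensor N (splice A B (Suc n)) s - tt_tensor N (splice A B (Suc i)) s" if "i \<le> n" "n \<le> N" for n
    using that
  proof (induction n rule: dec_induct)
    case base
    then show ?case by simp
  next
    case (step n)
    let ?P = "splice A B (Suc n)"
    have "?P(Suc n := A (Suc n)) = splice A B (Suc (Suc n))" "?P(Suc n := B (Suc n)) = ?P"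
      by (auto simp: splice_def fun_eq_iff less_Suc_eq)
    then have "f (Suc n)
      = tt_tensor N (splice A B (Suc (Suc n))) s - tt_tensor N ?P s"
      using tt_tensor_factor_diff[OF tt_factors_splice[OF A B] A B _ _ s, of "Suc n" "Suc n"] step by (simp add: f_def)
    then show ?case using step by simp
  qed
  from this[OF \<open>i \<le> N\<close> order_refl]
  have "(\<Sum>j=Suc i..N. f j) = tt_tensor N (splice A B (Suc N)) s - tt_tensor N (splice A B (Suc i)) s" .
  moreover have "tt_tensor N (splice A B (Suc N)) s = tt_tensor N A s"
    by (rule tt_tensor_cong) (auto simp: splice_def)
  ultimately show ?thesis unfolding f_def by (simp only:)
qed

lemma tensor_inner_add: "tensor_inner N d A (\<lambda>s. X s + Y s) = tensor_inner N d A X + tensor_inner N d A Y"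
  by (simp add: tensor_inner_def distrib_left sum.distrib)

lemma tensor_inner_diff: "tensor_inner N d A (\<lambda>s. X s - Y s) = tensor_inner N d A X - tensor_inner N d A Y"
  by (simp add: tensor_inner_def right_diff_distrib sum_subtractf)

lemma tensor_inner_sum: "tensor_inner N d A (\<lambda>s. \<Sum>i\<in>I. X i s) = (\<Sum>i\<in>I. tensor_inner N d A (X i))"
  unfolding tensor_inner_def sum_distrib_left by (rule sum.swap)

lemma tensor_inner_cong:
  "(\<And>s. s \<in> tensor_idx N d \<Longrightarrow> X s = Y s) \<Longrightarrow> tensor_inner N d A X = tensor_inner N d A Y"
  by (simp add: tensor_inner_def)

text \<open>From \<open>2 * a * b \<le> a\<^sup>2 + b\<^sup>2\<close>, since every index lies in
  \<open>n - 1\<close> pairs.\<close>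

lemma sum_pairs_le:
  fixes A :: "nat \<Rightarrow> real"
  shows "2 * (\<Sum>i=1..n. \<Sum>j=Suc i..n. A i * A j) \<le> (real n - 1) * (\<Sum>i=1..n. (A i)\<^sup>2)"
proof (induction n)
  case 0
  then show ?case by simp
next
  case (Suc n)
  have "(\<Sum>i=1..Suc n. \<Sum>j=Suc i..Suc n. A i * A j) = (\<Sum>i=1..n. (\<Sum>j=Suc i..n. A i * A j) + A i * A (Suc n))"
    by simp
  also have "\<dots> = (\<Sum>i=1..n. \<Sum>j=Suc i..n. A i * A j) + (\<Sum>i=1..n. A i * A (Suc n))"
    by (simp add: sum.distrib)
  finally have split: "(\<Sum>i=1..Suc n. \<Sum>j=Suc i..Suc n. A i * A j)
    = (\<Sum>i=1..n. \<Sum>j=Suc i..n. A i * A j) + (\<Sum>i=1..n. A i * A (Suc n))" .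
  have "2 * (\<Sum>i=1..n. A i * A (Suc n)) \<le> (\<Sum>i=1..n. (A i)\<^sup>2 + (A (Suc n))\<^sup>2)"
    unfolding sum_distrib_left
  proof (intro sum_mono)
    fix i
    show "2 * (A i * A (Suc n)) \<le> (A i)\<^sup>2 + (A (Suc n))\<^sup>2"
      using zero_le_power2[of "A i - A (Suc n)"] by (simp add: power2_eq_square algebra_simps)
  qed
  then have "2 * (\<Sum>i=1..n. A i * A (Suc n)) \<le> (\<Sum>i=1..n. (A i)\<^sup>2) + real n * (A (Suc n))\<^sup>2"
    by (simp add: sum.distrib)
  then show ?case unfolding split using Suc.IH by (simp add: algebra_simps)
qed

section \<open>Norms of the quadratic terms and the regularity estimate\<close>

context tt_pair
begin

lemma smax_pos: "0 < smax"
  using tail_bounds(3)[OF Fs loFs, of 1] N2 smin_pos by simp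

text \<open>A Weyl-type bound, since singular values are known for \<open>Xs\<close> but not for
  \<open>X\<close>. The image \<open>w\<close> of \<open>u\<close> under the left interface of
  \<open>F\<close> has the norm of \<open>u\<close> and turns the right interface of
  \<open>F\<close> into \<open>w\<^sup>T\<close> times the unfolding of \<open>X\<close>; splitting
  \<open>X\<close> as \<open>Xs + (X - Xs)\<close> gives the two summands.\<close>

lemma tail_F:
  assumes k: "1 \<le> k" "k < N"
  shows "right_op_bound N d r F k ((smax + E)\<^sup>2)"
  unfolding right_op_bound_def
proof
  fix u
  let ?I = "idx d 0 k" and ?J = "idx d k N"
  have kN: "k \<le> N" using k by simp
  define w where "w s = (\<Sum>a<r k. lvec r F k s a * u a)" for s
  define n where "n = (\<Sum>a<r k. (u a)\<^sup>2)"
  have w: "(\<Sum>s\<in>?I. (w s)\<^sup>2) = n"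
    unfolding w_def n_def by (rule sum_square_gram[OF finite_idx gramF[OF k(2)]])
  have n0: "0 \<le> n" unfolding n_def by (intro sum_nonneg) auto
  let ?p = "\<lambda>t. \<Sum>s\<in>?I. w s * Xs (merge k s t)" and ?q = "\<lambda>t. \<Sum>s\<in>?I. w s * (X (merge k s t) - Xs (merge k s t))"
  have wF: "(\<Sum>s\<in>?I. w s * lvec r F k s b) = u b" if "b < r k" for b
  proof -
    have "(\<Sum>s\<in>?I. w s * lvec r F k s b) = (\<Sum>s\<in>?I. \<Sum>a<r k. u a * (lvec r F k s a * lvec r F k s b))"
      by (simp add: w_def sum_distrib_left sum_distrib_right mult_ac)
    also have "\<dots> = (\<Sum>a<r k. \<Sum>s\<in>?I. u a * (lvec r F k s a * lvec r F k s b))" by (rule sum.swap)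
    also have "\<dots> = (\<Sum>a<r k. if a = b then u b else 0)"
      unfolding sum_distrib_left[symmetric] using gramF[OF k(2)] that by (intro sum.cong refl) auto
    finally show ?thesis using that by simp
  qed
  have val: "(\<Sum>s\<in>?I. w s * Z (merge k s t)) = (\<Sum>b<r k. (\<Sum>s\<in>?I. w s * lvec r G k s b) * rvec N G k t b)"
    if G: "tt_decomp N d r G Z" and t: "t \<in> ?J" for G Z t
  proof -
    have "(\<Sum>s\<in>?I. w s * Z (merge k s t)) = (\<Sum>s\<in>?I. \<Sum>b<r k. w s * lvec r G k s b * rvec N G k t b)"
      using decomp_merge[OF G kN _ t] by (simp add: sum_distrib_left mult.assoc)
    also have "\<dots> = (\<Sum>b<r k. \<Sum>s\<in>?I. w s * lvec r G k s b * rvec N G k t b)" by (rule sum.swap)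
    finally show ?thesis by (simp add: sum_distrib_right)
  qed
  have sum: "(\<Sum>a<r k. u a * rvec N F k t a) = ?p t + ?q t" if "t \<in> ?J" for t
    using val[OF F that] wF by (simp add: sum.distrib[symmetric] algebra_simps)
  have "(\<Sum>t\<in>?J. (?p t)\<^sup>2) = (\<Sum>t\<in>?J. (\<Sum>b<r k. (\<Sum>s\<in>?I. w s * lvec r Fs k s b) * rvec N Fs k t b)\<^sup>2)"
    using val[OF Fs] by simp
  also have "\<dots> \<le> smax\<^sup>2 * (\<Sum>b<r k. (\<Sum>s\<in>?I. w s * lvec r Fs k s b)\<^sup>2)"
    using tail_bounds(2)[OF Fs loFs k] by (simp add: right_op_bound_def)
  also have "\<dots> \<le> smax\<^sup>2 * n"
  proof (rule mult_left_mono)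
    have "(\<Sum>b<r k. (\<Sum>s\<in>?I. lvec r Fs k s b * w s)\<^sup>2) \<le> (\<Sum>s\<in>?I. (w s)\<^sup>2)"
      by (rule bessel[OF finite_idx gramFs[OF k(2)]])
    then show "(\<Sum>b<r k. (\<Sum>s\<in>?I. w s * lvec r Fs k s b)\<^sup>2) \<le> n" by (simp add: w mult.commute)
  qed simp
  finally have p: "(\<Sum>t\<in>?J. (?p t)\<^sup>2) \<le> smax\<^sup>2 * n" .
  have "(\<Sum>t\<in>?J. (?q t)\<^sup>2) \<le> (\<Sum>t\<in>?J. n * (\<Sum>s\<in>?I. (X (merge k s t) - Xs (merge k s t))\<^sup>2))"
    unfolding w[symmetric] by (intro sum_mono Cauchy_Schwarz_sum)
  also have "\<dots> = n * (\<Sum>s\<in>?I. \<Sum>t\<in>?J. (X (merge k s t) - Xs (merge k s t))\<^sup>2)"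
    by (subst sum.swap) (simp add: sum_distrib_left)
  also have "\<dots> = E\<^sup>2 * n"
    unfolding E_sq using kN by (subst sum_idx_split[of 0 k N]) simp_all
  finally have q: "(\<Sum>t\<in>?J. (?q t)\<^sup>2) \<le> E\<^sup>2 * n" .
  have "L2_set (\<lambda>t. \<Sum>a<r k. u a * rvec N F k t a) ?J = L2_set (\<lambda>t. ?p t + ?q t) ?J"
    by (rule L2_set_cong[OF refl]) (rule sum)
  also have "\<dots> \<le> L2_set ?p ?J + L2_set ?q ?J" by (rule L2_set_triangle_ineq)
  also have "\<dots> \<le> sqrt (smax\<^sup>2 * n) + sqrt (E\<^sup>2 * n)"
    unfolding L2_set_def using p q by (intro add_mono real_sqrt_le_mono)
  also have "\<dots> = (smax + E) * sqrt n"
    using smax_pos E_nonneg by (simp add: real_sqrt_mult distrib_right)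
  finally have "(L2_set (\<lambda>t. \<Sum>a<r k. u a * rvec N F k t a) ?J)\<^sup>2 \<le> ((smax + E) * sqrt n)\<^sup>2"
    by (rule power_mono) simp
  then show "(\<Sum>t\<in>?J. (\<Sum>a<r k. u a * rvec N F k t a)\<^sup>2) \<le> (smax + E)\<^sup>2 * (\<Sum>a<r k. (u a)\<^sup>2)"
    using n0 by (simp add: L2_set_def sum_nonneg power_mult_distrib n_def)
qed

text \<open>The left interface at \<open>i\<close>, an isometry, gets multiplied by
  \<open>K\<close>, whose Frobenius norm is at most the squared one of the left unfolding of
  \<open>D i\<close>. Factors of \<open>F\<close>, not of \<open>Xs\<close>, stand to the right of
  the slot: hence \<open>smax + E\<close>.\<close>

lemma norm_normal_term:
  assumes i: "1 \<le> i" "i < N" and Dt: "tt_factors N d r D"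
  defines "K \<equiv> transpose_mat (left_unf d r D i) * left_unf d r D i"
  shows "tensor_norm N d (tt_tensor N (F(i := \<lambda>t. F i t * K))) \<le> (smax + E) * factor_norm_sq d r D i"
proof -
  let ?L = "left_unf d r D i" and ?H = "F(i := \<lambda>t. F i t * K)"
  have L: "?L \<in> carrier_mat (d i * r (i - 1)) (r i)" by (rule left_unf_carrier)
  have K: "K \<in> carrier_mat (r i) (r i)" unfolding K_def using L by simp
  have iN: "i \<le> N" using i by simp
  have "F i t * K \<in> carrier_mat (r (i - 1)) (r i)" if "t < d i" for t
    by (rule mult_carrier_mat[OF tt_factors_carrier[OF ttF i(1) iN that] K])
  then have Ht: "tt_factors N d r ?H"
    using ttF by (auto simp: tt_factors_def)
  obtain k where k: "i = Suc k" using i by (cases i) auto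
  have lvH: "lvec r ?H i s b = (\<Sum>a<r i. lvec r F i s a * K $$ (a, b))" if s: "s \<in> idx d 0 i" and b: "b < r i" for s b
  proof -
    have si: "s i < d i" using idx_less[OF s] i by simp
    have lvk: "lvec r ?H k s = lvec r F k s" by (rule lvec_cong) (use k in auto)
    have "lvec r ?H i s b = (\<Sum>c<r k. lvec r F k s c * (F i (s i) * K) $$ (c, b))"
      using k lvk by simp
    also have "\<dots> = (\<Sum>c<r k. \<Sum>a<r i. lvec r F k s c * F i (s i) $$ (c, a) * K $$ (a, b))"
      using tt_factors_carrier[OF ttF i(1) iN si] k b
      by (intro sum.cong refl) (subst mult_mat_index_sum[OF _ K], auto simp: sum_distrib_left mult.assoc)
    also have "\<dots> = (\<Sum>a<r i. \<Sum>c<r k. lvec r F k s c * F i (s i) $$ (c, a) * K $$ (a, b))" by (rule sum.swap)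
    finally show ?thesis using k by (simp add: sum_distrib_right)
  qed
  have "left_frob_sq d r ?H i = (\<Sum>s\<in>idx d 0 i. \<Sum>b<r i. (\<Sum>a<r i. lvec r F i s a * K $$ (a, b))\<^sup>2)"
    unfolding left_frob_sq_def by (intro sum.cong refl) (simp add: lvH)
  also have "\<dots> = (\<Sum>b<r i. \<Sum>s\<in>idx d 0 i. (\<Sum>a<r i. lvec r F i s a * K $$ (a, b))\<^sup>2)" by (rule sum.swap)
  also have "\<dots> = (\<Sum>b<r i. \<Sum>a<r i. (K $$ (a, b))\<^sup>2)"
    by (rule sum.cong[OF refl]) (rule sum_square_gram[OF finite_idx gramF[OF i(2)]])
  also have "\<dots> \<le> (\<Sum>b<r i. \<Sum>a<r i. (\<Sum>p<d i * r (i - 1). (?L $$ (p, a))\<^sup>2) * (\<Sum>p<d i * r (i - 1). (?L $$ (p, b))\<^sup>2))"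
  proof (intro sum_mono)
    fix a b assume ab: "a \<in> {..<r i}" "b \<in> {..<r i}"
    have "K $$ (a, b) = (\<Sum>p<d i * r (i - 1). ?L $$ (p, a) * ?L $$ (p, b))"
      unfolding K_def using ab L
      by (subst mult_mat_index_sum[of _ "r i" "d i * r (i - 1)" _ "r i"]) (auto simp: carrier_matD[OF L])
    then show "(K $$ (a, b))\<^sup>2 \<le> (\<Sum>p<d i * r (i - 1). (?L $$ (p, a))\<^sup>2) * (\<Sum>p<d i * r (i - 1). (?L $$ (p, b))\<^sup>2)"
      by (simp add: Cauchy_Schwarz_sum)
  qed
  also have "\<dots> = (\<Sum>b<r i. \<Sum>p<d i * r (i - 1). (?L $$ (p, b))\<^sup>2)\<^sup>2"
    by (simp only: sum_distrib_left[symmetric] sum_distrib_right[symmetric] power2_eq_square)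
  also have "(\<Sum>b<r i. \<Sum>p<d i * r (i - 1). (?L $$ (p, b))\<^sup>2) = factor_norm_sq d r D i"
  proof -
    have "factor_norm_sq d r D i = frob_inner ?L ?L" by (simp only: frob_norm_left_unf[symmetric] frob_norm_sq)
    then show ?thesis
      unfolding frob_inner_def carrier_matD[OF L] power2_eq_square by (simp only:) (rule sum.swap)
  qed
  finally have left_frob_sq: "left_frob_sq d r ?H i \<le> (factor_norm_sq d r D i)\<^sup>2" .
  have "rvec N ?H i s = rvec N F i s" for s by (rule rvec_cong) auto
  then have "right_op_bound N d r ?H i ((smax + E)\<^sup>2)" using tail_F[OF i] by (simp add: right_op_bound_def)
  from tensor_norm_tt_le[OF Ht iN this]
  have "(tensor_norm N d (tt_tensor N ?H))\<^sup>2 \<le> (smax + E)\<^sup>2 * (factor_norm_sq d r D i)\<^sup>2"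
    using mult_left_mono[OF left_frob_sq, of "(smax + E)\<^sup>2"] by simp
  also have "\<dots> = ((smax + E) * factor_norm_sq d r D i)\<^sup>2" by (simp add: power_mult_distrib)
  finally show ?thesis
    using smax_pos E_nonneg factor_norm_sq_nonneg[of d r D i] by (simp add: power2_le_iff_abs_le tensor_norm_nonneg)
qed

text \<open>Read from left to right: orthogonal factors are free, slots \<open>i\<close> and
  \<open>j\<close> cost their Frobenius norms, and the part behind \<open>j\<close> costs
  \<open>smax\<close>, or nothing if \<open>j = N\<close>. The weights \<open>w\<close> cover both
  cases at once, and their squares are the summands of \<open>obj\<close>.\<close>

lemma norm_mixed_term:
  assumes ij: "1 \<le> i" "i < j" "j \<le> N" and Dt: "tt_factors N d r D"
    and Y: "tt_decomp N d r Y Xs" "\<And>i. 1 \<le> i \<Longrightarrow> i < N \<Longrightarrow> left_orth_at d r Y i"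
  defines "w \<equiv> \<lambda>i. (if i < N then smax else 1) * sqrt (factor_norm_sq d r D i)"
  shows "tensor_norm N d (tt_tensor N ((splice (F(i := D i)) Y j)(j := D j))) \<le> w i * w j / smax"
proof -
  let ?G = "(splice (F(i := D i)) Y j)(j := D j)"
  have ttY: "tt_factors N d r Y" using Y(1) by (simp add: tt_decomp_def)
  have G: "tt_factors N d r ?G"
    by (intro tt_factors_upd tt_factors_splice ttF ttY Dt)
  have loG: "left_orth_at d r ?G k" if "1 \<le> k" "k < j" "k \<noteq> i" for k
    using loF[of k] that ij by (simp add: splice_def left_orth_at_def)
  have Gi: "factor_norm_sq d r ?G i = factor_norm_sq d r D i" and Gj: "factor_norm_sq d r ?G j = factor_norm_sq d r D j"
    using ij by (auto simp: splice_def factor_norm_sq_def)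
  obtain i' where i': "i = Suc i'" using ij by (cases i) auto
  obtain j' where j': "j = Suc j'" using ij by (cases j) auto
  have "left_op_bound d r ?G i' 1" by (rule left_op_bound_left_orthogonal[where r = r, OF r0]) (use loG i' ij in auto)
  from left_frob_sq_Suc_le[OF this] have "left_frob_sq d r ?G i \<le> factor_norm_sq d r D i" using Gi i' by simp
  then have "left_op_bound d r ?G i (factor_norm_sq d r D i)" by (rule left_op_bound_of_frob)
  then have "left_op_bound d r ?G j' (factor_norm_sq d r D i)"
    by (rule left_op_bound_range) (use loG j' ij in auto)
  from left_frob_sq_Suc_le[OF this] have left_frob_sq: "left_frob_sq d r ?G j \<le> factor_norm_sq d r D i * factor_norm_sq d r D j" using Gj j' by simp
  define c where "c = (if j < N then smax else 1)"
  have c0: "0 < c" using smax_pos by (simp add: c_def)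
  have "right_op_bound N d r ?G j (c\<^sup>2)"
  proof (cases "j < N")
    case True
    have "rvec N ?G j s = rvec N Y j s" for s by (rule rvec_cong) (auto simp: splice_def)
    then show ?thesis using tail_bounds(2)[OF Y, of j] True ij by (simp add: right_op_bound_def c_def)
  next
    case False
    then show ?thesis using right_op_bound_last[where r = r, OF rN] ij by (simp add: c_def)
  qed
  from tensor_norm_tt_le[OF G ij(3) this]
  have "(tensor_norm N d (tt_tensor N ?G))\<^sup>2 \<le> c\<^sup>2 * (factor_norm_sq d r D i * factor_norm_sq d r D j)"
    using mult_left_mono[OF left_frob_sq, of "c\<^sup>2"] by simp
  also have "\<dots> = (c * (sqrt (factor_norm_sq d r D i) * sqrt (factor_norm_sq d r D j)))\<^sup>2"
    by (simp add: power_mult_distrib factor_norm_sq_nonneg)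
  finally have "tensor_norm N d (tt_tensor N ?G) \<le> c * (sqrt (factor_norm_sq d r D i) * sqrt (factor_norm_sq d r D j))"
    by (rule power2_le_imp_le) (use c0 factor_norm_sq_nonneg in auto)
  also have "\<dots> = w i * w j / smax"
    unfolding w_def c_def using ij smax_pos by simp
  finally show ?thesis .
qed

lemma regularity:
  assumes R: "rotations N r R" and small: "2 * E \<le> smax"
    and sharp: "sharpness N d r m A Xs out \<delta>" and y: "\<And>k. k < m \<Longrightarrow> y k = tensor_inner N d (A k) Xs + out k"
    and rip: "\<And>G. tt_factors N d r G \<Longrightarrow>
      1 / real m * (\<Sum>k<m. \<bar>tensor_inner N d (A k) (tt_tensor N G)\<bar>) \<le> \<rho> * tensor_norm N d (tt_tensor N G)"
    and rho: "0 \<le> \<rho>"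
  defines "c \<equiv> (1 - 2 * outlier_fraction m out) * sqrt (2 / pi) - \<delta>"
  shows "(\<Sum>i=1..N. frob_inner (left_unf d r F i - left_unf_rot d r R Fs i)
            (tangent_proj N d r F i (subgrad N d r m A y F i)))
    \<ge> c * E - \<rho> * ((2 * real N + 1) / 4) * obj (rotate_factors R Fs) / smax"
proof -
  let ?Y = "rotate_factors R Fs"
  let ?D = "factor_diff F ?Y"
  have Y: "tt_decomp N d r ?Y Xs" by (rule tt_decomp_rotate_factors[OF Fs R])
  then have ttY: "tt_factors N d r ?Y" by (simp add: tt_decomp_def)
  have loY: "left_orth_at d r ?Y i" if "1 \<le> i" "i < N" for i
    by (rule left_orth_at_rotate_factors[OF ttFs R]) (use that loFs in auto)
  have D: "tt_factors N d r ?D" by (rule tt_factors_factor_diff[OF ttF ttY])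
  have unfD: "left_unf d r F i - left_unf_rot d r R Fs i = left_unf d r ?D i" if "1 \<le> i" "i \<le> N" for i
    unfolding left_unf_rot_eq by (rule left_unf_diff[OF ttF ttY that])
  define sg where "sg k = sgn (tensor_inner N d (A k) (tt_tensor N F) - y k)" for k
  have sg1: "\<bar>sg k\<bar> \<le> 1" for k by (simp add: sg_def sgn_real_def)
  \<comment> \<open>With the signs frozen at \<open>F\<close>, this is a linear functional, and the
    RIP bounds it on each single tensor in TT format.\<close>
  define T where "T Z = 1 / real m * (\<Sum>k<m. sg k * tensor_inner N d (A k) Z)" for Z
  have T_sum: "T (\<lambda>s. \<Sum>i\<in>I. Z i s) = (\<Sum>i\<in>I. T (Z i))" for I and Z :: "nat \<Rightarrow> tensor"
    unfolding T_def tensor_inner_sum sum_distrib_left by (rule sum.swap)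
  have T_add: "T (\<lambda>s. Z s + Z' s) = T Z + T Z'" for Z Z'
    by (simp add: T_def tensor_inner_add distrib_left sum.distrib)
  have T_cong: "T Z = T Z'" if "\<And>s. s \<in> tensor_idx N d \<Longrightarrow> Z s = Z' s" for Z Z'
    unfolding T_def using tensor_inner_cong[OF that] by simp
  have T_bound: "\<bar>T (tt_tensor N G)\<bar> \<le> \<rho> * tensor_norm N d (tt_tensor N G)" if "tt_factors N d r G" for G
  proof -
    have "\<bar>T (tt_tensor N G)\<bar> = 1 / real m * \<bar>\<Sum>k<m. sg k * tensor_inner N d (A k) (tt_tensor N G)\<bar>"
      by (simp add: T_def abs_mult)
    also have "\<dots> \<le> 1 / real m * (\<Sum>k<m. \<bar>sg k * tensor_inner N d (A k) (tt_tensor N G)\<bar>)"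
      by (intro mult_left_mono sum_abs) auto
    also have "\<dots> \<le> 1 / real m * (\<Sum>k<m. \<bar>tensor_inner N d (A k) (tt_tensor N G)\<bar>)"
      using sg1 by (intro mult_left_mono sum_mono) (auto simp: abs_mult intro: mult_left_le_one_le)
    finally show ?thesis using rip[OF that] by linarith
  qed
  define n where "n i = factor_norm_sq d r ?D i" for i
  have n0: "0 \<le> n i" for i by (simp add: n_def factor_norm_sq_nonneg)
  define w where "w i = (if i < N then smax else 1) * sqrt (n i)" for i
  have obj: "obj ?Y = (\<Sum>i=1..N. (w i)\<^sup>2)"
  proof -
    have "{1..N} = insert N {1..N-1}" using N2 by auto
    then have "(\<Sum>i=1..N. (w i)\<^sup>2) = (w N)\<^sup>2 + (\<Sum>i=1..N-1. (w i)\<^sup>2)"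
      using N2 by simp
    moreover have "(w i)\<^sup>2 = smax\<^sup>2 * n i" if "i \<in> {1..N-1}" for i
      using that N2 n0[of i] by (auto simp: w_def power_mult_distrib)
    moreover have "(w N)\<^sup>2 = n N" using n0[of N] by (simp add: w_def)
    ultimately show ?thesis by (simp add: obj_def n_def)
  qed
  let ?M = "\<lambda>i j. (splice (F(i := ?D i)) ?Y j)(j := ?D j)"
  let ?K = "\<lambda>i. transpose_mat (left_unf d r ?D i) * left_unf d r ?D i"
  let ?Z = "\<lambda>i. F(i := \<lambda>t. F i t * ?K i)"
  have K: "?K i \<in> carrier_mat (r i) (r i)" for i using left_unf_carrier[of d r ?D i] by simp
  have ttZ: "tt_factors N d r (?Z i)" if "1 \<le> i" "i \<le> N" for i
  proof -
    have "F i t * ?K i \<in> carrier_mat (r (i - 1)) (r i)" if "t < d i" for t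
      by (rule mult_carrier_mat[OF tt_factors_carrier[OF ttF \<open>1 \<le> i\<close> \<open>i \<le> N\<close> that] K])
    then show ?thesis using ttF by (auto simp: tt_factors_def)
  qed
  have Dsub: "frob_inner (left_unf d r ?D i) (subgrad N d r m A y F i) = T (tt_tensor N (F(i := ?D i)))"
    if "1 \<le> i" "i \<le> N" for i
    unfolding T_def sg_def by (rule frob_inner_subgrad[where Z = ?D and i = i, OF ttF tt_factors_upd[OF ttF D] that])
  have summand: "frob_inner (left_unf d r F i - left_unf_rot d r R Fs i) (tangent_proj N d r F i (subgrad N d r m A y F i))
    = T (tt_tensor N (F(i := ?D i))) - (if i < N then 1/2 * T (tt_tensor N (?Z i)) else 0)"
    if i: "1 \<le> i" "i \<le> N" for i
  proof (cases "i = N")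
    case True
    then show ?thesis using i unfD[OF i] Dsub[OF i] by (simp add: tangent_proj_def)
  next
    case False
    then have iN: "i < N" using i by simp
    let ?L = "left_unf d r F i" and ?DL = "left_unf d r ?D i" and ?U = "subgrad N d r m A y F i"
    have U: "?U \<in> carrier_mat (d i * r (i - 1)) (r i)" by (simp add: subgrad_def vstack_def)
    have LD: "?L - ?DL = left_unf d r ?Y i"
      unfolding unfD[OF i, symmetric] left_unf_rot_eq
      by (rule eq_matI) (auto simp: carrier_matD[OF left_unf_carrier])
    have LL: "transpose_mat ?L * ?L = 1\<^sub>m (r i)" using loF[OF i(1) iN] by (simp add: left_orth_at_iff)
    have YY: "transpose_mat (?L - ?DL) * (?L - ?DL) = 1\<^sub>m (r i)"
      unfolding LD using loY[OF i(1) iN] by (simp add: left_orth_at_iff)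
    have "frob_inner ?DL (tangent_proj N d r F i ?U) = frob_inner ?DL ?U - 1/2 * frob_inner (?L * ?K i) ?U"
      unfolding tangent_proj_def using False
      by (simp only: if_False)
        (rule frob_inner_tangent_proj[where L = ?L and D = ?DL, OF left_unf_carrier left_unf_carrier U LL YY])
    also have "frob_inner (?L * ?K i) ?U = T (tt_tensor N (?Z i))"
    proof -
      have "?L * ?K i = left_unf d r (?Z i) i" by (rule left_unf_mult[OF ttF i K])
      moreover have Zi: "F(i := (?Z i) i) = ?Z i" by simp
      have "tt_factors N d r (F(i := (?Z i) i))" unfolding Zi by (rule ttZ[OF i])
      from frob_inner_subgrad[where Z = "?Z i" and m = m and A = A and y = y, OF ttF this i]
      have "frob_inner (left_unf d r (?Z i) i) ?U = T (tt_tensor N (?Z i))"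
        unfolding Zi T_def sg_def .
      ultimately show ?thesis by simp
    qed
    finally show ?thesis unfolding unfD[OF i] using Dsub[OF i] iN by simp
  qed
  have first: "(\<Sum>i=1..N. T (tt_tensor N (F(i := ?D i))))
      = T (\<lambda>s. X s - Xs s) + (\<Sum>i=1..N. \<Sum>j=Suc i..N. T (tt_tensor N (?M i j)))"
  proof -
    have "(\<Sum>i=1..N. T (tt_tensor N (F(i := ?D i)))) = T (\<lambda>s. \<Sum>i=1..N. tt_tensor N (F(i := ?D i)) s)"
      by (rule T_sum[symmetric])
    also have "\<dots> = T (\<lambda>s. (X s - Xs s) + (\<Sum>i=1..N. \<Sum>j=Suc i..N. tt_tensor N (?M i j) s))"
    proof (rule T_cong)
      fix s assume s: "s \<in> tensor_idx N d"
      have "X s - Xs s = tt_tensor N F s - tt_tensor N (splice F ?Y (Suc 0)) s"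
      proof -
        have "tt_tensor N (splice F ?Y (Suc 0)) s = tt_tensor N ?Y s"
          by (rule tt_tensor_cong) (auto simp: splice_def)
        then show ?thesis using F Y s by (simp add: tt_decomp_def)
      qed
      also have "\<dots> = (\<Sum>i=1..N. tt_tensor N ((splice F ?Y i)(i := ?D i)) s)"
        using tt_tensor_telescope[OF ttF ttY le0 s] by simp
      finally have A: "X s - Xs s = (\<Sum>i=1..N. tt_tensor N ((splice F ?Y i)(i := ?D i)) s)" .
      \<comment> \<open>Right of slot \<open>i\<close> the derivative has factors of
        \<open>F\<close>, whereas the expansion of \<open>X - Xs\<close> has those of
        \<open>?Y\<close>; a second telescoping measures the gap.\<close>
      have "tt_tensor N (F(i := ?D i)) s - tt_tensor N ((splice F ?Y i)(i := ?D i)) s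
          = (\<Sum>j=Suc i..N. tt_tensor N (?M i j) s)" if i: "i \<in> {1..N}" for i
      proof -
        let ?H = "F(i := ?D i)"
        have H: "tt_factors N d r ?H" by (rule tt_factors_upd[OF ttF D])
        have "tt_tensor N (splice ?H ?Y (Suc i)) s = tt_tensor N ((splice F ?Y i)(i := ?D i)) s"
          by (rule tt_tensor_cong) (auto simp: splice_def)
        moreover have "factor_diff ?H ?Y j = ?D j" if "j \<noteq> i" for j
          using that by (auto simp: factor_diff_def fun_eq_iff)
        ultimately show ?thesis
          using tt_tensor_telescope[OF H ttY _ s, of i] i by simp
      qed
      then have "(\<Sum>i=1..N. \<Sum>j=Suc i..N. tt_tensor N (?M i j) s)
        = (\<Sum>i=1..N. tt_tensor N (F(i := ?D i)) s - tt_tensor N ((splice F ?Y i)(i := ?D i)) s)"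
        by (intro sum.cong refl) simp
      then show "(\<Sum>i=1..N. tt_tensor N (F(i := ?D i)) s)
        = (X s - Xs s) + (\<Sum>i=1..N. \<Sum>j=Suc i..N. tt_tensor N (?M i j) s)"
        unfolding A by (simp add: sum_subtractf)
    qed
    also have "\<dots> = T (\<lambda>s. X s - Xs s) + (\<Sum>i=1..N. \<Sum>j=Suc i..N. T (tt_tensor N (?M i j)))"
      unfolding T_add T_sum ..
    finally show ?thesis .
  qed
  have sharpT: "c * E \<le> T (\<lambda>s. X s - Xs s)"
  proof -
    have "in_tt_format N d r X" using F by (auto simp: in_tt_format_def)
    then have "c * E \<le> 1 / real m * (\<Sum>k<m. \<bar>tensor_inner N d (A k) (\<lambda>s. X s - Xs s) - out k\<bar>) - 1 / real m * (\<Sum>k<m. \<bar>out k\<bar>)"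
      using sharp unfolding sharpness_def c_def E_def by blast
    also have "\<dots> = 1 / real m * (\<Sum>k<m. \<bar>tensor_inner N d (A k) (\<lambda>s. X s - Xs s) - out k\<bar> - \<bar>out k\<bar>)"
      by (simp add: sum_subtractf right_diff_distrib diff_divide_distrib)
    also have "\<dots> \<le> T (\<lambda>s. X s - Xs s)"
      unfolding T_def
    proof (intro mult_left_mono sum_mono)
      fix k assume "k \<in> {..<m}"
      moreover have "tensor_inner N d (A k) (tt_tensor N F) = tensor_inner N d (A k) X"
        using F by (intro tensor_inner_cong) (simp add: tt_decomp_def)
      ultimately have "sg k = sgn (tensor_inner N d (A k) (\<lambda>s. X s - Xs s) - out k)"
        using y by (simp add: sg_def tensor_inner_diff diff_diff_eq)
      \<comment> \<open>The subgradient inequality of the absolute value between the residual and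
        minus the outlier; it holds at the kink too.\<close>
      then show "\<bar>tensor_inner N d (A k) (\<lambda>s. X s - Xs s) - out k\<bar> - \<bar>out k\<bar> \<le> sg k * tensor_inner N d (A k) (\<lambda>s. X s - Xs s)"
        by (auto simp: sgn_real_def)
    qed simp
    finally show ?thesis .
  qed
  have mixed: "- (\<Sum>i=1..N. \<Sum>j=Suc i..N. T (tt_tensor N (?M i j))) \<le> \<rho> / smax * ((real N - 1) / 2 * obj ?Y)"
  proof -
    have "- (\<Sum>i=1..N. \<Sum>j=Suc i..N. T (tt_tensor N (?M i j))) = (\<Sum>i=1..N. \<Sum>j=Suc i..N. - T (tt_tensor N (?M i j)))"
      by (simp add: sum_negf)
    also have "\<dots> \<le> (\<Sum>i=1..N. \<Sum>j=Suc i..N. \<rho> / smax * (w i * w j))"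
    proof (intro sum_mono)
      fix i j assume ij: "i \<in> {1..N}" "j \<in> {Suc i..N}"
      have "tt_factors N d r (?M i j)" by (intro tt_factors_upd tt_factors_splice ttF ttY D)
      then have "- T (tt_tensor N (?M i j)) \<le> \<rho> * tensor_norm N d (tt_tensor N (?M i j))"
        using T_bound by fastforce
      also have "\<dots> \<le> \<rho> * (w i * w j / smax)"
        using norm_mixed_term[OF _ _ _ D Y loY, of i j] ij rho
        by (intro mult_left_mono) (auto simp: w_def n_def)
      finally show "- T (tt_tensor N (?M i j)) \<le> \<rho> / smax * (w i * w j)" by simp
    qed
    also have "\<dots> = \<rho> / smax * (\<Sum>i=1..N. \<Sum>j=Suc i..N. w i * w j)" by (simp only: sum_distrib_left)
    also have "\<dots> \<le> \<rho> / smax * ((real N - 1) / 2 * obj ?Y)"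
      using sum_pairs_le[of w N] rho smax_pos unfolding obj by (intro mult_left_mono) auto
    finally show ?thesis .
  qed
  have normal: "(\<Sum>i=1..N. if i < N then 1/2 * T (tt_tensor N (?Z i)) else 0) \<le> \<rho> / smax * (3/4 * obj ?Y)"
  proof -
    have "(\<Sum>i=1..N. if i < N then 1/2 * T (tt_tensor N (?Z i)) else 0) \<le> (\<Sum>i=1..N. \<rho> / smax * (3/4 * (w i)\<^sup>2))"
    proof (intro sum_mono)
      fix i assume i: "i \<in> {1..N}"
      show "(if i < N then 1/2 * T (tt_tensor N (?Z i)) else 0) \<le> \<rho> / smax * (3/4 * (w i)\<^sup>2)"
      proof (cases "i < N")
        case True
        have "T (tt_tensor N (?Z i)) \<le> \<rho> * tensor_norm N d (tt_tensor N (?Z i))"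
          using T_bound[OF ttZ] i by fastforce
        also have "\<dots> \<le> \<rho> * ((smax + E) * n i)"
          using norm_normal_term[OF _ True D] i rho by (intro mult_left_mono) (auto simp: n_def)
        also have "\<dots> \<le> \<rho> * (3/2 * smax * n i)"
          using small rho n0[of i] by (intro mult_left_mono mult_right_mono) auto
        finally have "1/2 * T (tt_tensor N (?Z i)) \<le> \<rho> * (3/4 * smax * n i)" by simp
        also have "\<dots> = \<rho> / smax * (3/4 * (w i)\<^sup>2)"
          using True smax_pos n0[of i] by (simp add: w_def power_mult_distrib power2_eq_square)
        finally show ?thesis using True by simp
      next
        case False
        then show ?thesis using rho smax_pos by simp
      qed
    qed
    then show ?thesis unfolding obj by (simp only: sum_distrib_left)
  qed
  have "(\<Sum>i=1..N. frob_inner (left_unf d r F i - left_unf_rot d r R Fs i)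
            (tangent_proj N d r F i (subgrad N d r m A y F i)))
    = (\<Sum>i=1..N. T (tt_tensor N (F(i := ?D i)))) - (\<Sum>i=1..N. if i < N then 1/2 * T (tt_tensor N (?Z i)) else 0)"
    unfolding sum_subtractf[symmetric] by (intro sum.cong refl summand) auto
  moreover have "\<rho> * ((2 * real N + 1) / 4) * obj ?Y / smax
      = \<rho> / smax * ((real N - 1) / 2 * obj ?Y) + \<rho> / smax * (3/4 * obj ?Y)"
    using smax_pos by (simp add: field_simps)
  ultimately show ?thesis using first sharpT mixed normal by linarith
qed

end

section \<open>Scalar inequalities that exploit the radius \<open>b\<close>\<close>

lemma radius_small:
  fixes smin smax E c \<rho> S q :: real
  assumes smin: "0 < smin" "smin \<le> smax" and c: "0 \<le> c" "c \<le> \<rho>" "0 < \<rho>" and S: "1 \<le> S" and q: "1 \<le> q"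
    and E: "0 \<le> E" "E\<^sup>2 \<le> smin ^ 4 * c\<^sup>2 / (144 * q * S\<^sup>2 * \<rho>\<^sup>2 * smax\<^sup>2)"
  shows "12 * E \<le> smin"
proof -
  \<comment> \<open>The radius is \<open>smin\<^sup>2 / 144\<close> times quotients that
    \<open>h1\<close> and \<open>h2\<close> show to be at most 1; 144 is the square of 12.\<close>
  have h1: "c\<^sup>2 * smin\<^sup>2 \<le> \<rho>\<^sup>2 * smax\<^sup>2"
    using smin c by (intro mult_mono power_mono) auto
  have h2: "1 \<le> q * S\<^sup>2" using S q mult_mono[of 1 q 1 "S\<^sup>2"] by simp
  have "c\<^sup>2 * smin\<^sup>2 * 1 \<le> (\<rho>\<^sup>2 * smax\<^sup>2) * (q * S\<^sup>2)"
    by (rule mult_mono[OF h1 h2]) auto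
  then have "smin\<^sup>2 * (c\<^sup>2 * smin\<^sup>2) \<le> smin\<^sup>2 * ((\<rho>\<^sup>2 * smax\<^sup>2) * (q * S\<^sup>2))"
    by (intro mult_left_mono) auto
  then have "smin ^ 4 * c\<^sup>2 \<le> smin\<^sup>2 / 144 * (144 * q * S\<^sup>2 * \<rho>\<^sup>2 * smax\<^sup>2)"
    by (simp add: power4_eq_xxxx power2_eq_square mult_ac)
  moreover have "0 < 144 * q * S\<^sup>2 * \<rho>\<^sup>2 * smax\<^sup>2" using assms by simp
  ultimately have "smin ^ 4 * c\<^sup>2 / (144 * q * S\<^sup>2 * \<rho>\<^sup>2 * smax\<^sup>2) \<le> smin\<^sup>2 / 144"
    by (simp only: pos_divide_le_eq)
  with E(2) have "E\<^sup>2 \<le> smin\<^sup>2 / 144" by (rule order_trans)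
  then have "(12 * E)\<^sup>2 \<le> smin\<^sup>2" by (simp add: power_mult_distrib)
  then show ?thesis by (rule power2_le_imp_le) (use smin in simp)
qed

text \<open>With \<open>g = sqrt (2 * S) * (smax / smin)\<close>, the bound on
  \<open>\<Delta>\<close> gives \<open>c * \<Delta> / (2 * g) \<le> c * E\<close>. Half of this is
  the conclusion; the other half pays for the quadratic term, which amounts to
  \<open>\<rho> * (2 * n + 1) * g * \<Delta> \<le> c * smax\<close>. Squaring that inequality makes
  the radius applicable.\<close>

lemma quadratic_terms_absorbed:
  fixes smin smax E \<Delta> c \<rho> S n q :: real
  assumes smin: "0 < smin" "smin \<le> smax" and c: "0 \<le> c" "0 < \<rho>" and S: "1 \<le> S" and n: "2 \<le> n"
    and q: "q = 2 * n\<^sup>2 - 2 * n + 1"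
    and E: "0 \<le> E" "E\<^sup>2 \<le> smin ^ 4 * c\<^sup>2 / (144 * q * S\<^sup>2 * \<rho>\<^sup>2 * smax\<^sup>2)"
    and \<Delta>: "0 \<le> \<Delta>" "\<Delta>\<^sup>2 \<le> 8 * S * (smax / smin)\<^sup>2 * E\<^sup>2"
  shows "c / (4 * sqrt (2 * S) * (smax / smin)) * \<Delta> \<le> c * E - \<rho> * ((2 * n + 1) / 4) * \<Delta>\<^sup>2 / smax"
proof -
  define g where "g = sqrt (2 * S) * (smax / smin)"
  have smax: "0 < smax" using smin by simp
  have g: "0 < g" using S smin smax by (simp add: g_def)
  define k where "k = (smax / smin)\<^sup>2"
  have g2: "g\<^sup>2 = 2 * S * k" using S unfolding g_def power_mult_distrib k_def by simp
  have \<Delta>g: "\<Delta>\<^sup>2 \<le> 4 * g\<^sup>2 * E\<^sup>2" using \<Delta>(2) unfolding g2 k_def[symmetric] by simp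
  \<comment> \<open>The difference of the sides is \<open>(n - 2) * (14 * n + 6) + 20\<close>. The 9
    is what is left of 144 after division by 16, the coefficient produced by
    \<open>4 * g ^ 4\<close>.\<close>
  have qn: "(2 * n + 1)\<^sup>2 \<le> 9 * q"
  proof -
    have "0 \<le> (n - 2) * (14 * n + 6)" using n by (intro mult_nonneg_nonneg) auto
    then show ?thesis unfolding q using n by (simp add: power2_eq_square algebra_simps)
  qed
  have "0 < (2 * n + 1)\<^sup>2" using n by simp
  then have q0: "0 < q" using qn by linarith
  have "\<Delta>\<^sup>2 \<le> (2 * g * E)\<^sup>2" using \<Delta>g by (simp add: power_mult_distrib)
  then have \<Delta>E: "\<Delta> \<le> 2 * g * E" by (rule power2_le_imp_le) (use g E in simp)
  have "(\<rho> * (2 * n + 1) * g * \<Delta>)\<^sup>2 = \<rho>\<^sup>2 * (2 * n + 1)\<^sup>2 * g\<^sup>2 * \<Delta>\<^sup>2" by (simp add: power_mult_distrib)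
  also have "\<dots> \<le> \<rho>\<^sup>2 * (2 * n + 1)\<^sup>2 * g\<^sup>2 * (4 * g\<^sup>2 * E\<^sup>2)"
    by (rule mult_left_mono[OF \<Delta>g]) simp
  also have "\<dots> \<le> \<rho>\<^sup>2 * (2 * n + 1)\<^sup>2 * g\<^sup>2 * (4 * g\<^sup>2 * (smin ^ 4 * c\<^sup>2 / (144 * q * S\<^sup>2 * \<rho>\<^sup>2 * smax\<^sup>2)))"
    using E(2) by (intro mult_left_mono) auto
  also have "\<dots> = (2 * n + 1)\<^sup>2 * (smax\<^sup>2 * c\<^sup>2 / (9 * q))"
  proof -
    have k: "k * k * smin ^ 4 = smax\<^sup>2 * smax\<^sup>2"
      using smin by (simp add: k_def power_divide power4_eq_xxxx power2_eq_square)
    have "\<rho>\<^sup>2 * (2 * n + 1)\<^sup>2 * g\<^sup>2 * (4 * g\<^sup>2 * (smin ^ 4 * c\<^sup>2 / (144 * q * S\<^sup>2 * \<rho>\<^sup>2 * smax\<^sup>2)))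
      = (16 * S\<^sup>2 * \<rho>\<^sup>2 * (2 * n + 1)\<^sup>2 * c\<^sup>2) * (k * k * smin ^ 4) / (144 * q * S\<^sup>2 * \<rho>\<^sup>2 * smax\<^sup>2)"
      unfolding g2 power2_eq_square[of S] by (simp add: mult_ac)
    also have "\<dots> = (2 * n + 1)\<^sup>2 * (smax\<^sup>2 * c\<^sup>2 / (9 * q))"
      unfolding k using smax c S q0 by (simp add: divide_simps mult_ac)
    finally show ?thesis .
  qed
  also have "\<dots> \<le> 9 * q * (smax\<^sup>2 * c\<^sup>2 / (9 * q))"
    using qn q0 by (intro mult_right_mono) auto
  also have "\<dots> = (c * smax)\<^sup>2" using q0 by (simp add: power_mult_distrib mult.commute)
  finally have "\<rho> * (2 * n + 1) * g * \<Delta> \<le> c * smax"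
    by (rule power2_le_imp_le) (use c smax in simp)
  then have "\<rho> * (2 * n + 1) * g * \<Delta> * \<Delta> \<le> c * smax * \<Delta>" using \<Delta> by (intro mult_right_mono)
  then have f1: "\<rho> * ((2 * n + 1) / 4) * \<Delta>\<^sup>2 / smax \<le> c * \<Delta> / (4 * g)"
    using g smax by (simp add: field_simps power2_eq_square)
  have f2: "c * \<Delta> / (2 * g) \<le> c * E"
    using mult_left_mono[OF \<Delta>E c(1)] g by (simp add: field_simps)
  have f3: "c * \<Delta> / (4 * g) + c * \<Delta> / (4 * g) = c * \<Delta> / (2 * g)" using g by (simp add: field_simps)
  have f4: "c / (4 * sqrt (2 * S) * (smax / smin)) * \<Delta> = c * \<Delta> / (4 * g)" by (simp add: g_def mult.assoc)
  have "a \<le> e - x" if "x \<le> a" "w \<le> e" "a + a = w" for a e x w :: real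
    using that by linarith
  from this[OF f1 f2 f3] show ?thesis unfolding f4 .
qed

section \<open>Vanishing ranks and the assembly of the estimate\<close>

lemma frob_inner_empty:
  "dim_row A = 0 \<or> dim_col A = 0 \<Longrightarrow> frob_inner A B = 0"
  by (auto simp: frob_inner_def)

text \<open>Cut at an interface of width 0, every entry of the tensor is an empty sum.\<close>

lemma zero_rank_all_ranks_zero:
  assumes Fs: "tt_decomp N d r Fs Xs" and ranks: "has_tt_ranks N d r Xs" and i: "i \<le> N" "r i = 0"
    and j: "j \<in> {1..N-1}"
  shows "r j = 0"
proof -
  have Xs0: "Xs s = 0" if s: "s \<in> tensor_idx N d" for s
  proof -
    have "tt_tensor N Fs s = (\<Sum>a<r i. lvec r Fs i s a * rvec N Fs i s a)"
      by (rule tt_tensor_split[of N d]) (use Fs s i idx_less in \<open>auto simp: tt_decomp_def tensor_idx_eq\<close>)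
    then show ?thesis using Fs s i by (simp add: tt_decomp_def)
  qed
  let ?M = "unfolding_mat N d j Xs"
  have jN: "j \<le> N" using j by auto
  have "?M $$ (p, q) = (\<Sum>k\<in>{}. (\<lambda>_ _. 0) k p * (\<lambda>_ _. 0) k q)" if "p < dim_row ?M" "q < dim_col ?M" for p q
  proof -
    have pq: "p < (\<Prod>j\<in>{Suc 0..j}. d j)" "q < (\<Prod>j\<in>{Suc j..N}. d j)" using that by (auto simp: unfolding_mat_def)
    have "unfold_idx N d j p q \<in> tensor_idx N d"
      unfolding unfold_idx_merge[OF jN] tensor_idx_eq
      by (rule merge_in_idx[OF digits_in_idx[OF pq(1)] digits_in_idx[OF pq(2)]]) (use jN in auto)
    then show ?thesis using pq Xs0 by (simp add: unfolding_mat_def)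
  qed
  then have "vec_space.rank (dim_row ?M) ?M \<le> card ({} :: nat set)"
    by (intro rank_le_card_of_sum[where f = "\<lambda>_ _. 0" and g = "\<lambda>_ _. 0" and q = "dim_col ?M"]) auto
  then show ?thesis using ranks j by (simp add: has_tt_ranks_def mat_rank_def)
qed

theorem lemma5:
  fixes N m rbar :: nat
    and d r :: "nat \<Rightarrow> nat"
    and Xs X :: tensor
    and Fs F :: factors
    and A :: "nat \<Rightarrow> tensor"
    and out y :: "nat \<Rightarrow> real"
    and ps \<delta> b :: real
    and R :: "nat \<Rightarrow> real mat"
  assumes "N \<ge> 2"
    and "tt_decomp N d r Fs Xs"
    and "left_orthogonal N d r Fs"
    and "has_tt_ranks N d r Xs"
    and "rbar = Max (r ` {1..N-1})"
    and "ps = outlier_fraction m out"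
    and "\<And>k. k < m \<Longrightarrow> y k = tensor_inner N d (A k) Xs + out k"
    and "l1l2_rip N d m A ((N + 1) * rbar) \<delta>"
    and "sharpness N d r m A Xs out \<delta>"
    and "\<delta> \<le> (1 - 2 * ps) * sqrt (2 / pi)"
    and "b = (sigma_min N d r Xs) ^ 4 * ((1 - 2 * ps) * sqrt (2 / pi) - \<delta>)\<^sup>2 /
          (144 * (2 * (real N)\<^sup>2 - 2 * real N + 1) *
           (real N + 1 + (\<Sum>i=2..N-1. real (r i)))\<^sup>2 *
           (sqrt (2 / pi) + \<delta>)\<^sup>2 * (sigma_max N d Xs)\<^sup>2)"
    and "tt_decomp N d r F X"
    and "left_orthogonal N d r F"
    and "(tensor_norm N d (\<lambda>s. X s - Xs s))\<^sup>2 \<le> b"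
    and "is_arg_min (dist_objective N d r Xs F Fs) (rotations N r) R"
  shows "(\<Sum>i=1..N. frob_inner (left_unf d r F i - left_unf_rot d r R Fs i)
            (tangent_proj N d r F i (subgrad N d r m A y F i)))
         \<ge> ((1 - 2 * ps) * sqrt (2 / pi) - \<delta>) /
            (4 * sqrt (2 * (real N + 1 + (\<Sum>i=2..N-1. real (r i)))) * tt_kappa N d r Xs)
            * tt_dist N d r Xs F Fs"
proof (cases "\<forall>i\<in>{1..N-1}. 0 < r i")
  case True
  interpret tt_pair N d r Xs X Fs F
    using assms(1-4,12,13) True by unfold_locales auto
  define c where "c = (1 - 2 * ps) * sqrt (2 / pi) - \<delta>"
  define \<rho> where "\<rho> = sqrt (2 / pi) + \<delta>"
  define q where "q = 2 * (real N)\<^sup>2 - 2 * real N + 1"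
  have \<delta>: "0 < \<delta>" using assms(8) by (simp add: l1l2_rip_def)
  have "0 \<le> ps" by (simp add: assms(6) outlier_fraction_def)
  \<comment> \<open>This yields \<open>c \<le> \<rho>\<close>, without which the radius would not
    bound \<open>E\<close> in terms of \<open>smin\<close>.\<close>
  then have "(1 - 2 * ps) * sqrt (2 / pi) \<le> 1 * sqrt (2 / pi)" by (intro mult_right_mono) auto
  then have c: "0 \<le> c" "c \<le> \<rho>" using assms(10) \<delta> unfolding c_def \<rho>_def by linarith+
  have \<rho>: "0 < \<rho>" unfolding \<rho>_def using \<delta> by (intro add_nonneg_pos) auto
  have S: "1 \<le> S" by (simp add: sum_nonneg)
  have q1: "1 \<le> q"
  proof -
    have "0 \<le> 2 * real N * (real N - 1)" using N2 by (intro mult_nonneg_nonneg) auto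
    then show ?thesis by (simp add: q_def power2_eq_square algebra_simps)
  qed
  have sm: "smin \<le> smax" using tail_bounds(3)[OF Fs loFs, of 1] N2 by simp
  have Eb: "E\<^sup>2 \<le> smin ^ 4 * c\<^sup>2 / (144 * q * S\<^sup>2 * \<rho>\<^sup>2 * smax\<^sup>2)"
    using assms(14) unfolding assms(11) E_def smin_def smax_def c_def \<rho>_def q_def .
  have E12: "12 * E \<le> smin" by (rule radius_small[OF smin_pos sm c \<rho> S q1 E_nonneg Eb])
  then have small: "E < smin" "2 * E \<le> smax" using E_nonneg smin_pos sm by linarith+
  note Rmin = assms(15)
  have R: "rotations N r R" using Rmin by (simp add: is_arg_min_def)
  have dist: "tt_dist N d r Xs F Fs = sqrt (obj (rotate_factors R Fs))" by (rule tt_dist_le(2)[OF small(1) Rmin])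
  have obj0: "0 \<le> obj (rotate_factors R Fs)"
    unfolding obj_def by (intro add_nonneg_nonneg sum_nonneg mult_nonneg_nonneg factor_norm_sq_nonneg) auto
  have \<Delta>: "0 \<le> tt_dist N d r Xs F Fs" "(tt_dist N d r Xs F Fs)\<^sup>2 = obj (rotate_factors R Fs)"
    unfolding dist using obj0 by auto
  have rip: "1 / real m * (\<Sum>k<m. \<bar>tensor_inner N d (A k) (tt_tensor N G)\<bar>) \<le> \<rho> * tensor_norm N d (tt_tensor N G)"
    if "tt_factors N d r G" for G
  proof -
    have "in_tt_format N d r (tt_tensor N G)" using that by (auto simp: in_tt_format_def tt_decomp_def)
    moreover have "r i \<le> (N + 1) * rbar" if "i \<in> {1..N-1}" for i
    proof -
      have "r i \<le> rbar" unfolding assms(5) using that by (intro Max_ge) auto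
      then show ?thesis by simp
    qed
    ultimately show ?thesis using assms(8) unfolding l1l2_rip_def \<rho>_def by blast
  qed
  have "c / (4 * sqrt (2 * S) * (smax / smin)) * tt_dist N d r Xs F Fs
      \<le> c * E - \<rho> * ((2 * real N + 1) / 4) * (tt_dist N d r Xs F Fs)\<^sup>2 / smax"
    by (rule quadratic_terms_absorbed[OF smin_pos sm c(1) \<rho> S _ q_def E_nonneg Eb \<Delta>(1)])
      (use N2 tt_dist_le(1)[OF small(1) Rmin] \<Delta>(2) in auto)
  also have "\<dots> \<le> (\<Sum>i=1..N. frob_inner (left_unf d r F i - left_unf_rot d r R Fs i)
            (tangent_proj N d r F i (subgrad N d r m A y F i)))"
    unfolding \<Delta>(2) c_def assms(6)
    by (rule regularity[OF R small(2) assms(9) assms(7) rip less_imp_le[OF \<rho>]])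
  finally show ?thesis unfolding c_def tt_kappa_def smin_def smax_def .
next
  text \<open>A vanishing rank forces \<open>Xs = 0\<close>, hence all ranks vanish and every matrix is empty: both sides
    are \<open>0\<close>, whatever the junk values of the singular values.\<close>
  case False
  then obtain i where i: "i \<in> {1..N-1}" "r i = 0" by auto
  then have r0: "r j = 0" if "j \<in> {1..N-1}" for j
    using zero_rank_all_ranks_zero[OF assms(2,4) _ i(2) that] by auto
  let ?D = "\<lambda>j. left_unf d r F j - left_unf_rot d r R Fs j"
  have dims: "dim_row (?D j) = 0 \<or> dim_col (?D j) = 0" if "j \<in> {1..N}" for j
  proof (cases "j = N")
    case True
    \<comment> \<open>The last left unfolding keeps its single column, as \<open>r N = 1\<close>; it
      is empty because it has \<open>d N * r (N - 1)\<close> rows.\<close>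
    have "N - 1 \<in> {1..N-1}" using assms(1) by simp
    then have "r (N - 1) = 0" by (rule r0)
    then show ?thesis using True by (simp add: left_unf_rot_eq carrier_matD[OF left_unf_carrier])
  next
    case False
    then have "r j = 0" using r0[of j] that by auto
    then show ?thesis by (simp add: left_unf_rot_eq carrier_matD[OF left_unf_carrier])
  qed
  have R: "rotations N r R"
    and Rmin: "\<And>Q. rotations N r Q \<Longrightarrow> dist_objective N d r Xs F Fs R \<le> dist_objective N d r Xs F Fs Q"
    using assms(15) by (auto simp: is_arg_min_def not_less)
  have "(INF Q\<in>{Q. rotations N r Q}. dist_objective N d r Xs F Fs Q) = dist_objective N d r Xs F Fs R"
    by (rule cInf_eq_minimum) (use R Rmin in auto)
  also have "\<dots> = 0"
  proof -
    have "dim_row (?D N) = 0"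
      using r0[of "N - 1"] assms(1) by (simp add: left_unf_rot_eq carrier_matD[OF left_unf_carrier])
    then have "(let v = col (?D N) 0 in v \<bullet> v) = 0" by (simp add: scalar_prod_def Let_def)
    moreover have "frob_norm (?D j) = 0" if "j \<in> {1..N-1}" for j
      using dims[of j] that by (auto simp: frob_norm_def frob_inner_empty)
    ultimately show ?thesis unfolding dist_objective_def by simp
  qed
  finally have "tt_dist N d r Xs F Fs = 0" by (simp add: tt_dist_def)
  \<comment> \<open>\<open>frob_inner\<close> sums over the dimensions of its first argument, so the
    projected subgradient need not be examined.\<close>
  moreover have "(\<Sum>i=1..N. frob_inner (?D i) (tangent_proj N d r F i (subgrad N d r m A y F i))) = 0"
    using dims by (intro sum.neutral ballI frob_inner_empty)
  ultimately show ?thesis by simp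
qed

end
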